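(* Let $G_1$ and $G_2$ be $2$-connected tightly two-face-embeddable cubic graphs, let $e_i$ be an odd edge of $G_i$ ($i=1,2$), and let $G$ be an odd $2$-sum of $G_1$ and $G_2$ with respect to $e_1$ and $e_2$. Then $G$ is $2$-connected and tightly two-face-embeddable.
   Context: A cubic graph is $3$-regular; multiple edges allowed. For connected $G$, $\beta(G)=|E(G)|-|V(G)|+1$; $\gamma_M(G)$ is the largest genus of a closed orientable surface on which $G$ has a cellular embedding; $\xi(G)=\beta(G)-2\gamma_M(G)$. $G$ is upper-embeddable if $\xi(G)\le1$; an upper-embeddable cubic graph with odd $\beta$ is two-face-embeddable. In an upper-embeddable cubic graph $G$, a pair $\{x,y\}$ of distinct vertices is removable if $x,y$ are joined by exactly one edge, $xy$ is not a bridge, and $G-\{x,y\}$ is (connected and) upper-embeddable; a two-face-embeddable cubic graph is tightly two-face-embeddable if it has no removable pair. For a spanning tree $T$, the cotree is $G-E(T)$; a cotree component is odd if it has an odd number of edges; $T$ is a Xuong tree if its cotree has exactly $\xi(G)$ odd components. An edge $e$ of a tightly two-face-embeddable cubic graph $G$ is odd if there is a Xuong tree $T$ of $G$ such that the unique odd component of $G-E(T)$ consists of the single edge $e$. Odd $2$-sum: given such $G_1,G_2$ with odd edges $e_1,e_2$, form $(G_1-e_1)\cup(G_2-e_2)$ and add two independent edges $f_1,f_2$, each joining a $2$-valent vertex of $G_1-e_1$ to a $2$-valent vertex of $G_2-e_2$, so that the result is cubic. *)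

theory Defs
  imports Main
begin

section \<open>Finite multigraphs (loops and parallel edges allowed)\<close>

record ('v, 'e) mgraph =
  verts :: "'v set"
  edges :: "'e set"
  ends  :: "'e \<Rightarrow> 'v \<times> 'v"

definition wf_graph :: "('v,'e) mgraph \<Rightarrow> bool" where
  "wf_graph G \<longleftrightarrow> finite (verts G) \<and> finite (edges G) \<and>
     (\<forall>e \<in> edges G. fst (ends G e) \<in> verts G \<and> snd (ends G e) \<in> verts G)"

definition joins :: "('v,'e) mgraph \<Rightarrow> 'e \<Rightarrow> 'v \<Rightarrow> 'v \<Rightarrow> bool" where
  "joins G e x y \<longleftrightarrow> ends G e = (x, y) \<or> ends G e = (y, x)"

text \<open>Degree: a loop contributes 2.\<close>
definition deg :: "('v,'e) mgraph \<Rightarrow> 'v \<Rightarrow> nat" where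
  "deg G v = card {e \<in> edges G. fst (ends G e) = v} + card {e \<in> edges G. snd (ends G e) = v}"

definition cubic :: "('v,'e) mgraph \<Rightarrow> bool" where
  "cubic G \<longleftrightarrow> wf_graph G \<and> (\<forall>v \<in> verts G. deg G v = 3)"

definition adj :: "('v,'e) mgraph \<Rightarrow> ('v \<times> 'v) set" where
  "adj G = {(x, y). \<exists>e \<in> edges G. joins G e x y}"

definition connected_graph :: "('v,'e) mgraph \<Rightarrow> bool" where
  "connected_graph G \<longleftrightarrow> verts G \<noteq> {} \<and>
     (\<forall>x \<in> verts G. \<forall>y \<in> verts G. (x, y) \<in> (adj G)\<^sup>*)"

definition delete_verts :: "('v,'e) mgraph \<Rightarrow> 'v set \<Rightarrow> ('v,'e) mgraph" where
  "delete_verts G X = \<lparr> verts = verts G - X,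
     edges = {e \<in> edges G. fst (ends G e) \<notin> X \<and> snd (ends G e) \<notin> X},
     ends = ends G \<rparr>"

definition delete_edges :: "('v,'e) mgraph \<Rightarrow> 'e set \<Rightarrow> ('v,'e) mgraph" where
  "delete_edges G F = \<lparr> verts = verts G, edges = edges G - F, ends = ends G \<rparr>"

text \<open>2-connected (Diestel): more than 2 vertices and no set of fewer than 2 vertices disconnects.\<close>
definition two_connected :: "('v,'e) mgraph \<Rightarrow> bool" where
  "two_connected G \<longleftrightarrow> card (verts G) \<ge> 3 \<and> connected_graph G \<and>
     (\<forall>v \<in> verts G. connected_graph (delete_verts G {v}))"

definition is_bridge :: "('v,'e) mgraph \<Rightarrow> 'e \<Rightarrow> bool" where
  "is_bridge G e \<longleftrightarrow> e \<in> edges G \<and> \<not> connected_graph (delete_edges G {e})"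

text \<open>Cycle rank (Betti number).\<close>
definition betti :: "('v,'e) mgraph \<Rightarrow> int" where
  "betti G = int (card (edges G)) - int (card (verts G)) + 1"

section \<open>Orientable cellular embeddings as rotation systems\<close>

type_synonym 'e dart = "'e \<times> bool"

definition darts :: "('v,'e) mgraph \<Rightarrow> 'e dart set" where
  "darts G = edges G \<times> UNIV"

definition dtail :: "('v,'e) mgraph \<Rightarrow> 'e dart \<Rightarrow> 'v" where
  "dtail G d = (if snd d then fst (ends G (fst d)) else snd (ends G (fst d)))"

definition dflip :: "'e dart \<Rightarrow> 'e dart" where
  "dflip d = (fst d, \<not> snd d)"

text \<open>A rotation system: a permutation of the darts which, at every vertex,
  cyclically permutes the darts leaving that vertex.\<close>
definition rotation_system :: "('v,'e) mgraph \<Rightarrow> ('e dart \<Rightarrow> 'e dart) \<Rightarrow> bool" where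
  "rotation_system G \<rho> \<longleftrightarrow> bij_betw \<rho> (darts G) (darts G) \<and>
     (\<forall>d \<in> darts G. dtail G (\<rho> d) = dtail G d) \<and>
     (\<forall>d \<in> darts G. \<forall>d' \<in> darts G. dtail G d = dtail G d' \<longrightarrow> (\<exists>n. (\<rho> ^^ n) d = d'))"

definition orbit_of :: "('a \<Rightarrow> 'a) \<Rightarrow> 'a \<Rightarrow> 'a set" where
  "orbit_of f x = {(f ^^ n) x | n. True}"

text \<open>Faces of the embedding = orbits of the face-tracing permutation.\<close>
definition num_faces :: "('v,'e) mgraph \<Rightarrow> ('e dart \<Rightarrow> 'e dart) \<Rightarrow> nat" where
  "num_faces G \<rho> = card (orbit_of (\<rho> \<circ> dflip) ` darts G)"

text \<open>Genus of the embedding via Euler's formula V - E + F = 2 - 2g.\<close>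
definition emb_genus :: "('v,'e) mgraph \<Rightarrow> ('e dart \<Rightarrow> 'e dart) \<Rightarrow> int" where
  "emb_genus G \<rho> = (2 - int (card (verts G)) + int (card (edges G)) - int (num_faces G \<rho>)) div 2"

definition max_genus :: "('v,'e) mgraph \<Rightarrow> int" where
  "max_genus G = Max {emb_genus G \<rho> | \<rho>. rotation_system G \<rho>}"

definition xi :: "('v,'e) mgraph \<Rightarrow> int" where
  "xi G = betti G - 2 * max_genus G"

definition upper_embeddable :: "('v,'e) mgraph \<Rightarrow> bool" where
  "upper_embeddable G \<longleftrightarrow> wf_graph G \<and> connected_graph G \<and> xi G \<le> 1"

definition two_face_embeddable :: "('v,'e) mgraph \<Rightarrow> bool" where
  "two_face_embeddable G \<longleftrightarrow> cubic G \<and> upper_embeddable G \<and> odd (betti G)"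

definition removable_pair :: "('v,'e) mgraph \<Rightarrow> 'v \<Rightarrow> 'v \<Rightarrow> bool" where
  "removable_pair G x y \<longleftrightarrow> x \<in> verts G \<and> y \<in> verts G \<and> x \<noteq> y \<and>
     card {e \<in> edges G. joins G e x y} = 1 \<and>
     (\<forall>e \<in> edges G. joins G e x y \<longrightarrow> \<not> is_bridge G e) \<and>
     upper_embeddable (delete_verts G {x, y})"

definition tightly_two_face_embeddable :: "('v,'e) mgraph \<Rightarrow> bool" where
  "tightly_two_face_embeddable G \<longleftrightarrow> two_face_embeddable G \<and>
     \<not> (\<exists>x y. removable_pair G x y)"

section \<open>Spanning trees, cotrees, Xuong trees\<close>

text \<open>A tree is a connected graph without cycles, i.e. in which every edge is a bridge.\<close>
definition spanning_tree :: "('v,'e) mgraph \<Rightarrow> 'e set \<Rightarrow> bool" where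
  "spanning_tree G T \<longleftrightarrow> T \<subseteq> edges G \<and>
     connected_graph (delete_edges G (edges G - T)) \<and>
     (\<forall>e \<in> T. is_bridge (delete_edges G (edges G - T)) e)"

definition cotree :: "('v,'e) mgraph \<Rightarrow> 'e set \<Rightarrow> ('v,'e) mgraph" where
  "cotree G T = delete_edges G T"

text \<open>Vertex set of the connected component of H containing v, and its edges.\<close>
definition comp_verts :: "('v,'e) mgraph \<Rightarrow> 'v \<Rightarrow> 'v set" where
  "comp_verts H v = {w \<in> verts H. (v, w) \<in> (adj H)\<^sup>*}"

definition comp_edges :: "('v,'e) mgraph \<Rightarrow> 'v set \<Rightarrow> 'e set" where
  "comp_edges H C = {e \<in> edges H. fst (ends H e) \<in> C}"

definition odd_components :: "('v,'e) mgraph \<Rightarrow> 'v set set" where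
  "odd_components H = {C. \<exists>v \<in> verts H. C = comp_verts H v \<and> odd (card (comp_edges H C))}"

definition xuong_tree :: "('v,'e) mgraph \<Rightarrow> 'e set \<Rightarrow> bool" where
  "xuong_tree G T \<longleftrightarrow> spanning_tree G T \<and>
     int (card (odd_components (cotree G T))) = xi G"

definition odd_edge :: "('v,'e) mgraph \<Rightarrow> 'e \<Rightarrow> bool" where
  "odd_edge G e \<longleftrightarrow> tightly_two_face_embeddable G \<and> e \<in> edges G \<and>
     (\<exists>T. xuong_tree G T \<and> e \<notin> T \<and>
        odd_components (cotree G T) = {comp_verts (cotree G T) (fst (ends G e))} \<and>
        comp_edges (cotree G T) (comp_verts (cotree G T) (fst (ends G e))) = {e})"

section \<open>Odd 2-sum\<close>

definition odd_two_sum ::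
  "('v,'e) mgraph \<Rightarrow> 'e \<Rightarrow> ('v,'e) mgraph \<Rightarrow> 'e \<Rightarrow> ('v,'e) mgraph \<Rightarrow> bool" where
  "odd_two_sum G1 e1 G2 e2 G \<longleftrightarrow>
     odd_edge G1 e1 \<and> odd_edge G2 e2 \<and>
     verts G1 \<inter> verts G2 = {} \<and> edges G1 \<inter> edges G2 = {} \<and>
     verts G = verts G1 \<union> verts G2 \<and>
     (\<exists>f1 f2. f1 \<noteq> f2 \<and> f1 \<notin> edges G1 \<union> edges G2 \<and> f2 \<notin> edges G1 \<union> edges G2 \<and>
        edges G = (edges G1 - {e1}) \<union> (edges G2 - {e2}) \<union> {f1, f2} \<and>
        (\<forall>e \<in> edges G1 - {e1}. ends G e = ends G1 e) \<and>
        (\<forall>e \<in> edges G2 - {e2}. ends G e = ends G2 e) \<and>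
        (\<forall>f \<in> {f1, f2}. \<exists>x y. joins G f x y \<and>
            x \<in> verts G1 \<and> deg (delete_edges G1 {e1}) x = 2 \<and>
            y \<in> verts G2 \<and> deg (delete_edges G2 {e2}) y = 2) \<and>
        {fst (ends G f1), snd (ends G f1)} \<inter> {fst (ends G f2), snd (ends G f2)} = {} \<and>
        cubic G)"

end

theory Submission
  imports Defs "HOL-Combinatorics.Permutations"
begin

text \<open>
  \<^emph>\<open>Embedding the sum.\<close> If \<open>T\<^sub>i\<close> is a Xuong tree of \<open>G\<^sub>i\<close> whose odd cotree component is
  \<open>{e\<^sub>i}\<close>, then \<open>T\<^sub>1 \<union> T\<^sub>2 \<union> {f\<^sub>1}\<close> is a spanning tree of \<open>G\<close>. A tree embeds with one face, and
  adding two adjacent edges at a common vertex can be done keeping one face. The cotree edges other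
  than \<open>f\<^sub>2\<close> lie in even components and hence split into such pairs, so \<open>G - f\<^sub>2\<close> has a
  one-face embedding; inserting \<open>f\<^sub>2\<close> gives two faces.

  \<^emph>\<open>Tightness.\<close> If \<open>{x, y}\<close> were removable, \<open>G - {x, y}\<close> would have a one-face embedding.
  When \<open>x\<close> and \<open>y\<close> both lie in \<open>G\<^sub>1\<close>, cutting this embedding along the surviving edges among
  \<open>f\<^sub>1, f\<^sub>2\<close> and, if both survive, replacing the part in \<open>G\<^sub>2\<close> by \<open>e\<^sub>1\<close>, yields an embedding of
  \<open>G\<^sub>1 - {x, y}\<close> with at most two faces, hence with one face by parity; so \<open>{x, y}\<close> is removable
  in \<open>G\<^sub>1\<close>. When \<open>xy = f\<^sub>1\<close>, the same cut gives a one-face embedding of \<open>G\<^sub>1 - x\<close>, whose cycle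
  rank is odd, contradicting parity.
\<close>

section \<open>Orbits\<close>

text \<open>Parity carries the proof. As \<open>xi\<close> has the parity of the cycle rank,
  upper-embeddability means at most one face for even rank and at most two for odd rank. Deleting a
  removable pair from a cubic graph changes the parity of the rank, which is why a one-face
  embedding is available there. The parity of the number of faces comes from signs: the face
  permutation is the rotation composed with edge reversal.

  Every surgery is a composition with a transposition, which either merges two cycles or splits one.
  Two things do not fit rotation systems: isolated vertices, which carry no dart, and cut edges, of
  which only one half remains. Both are modelled by dangling half-edges, and a first return map
  skips these, or the whole far side of a cut.

  An even cotree component is split into adjacent pairs by assigning every edge to one of its ends
  so that each vertex receives an even number of edges.

  The pair of both attachment vertices in \<open>G1\<close> escapes the cutting argument, since
  neither \<open>f1\<close> nor \<open>f2\<close> survives; it is excluded because its deletion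
  disconnects the sum.\<close>

definition same_orbit :: "('a \<Rightarrow> 'a) \<Rightarrow> 'a \<Rightarrow> 'a \<Rightarrow> bool" where
  "same_orbit f x y \<longleftrightarrow> (\<exists>n. (f ^^ n) x = y)"

lemma orbit_of_eq: "orbit_of f x = {y. same_orbit f x y}"
  by (auto simp: orbit_of_def same_orbit_def)

lemma same_orbit_refl [simp]: "same_orbit f x x"
  unfolding same_orbit_def by (rule exI[of _ 0]) simp

lemma same_orbit_trans: "same_orbit f x y \<Longrightarrow> same_orbit f y z \<Longrightarrow> same_orbit f x z"
  unfolding same_orbit_def by (metis funpow_add comp_apply)

lemma same_orbit_step: "same_orbit f x y \<Longrightarrow> same_orbit f x (f y)"
  unfolding same_orbit_def by (metis funpow.simps(2) comp_apply)

lemma same_orbit_apply: "same_orbit f x (f x)"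
  by (rule same_orbit_step) simp

lemma same_orbit_induct [consumes 1, case_names refl step]:
  assumes "same_orbit f x y" and "P x" and "\<And>z. same_orbit f x z \<Longrightarrow> P z \<Longrightarrow> P (f z)"
  shows "P y"
proof -
  have "P ((f ^^ n) x)" for n
    by (induction n) (use assms(2,3) in \<open>auto simp: same_orbit_def\<close>)
  then show ?thesis using assms(1) by (auto simp: same_orbit_def)
qed

lemma funpow_closed: "f ` D \<subseteq> D \<Longrightarrow> x \<in> D \<Longrightarrow> (f ^^ n) x \<in> D"
  by (induction n) auto

lemma same_orbit_closed: "f ` D \<subseteq> D \<Longrightarrow> x \<in> D \<Longrightarrow> same_orbit f x y \<Longrightarrow> y \<in> D"
  by (auto simp: same_orbit_def funpow_closed)

lemma funpow_cong_on:
  assumes "f ` D \<subseteq> D" and "\<And>x. x \<in> D \<Longrightarrow> f x = g x" and "x \<in> D"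
  shows "(f ^^ n) x = (g ^^ n) x"
proof (induction n)
  case (Suc n)
  then show ?case using assms(2)[OF funpow_closed[OF assms(1,3), of n]] by simp
qed simp

lemma same_orbit_cong_on:
  assumes "f ` D \<subseteq> D" and "\<And>x. x \<in> D \<Longrightarrow> f x = g x" and "x \<in> D"
  shows "same_orbit f x y \<longleftrightarrow> same_orbit g x y"
  unfolding same_orbit_def using funpow_cong_on[OF assms] by simp

text \<open>Pigeonhole: two iterates of \<open>x\<close> coincide, and injectivity cancels their
  common number of applications of \<open>f\<close>.\<close>

lemma orbit_returns:
  assumes "finite D" and "bij_betw f D D" and "x \<in> D"
  shows "\<exists>n>0. (f ^^ n) x = x"
proof -
  have D: "(f ^^ n) x \<in> D" for n
    using funpow_closed[of f D] assms by (auto simp: bij_betw_def)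
  have "\<not> inj (\<lambda>n. (f ^^ n) x)"
  proof
    assume "inj (\<lambda>n. (f ^^ n) x)"
    then have "infinite (range (\<lambda>n. (f ^^ n) x))"
      using finite_imageD by blast
    then show False using D assms(1) finite_subset[of "range (\<lambda>n. (f ^^ n) x)" D] by blast
  qed
  then obtain i j where "i \<noteq> j" "(f ^^ i) x = (f ^^ j) x" unfolding inj_def by blast
  then obtain i j where ij: "i < j" "(f ^^ i) x = (f ^^ j) x"
    by (metis linorder_neqE_nat)
  have "(f ^^ i) x = (f ^^ (i + k)) x \<Longrightarrow> x = (f ^^ k) x" for i k
  proof (induction i)
    case (Suc i)
    have "f ((f ^^ i) x) = f ((f ^^ (i + k)) x)" using Suc.prems by simp
    then have "(f ^^ i) x = (f ^^ (i + k)) x"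
      using assms(2) D by (meson bij_betw_imp_inj_on inj_on_eq_iff)
    then show ?case by (rule Suc.IH)
  qed simp
  from this[of i "j - i"] ij show ?thesis by (intro exI[of _ "j - i"]) simp
qed

text \<open>A single step is undone by going once round the cycle.\<close>

lemma same_orbit_sym:
  assumes "finite D" and "bij_betw f D D" and "x \<in> D" and "same_orbit f x y"
  shows "same_orbit f y x"
  using assms(4)
proof (induction rule: same_orbit_induct)
  case (step z)
  have "z \<in> D" using step assms same_orbit_closed[of f D x z] by (auto simp: bij_betw_def)
  then obtain n where "n > 0" "(f ^^ n) z = z" using orbit_returns[OF assms(1,2)] by blast
  then have "(f ^^ (n - 1)) (f z) = z" by (cases n) (auto simp: funpow_swap1)
  then have "same_orbit f (f z) z" unfolding same_orbit_def by blast
  then show ?case using step(2) by (rule same_orbit_trans)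
qed simp

section \<open>Effect of a transposition on orbits\<close>

lemma bij_betw_comp_transpose:
  assumes "bij_betw f D D" "a \<in> D" "b \<in> D"
  shows "bij_betw (f \<circ> transpose a b) D D"
  by (rule bij_betw_trans[OF _ assms(1)])
    (use assms(2,3) permutes_imp_bij[OF permutes_swap_id] in auto)

text \<open>The modified map sends \<open>b\<close> to \<open>f a\<close> and then agrees with
  \<open>f\<close> until the cycle of \<open>a\<close> closes, since that cycle avoids
  \<open>b\<close>. So from \<open>b\<close> it traverses the whole cycle of
  \<open>a\<close>.\<close>

lemma orbit_merge_aux:
  assumes "finite D" and "bij_betw f D D" and "a \<in> D" and "b \<in> D"
    and "\<not> same_orbit f a b" and "same_orbit f a y"
  shows "same_orbit (f \<circ> transpose a b) b y"
proof -
  let ?g = "f \<circ> transpose a b"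
  have *: "same_orbit ?g b ((f ^^ Suc n) a)" for n
  proof (induction n)
    case 0
    then show ?case using same_orbit_apply[of ?g b] by (simp add: comp_def)
  next
    case (Suc n)
    let ?z = "(f ^^ Suc n) a"
    have "?z \<noteq> b" using assms(5) unfolding same_orbit_def by blast
    show ?case
    proof (cases "?z = a")
      case True
      then show ?thesis using same_orbit_apply[of ?g b] by (simp add: comp_def)
    next
      case False
      then have "?g ?z = f ?z" using \<open>?z \<noteq> b\<close> by (simp add: transpose_def)
      then show ?thesis using same_orbit_step[OF Suc] by simp
    qed
  qed
  obtain n where n: "(f ^^ n) a = y" using assms(6) by (auto simp: same_orbit_def)
  show ?thesis
  proof (cases n)
    \<comment> \<open>Here \<open>y = a\<close>, which is reached as the last point of the cycle:
      zero steps are replaced by a full period.\<close>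
    case 0
    obtain m where "m > 0" "(f ^^ m) a = a" using orbit_returns assms by metis
    then show ?thesis using *[of "m - 1"] n 0 by simp
  next
    case (Suc k)
    then show ?thesis using *[of k] n by simp
  qed
qed

text \<open>Off the union \<open>U\<close> of the two cycles the maps agree; inside it,
  \<open>orbit_merge_aux\<close> applied in both directions shows that the new map is a single
  cycle.\<close>

lemma orbit_merge:
  assumes fin: "finite D" and f: "bij_betw f D D" and ab: "a \<in> D" "b \<in> D"
    and ns: "\<not> same_orbit f a b" and xy: "x \<in> D" "y \<in> D"
  shows "same_orbit (f \<circ> transpose a b) x y \<longleftrightarrow>
    same_orbit f x y \<or> ((same_orbit f a x \<or> same_orbit f b x) \<and> (same_orbit f a y \<or> same_orbit f b y))"
    (is "same_orbit ?g x y \<longleftrightarrow> _")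
proof -
  have g: "bij_betw ?g D D" using bij_betw_comp_transpose[OF f ab] .
  have cl: "f ` D \<subseteq> D" using f by (simp add: bij_betw_def)
  have ns': "\<not> same_orbit f b a" using ns same_orbit_sym[OF fin f ab(2)] by blast
  define U where "U = {z \<in> D. same_orbit f a z \<or> same_orbit f b z}"
  have Ustep: "f z \<in> U" if "z \<in> U" for z
    using that cl unfolding U_def by (auto intro: same_orbit_step)
  have fU: "z \<in> U" if "same_orbit f z w" "w \<in> U" "z \<in> D" for z w
    using that same_orbit_sym[OF fin f that(3,1)] same_orbit_trans[of f _ w z] unfolding U_def by blast
  have a_all: "same_orbit ?g a z" if "z \<in> U" for z
  proof -
    have 1: "same_orbit ?g a z" if "same_orbit f b z" for z
      using orbit_merge_aux[OF fin f ab(2,1) ns' that] by (simp add: transpose_commute)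
    have 2: "same_orbit ?g b z" if "same_orbit f a z" for z
      using orbit_merge_aux[OF fin f ab ns that] .
    show ?thesis using that 1 2 same_orbit_trans[OF 1[of b]] unfolding U_def by auto
  qed
  have L: "same_orbit f x y \<or> (x \<in> U \<and> y \<in> U)" if "same_orbit ?g x y"
    using that
  proof (induction rule: same_orbit_induct)
    case (step z)
    have "z \<in> D" using step xy same_orbit_closed[of ?g D x z] g by (auto simp: bij_betw_def)
    have aU: "a \<in> U" "b \<in> U" using ab by (auto simp: U_def)
    show ?case
    proof (cases "z = a \<or> z = b")
      case True
      then have "z \<in> U" "?g z \<in> U" using aU Ustep by (auto)
      moreover have "x \<in> U" using step(2) fU[of x z] \<open>z \<in> U\<close> xy by auto
      ultimately show ?thesis by simp
    next
      case False
      then have "?g z = f z" by (simp add: transpose_def)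
      then show ?thesis using step(2) Ustep same_orbit_step by metis
    qed
  qed simp
  have R1: "same_orbit ?g x y" if "x \<in> U" "y \<in> U"
    using same_orbit_trans[OF same_orbit_sym[OF fin g ab(1) a_all[OF that(1)]] a_all[OF that(2)]] .
  have R2: "same_orbit ?g x y" if "same_orbit f x y" "x \<notin> U"
    using that(1)
  proof (induction rule: same_orbit_induct)
    case (step z)
    have "a \<in> U" "b \<in> U" using ab by (auto simp: U_def)
    then have "z \<noteq> a" "z \<noteq> b" using step(1) fU[of x z] that xy by blast+
    then have "?g z = f z" by (simp add: transpose_def)
    then show ?case using step(2) same_orbit_step by metis
  qed simp
  have R3: "y \<in> U" if "same_orbit f x y" "x \<in> U"
    using that xy same_orbit_trans[of f _ x y] unfolding U_def by blast
  show ?thesis using L R1 R2 R3 xy unfolding U_def by blast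
qed

text \<open>Let \<open>k\<close> be the first time at which \<open>f\<close> leads from
  \<open>a\<close> to \<open>b\<close>. The modified map sends \<open>b\<close> to
  \<open>f a\<close> and then follows \<open>f\<close>, so it is back at \<open>b\<close> after
  \<open>k\<close> steps. The closed segment \<open>C\<close> traversed in this way omits
  \<open>a\<close>.\<close>

lemma orbit_split:
  assumes fin: "finite D" and f: "bij_betw f D D" and ab: "a \<in> D" "b \<in> D" "a \<noteq> b"
    and so: "same_orbit f a b"
  shows "\<not> same_orbit (f \<circ> transpose a b) a b"
proof
  let ?g = "f \<circ> transpose a b"
  assume "same_orbit ?g a b"
  then have ba: "same_orbit ?g b a"
    using same_orbit_sym[OF fin bij_betw_comp_transpose[OF f ab(1,2)]] ab by blast
  define k where "k = (LEAST k. (f ^^ k) a = b)"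
  have k: "(f ^^ k) a = b" using so unfolding k_def same_orbit_def by (rule LeastI_ex)
  have k_min: "(f ^^ j) a \<noteq> b" if "j < k" for j using that unfolding k_def by (rule not_less_Least)
  have k0: "k > 0" using k ab(3) by (cases k) auto
  have no_a: "(f ^^ j) a \<noteq> a" if "0 < j" "j \<le> k" for j
  proof
    assume j: "(f ^^ j) a = a"
    have "(f ^^ (k - j + j)) a = (f ^^ (k - j)) a" using j by (simp add: funpow_add)
    then show False using k_min[of "k - j"] k that by simp
  qed
  define C where "C = {(f ^^ j) a | j. 0 < j \<and> j \<le> k}"
  from ba have "a \<in> C"
  proof (induction rule: same_orbit_induct)
    case refl
    then show ?case using k k0 unfolding C_def by blast
  next
    case (step z)
    then obtain j where j: "z = (f ^^ j) a" "0 < j" "j \<le> k" unfolding C_def by blast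
    show ?case
    proof (cases "j = k")
      case True
      then have "?g z = (f ^^ 1) a" using j k by simp
      then show ?thesis using k0 unfolding C_def by (intro CollectI exI[of _ 1]) auto
    next
      case False
      then have "?g z = (f ^^ Suc j) a" using j no_a[of j] k_min[of j] by (simp add: transpose_def)
      then show ?thesis using j False unfolding C_def by (intro CollectI exI[of _ "Suc j"]) auto
    qed
  qed
  then obtain j where "a = (f ^^ j) a" "0 < j" "j \<le> k" unfolding C_def by blast
  then show False using no_a[of j] by simp
qed

lemma orbit_of_eq_iff:
  assumes "finite D" and "bij_betw f D D" and "x \<in> D" and "y \<in> D"
  shows "orbit_of f x = orbit_of f y \<longleftrightarrow> same_orbit f x y"
proof
  assume "same_orbit f x y"
  moreover from this have "same_orbit f y x" by (rule same_orbit_sym[OF assms(1-3)])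
  ultimately show "orbit_of f x = orbit_of f y"
    unfolding orbit_of_eq using same_orbit_trans[of f x y] same_orbit_trans[of f y x] by blast
next
  assume "orbit_of f x = orbit_of f y"
  then show "same_orbit f x y" using same_orbit_refl[of f y] unfolding orbit_of_eq by blast
qed

lemma card_orbits_merge:
  assumes fin: "finite D" and f: "bij_betw f D D" and ab: "a \<in> D" "b \<in> D"
    and ns: "\<not> same_orbit f a b"
  shows "card (orbit_of f ` D) = Suc (card (orbit_of (f \<circ> transpose a b) ` D))"
proof -
  let ?g = "f \<circ> transpose a b"
  let ?U = "orbit_of f a \<union> orbit_of f b"
  let ?R = "orbit_of f ` D - {orbit_of f a, orbit_of f b}"
  have g: "bij_betw ?g D D" using bij_betw_comp_transpose[OF f ab] .
  have sub: "orbit_of f x \<subseteq> D" "orbit_of ?g x \<subseteq> D" if "x \<in> D" for x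
    using that same_orbit_closed[OF eq_refl[OF bij_betw_imp_surj_on[OF f]]]
      same_orbit_closed[OF eq_refl[OF bij_betw_imp_surj_on[OF g]]]
    unfolding orbit_of_eq by blast+
  have gorb: "orbit_of ?g x = (if x \<in> ?U then ?U else orbit_of f x)" if x: "x \<in> D" for x
  proof -
    have "y \<in> orbit_of ?g x \<longleftrightarrow> y \<in> (if x \<in> ?U then ?U else orbit_of f x)" if "y \<in> D" for y
      using orbit_merge[OF fin f ab ns x that] same_orbit_trans[of f _ x y]
      unfolding orbit_of_eq by simp blast
    moreover have "(if x \<in> ?U then ?U else orbit_of f x) \<subseteq> D" using sub(1) x ab by simp
    ultimately show ?thesis using sub(2)[OF x] by blast
  qed
  have inU: "x \<in> ?U \<longleftrightarrow> orbit_of f x \<in> {orbit_of f a, orbit_of f b}" if "x \<in> D" for x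
    using orbit_of_eq_iff[OF fin f ab(1) that] orbit_of_eq_iff[OF fin f ab(2) that]
    by (auto simp: orbit_of_eq[of f a] orbit_of_eq[of f b])
  have "orbit_of ?g ` D = insert ?U ?R"
  proof (intro subset_antisym subsetI)
    fix X assume "X \<in> orbit_of ?g ` D"
    then show "X \<in> insert ?U ?R" using gorb inU by auto
  next
    fix X assume "X \<in> insert ?U ?R"
    then consider "X = ?U" | x where "x \<in> D" "X = orbit_of f x" "x \<notin> ?U" using inU by auto
    then show "X \<in> orbit_of ?g ` D"
    proof cases
      case 1
      have "a \<in> ?U" by (simp add: orbit_of_eq)
      then show ?thesis using gorb[OF ab(1)] 1 ab(1) by (metis image_eqI)
    next
      case 2
      then show ?thesis using gorb[of x] by (metis image_eqI)
    qed
  qed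
  moreover have "?U \<notin> ?R"
  proof
    assume "?U \<in> ?R"
    then obtain x where x: "x \<in> D" "orbit_of f x = ?U" "orbit_of f x \<noteq> orbit_of f a" by auto
    then have "a \<in> orbit_of f x" by (simp add: orbit_of_eq)
    then show False using x orbit_of_eq_iff[OF fin f x(1) ab(1)] by (simp add: orbit_of_eq)
  qed
  ultimately have "card (orbit_of ?g ` D) = Suc (card ?R)" using fin by simp
  moreover have "orbit_of f a \<noteq> orbit_of f b" using orbit_of_eq_iff[OF fin f ab] ns by simp
  then have "card (orbit_of f ` D) = card ?R + 2"
    using card_Diff_subset[of "{orbit_of f a, orbit_of f b}" "orbit_of f ` D"] fin ab
      card_mono[of "orbit_of f ` D" "{orbit_of f a, orbit_of f b}"] by auto
  ultimately show ?thesis by simp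
qed

section \<open>Number of cycles and sign of a permutation\<close>

lemma transpose_comp_cancel: "f \<circ> transpose a b \<circ> transpose a b = f"
  by (simp add: comp_assoc)

text \<open>When \<open>a\<close> and \<open>b\<close> share a cycle, the merge count is applied to
  the composed map, because transposing a second time restores \<open>f\<close>.\<close>

lemma card_orbits_transpose_parity:
  assumes fin: "finite D" and f: "bij_betw f D D" and ab: "a \<in> D" "b \<in> D" "a \<noteq> b"
  shows "even (card (orbit_of (f \<circ> transpose a b) ` D)) \<longleftrightarrow> odd (card (orbit_of f ` D))"
proof (cases "same_orbit f a b")
  case False
  show ?thesis using card_orbits_merge[OF fin f ab(1,2) False] by simp
next
  case True
  show ?thesis
    using card_orbits_merge[OF fin bij_betw_comp_transpose[OF f ab(1,2)] ab(1,2) orbit_split[OF fin f ab True]]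
    by (simp add: transpose_comp_cancel)
qed

text \<open>The classical sign formula, with fixed points counted as cycles. A sum replaces the
  difference of size and cycle number, since only parity matters.\<close>

lemma card_orbits_parity:
  assumes "finite D" and "p permutes D"
  shows "even (card (orbit_of p ` D) + card D) \<longleftrightarrow> evenperm p"
  using assms
proof (induction rule: permutes_rev_induct)
  case id
  have "orbit_of id x = {x}" for x :: 'a by (auto simp: orbit_of_def)
  then have "inj_on (orbit_of id) D" by (auto simp: inj_on_def)
  from card_image[OF this] show ?case by (simp add: evenperm_id[unfolded id_def] id_def)
next
  case (swap a b p)
  have "p permutes D" using swap by blast
  then have "permutation p" using assms permutation_permutes by blast
  then have "evenperm (p \<circ> transpose a b) \<longleftrightarrow> (evenperm p \<longleftrightarrow> evenperm (transpose a b))"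
    by (intro evenperm_comp permutation_swap_id)
  then show ?case
    using card_orbits_transpose_parity[OF assms(1) permutes_imp_bij[OF \<open>p permutes D\<close>], of a b] swap
    unfolding evenperm_swap even_add by blast
qed

section \<open>First return maps\<close>

text \<open>The map induced on \<open>S\<close> by skipping all points outside; \<open>0 < n\<close>
  forces a genuine step although the starting point already lies in \<open>S\<close>.\<close>

definition first_return :: "('a \<Rightarrow> 'a) \<Rightarrow> 'a set \<Rightarrow> 'a \<Rightarrow> 'a" where
  "first_return f S x = (f ^^ (LEAST n. 0 < n \<and> (f ^^ n) x \<in> S)) x"

lemma first_returnE:
  assumes "finite D" and "bij_betw f D D" and "S \<subseteq> D" and "x \<in> S"
  obtains n where "0 < n" "(f ^^ n) x \<in> S" "\<And>k. 0 < k \<Longrightarrow> k < n \<Longrightarrow> (f ^^ k) x \<notin> S"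
    "first_return f S x = (f ^^ n) x"
proof -
  let ?P = "\<lambda>n. 0 < n \<and> (f ^^ n) x \<in> S"
  have "\<exists>n. ?P n" using orbit_returns[OF assms(1,2), of x] assms(3,4) by (metis subsetD)
  then have "?P (Least ?P)" by (rule LeastI_ex)
  moreover have "\<not> ?P k" if "k < Least ?P" for k using that by (rule not_less_Least)
  ultimately show ?thesis using that[of "Least ?P"] by (auto simp: first_return_def)
qed

lemma first_return_eqI:
  assumes "0 < n" "(f ^^ n) x \<in> S" "\<And>k. 0 < k \<Longrightarrow> k < n \<Longrightarrow> (f ^^ k) x \<notin> S"
  shows "first_return f S x = (f ^^ n) x"
proof -
  have "(LEAST n. 0 < n \<and> (f ^^ n) x \<in> S) = n"
    using assms by (intro Least_equality) (auto simp: not_less[symmetric])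
  then show ?thesis by (simp add: first_return_def)
qed

lemma first_return_in:
  assumes "finite D" and "bij_betw f D D" and "S \<subseteq> D" and "x \<in> S"
  shows "first_return f S x \<in> S"
  by (rule first_returnE[OF assms]) simp

lemma first_return_same_orbit: "same_orbit f x (first_return f S x)"
  unfolding first_return_def same_orbit_def by blast

text \<open>Cancelling the shorter return time from a common return point exhibits one starting
  point as a visit of the other walk to \<open>S\<close> before its return, unless the two times
  agree.\<close>

lemma first_return_inj:
  assumes fin: "finite D" and f: "bij_betw f D D" and S: "S \<subseteq> D"
  shows "inj_on (first_return f S) S"
proof -
  have cl: "(f ^^ n) x \<in> D" if "x \<in> D" for n x
    using that funpow_closed[of f D] f by (auto simp: bij_betw_def)
  have cancel: "x \<in> D \<Longrightarrow> y \<in> D \<Longrightarrow> (f ^^ n) x = (f ^^ (k + n)) y \<Longrightarrow> x = (f ^^ k) y" for n k x y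
  proof (induction n)
    case (Suc n)
    have "f ((f ^^ n) x) = f ((f ^^ (k + n)) y)" using Suc.prems by simp
    then have "(f ^^ n) x = (f ^^ (k + n)) y"
      using f cl Suc.prems by (meson bij_betw_imp_inj_on inj_on_eq_iff)
    then show ?case using Suc by blast
  qed simp
  have main: "x = y" if xy: "x \<in> S" "y \<in> S" and nm: "n \<le> m" "0 < n"
    "\<And>k. 0 < k \<Longrightarrow> k < m \<Longrightarrow> (f ^^ k) y \<notin> S" "(f ^^ n) x = (f ^^ m) y" for x y n m
  proof -
    have "x = (f ^^ (m - n)) y" using cancel[of x y n "m - n"] nm xy S by auto
    then show ?thesis using nm(3)[of "m - n"] xy(1) nm(1,2) by (cases "m = n") auto
  qed
  show ?thesis
  proof (rule inj_onI)
    fix x y assume xy: "x \<in> S" "y \<in> S" and eq: "first_return f S x = first_return f S y"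
    obtain n where n: "0 < n" "\<And>k. 0 < k \<Longrightarrow> k < n \<Longrightarrow> (f ^^ k) x \<notin> S"
      "first_return f S x = (f ^^ n) x" using first_returnE[OF fin f S xy(1)] by metis
    obtain m where m: "0 < m" "\<And>k. 0 < k \<Longrightarrow> k < m \<Longrightarrow> (f ^^ k) y \<notin> S"
      "first_return f S y = (f ^^ m) y" using first_returnE[OF fin f S xy(2)] by metis
    show "x = y"
      using main[OF xy, of n m] main[OF xy(2,1), of m n] n m eq by (cases "n \<le> m") auto
  qed
qed

lemma first_return_bij:
  assumes "finite D" and "bij_betw f D D" and "S \<subseteq> D"
  shows "bij_betw (first_return f S) S S"
proof -
  have "finite S" using assms finite_subset by blast
  then show ?thesis
    using first_return_inj[OF assms] first_return_in[OF assms]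
    by (simp add: bij_betw_def endo_inj_surj image_subsetI)
qed

text \<open>The walk from \<open>x\<close> to \<open>y\<close> is cut at its visits to
  \<open>S\<close>; each piece is one step of the return map.\<close>

lemma same_orbit_first_return:
  assumes fin: "finite D" and f: "bij_betw f D D" and S: "S \<subseteq> D"
    and xy: "x \<in> S" "y \<in> S" "same_orbit f x y"
  shows "same_orbit (first_return f S) x y"
proof -
  have "x \<in> S \<Longrightarrow> (f ^^ n) x = y \<Longrightarrow> same_orbit (first_return f S) x y" for n x
  proof (induction n arbitrary: x rule: less_induct)
    case (less n)
    show ?case
    proof (cases "n = 0")
      case False
      obtain m where m: "0 < m" "(f ^^ m) x \<in> S" "\<And>k. 0 < k \<Longrightarrow> k < m \<Longrightarrow> (f ^^ k) x \<notin> S"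
        "first_return f S x = (f ^^ m) x" using first_returnE[OF fin f S less.prems(1)] by metis
      have "m \<le> n" using m(3)[of n] False less.prems xy(2) by (meson not_gr0 not_less)
      then have "(f ^^ (n - m)) ((f ^^ m) x) = y"
        using less.prems(2) by (metis comp_apply funpow_add le_add_diff_inverse2)
      then have "same_orbit (first_return f S) ((f ^^ m) x) y"
        using less.IH[of "n - m"] m(1,2) \<open>m \<le> n\<close> by auto
      then show ?thesis using m(4) same_orbit_apply same_orbit_trans by metis
    qed (use less in auto)
  qed
  then show ?thesis using xy by (auto simp: same_orbit_def)
qed

text \<open>Locates the point from which a walk re-enters \<open>S\<close>; for a face walk this
  identifies the cut edge used for the return.\<close>

lemma first_return_last_step:
  assumes "finite D" and "bij_betw f D D" and "S \<subseteq> D" and "x \<in> S"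
  shows "\<exists>z \<in> D. first_return f S x = f z \<and> (z = x \<or> z \<notin> S)"
proof -
  obtain n where n: "0 < n" "\<And>k. 0 < k \<Longrightarrow> k < n \<Longrightarrow> (f ^^ k) x \<notin> S"
    "first_return f S x = (f ^^ n) x" using first_returnE[OF assms] by metis
  let ?z = "(f ^^ (n - 1)) x"
  have "(f ^^ n) x = f ?z" using n(1) by (cases n) auto
  moreover have "?z = x \<or> ?z \<notin> S" using n(1) n(2)[of "n - 1"] by (cases "n = 1") auto
  moreover have "?z \<in> D" using funpow_closed[of f D x] assms by (auto simp: bij_betw_def)
  ultimately show ?thesis using n(3) by auto
qed

lemma first_return_immediate:
  assumes "f x \<in> S"
  shows "first_return f S x = f x"
  using first_return_eqI[of 1 f x S] assms by simp

text \<open>Points outside \<open>S\<close> are dangling half-edges: an involution pairing the half-edges of \<open>S\<close>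
  commutes with skipping them.\<close>

lemma first_return_comp_fixed:
  assumes fin: "finite D" and f: "bij_betw f D D" and S: "S \<subseteq> D"
    and a: "\<And>z. z \<in> D - S \<Longrightarrow> a z = z" and x: "x \<in> S" "a x \<in> S"
  shows "first_return (f \<circ> a) S x = first_return f S (a x)"
proof -
  obtain n where n: "0 < n" "(f ^^ n) (a x) \<in> S" "\<And>k. 0 < k \<Longrightarrow> k < n \<Longrightarrow> (f ^^ k) (a x) \<notin> S"
    "first_return f S (a x) = (f ^^ n) (a x)" using first_returnE[OF fin f S x(2)] by metis
  have cl: "(f ^^ k) (a x) \<in> D" for k
    using funpow_closed[of f D "a x"] f S x(2) by (auto simp: bij_betw_def)
  \<comment> \<open>\<open>a\<close> fixes every point outside \<open>S\<close>, so after the first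
    step both walks coincide until they return.\<close>
  have *: "0 < k \<Longrightarrow> k \<le> n \<Longrightarrow> ((f \<circ> a) ^^ k) x = (f ^^ k) (a x)" for k
  proof (induction k)
    case (Suc k)
    show ?case
    proof (cases "k = 0")
      case False
      then have "(f ^^ k) (a x) \<in> D - S" using n(3) Suc.prems cl by auto
      then show ?thesis using Suc False a by auto
    qed simp
  qed simp
  show ?thesis using first_return_eqI[of n "f \<circ> a" x S] n * by auto
qed

text \<open>Applying the transposition again restores the single cycle of \<open>f\<close>, and by
  \<open>orbit_merge\<close> it does so by fusing just the cycles of \<open>a\<close> and
  \<open>b\<close>. Hence there is no third cycle.\<close>

lemma split_single_orbit:
  assumes fin: "finite D" and f: "bij_betw f D D" and ab: "a \<in> D" "b \<in> D" "a \<noteq> b"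
    and one: "\<And>x y. x \<in> D \<Longrightarrow> y \<in> D \<Longrightarrow> same_orbit f x y"
  shows "\<not> same_orbit (f \<circ> transpose a b) a b"
    and "x \<in> D \<Longrightarrow> same_orbit (f \<circ> transpose a b) a x \<or> same_orbit (f \<circ> transpose a b) b x"
proof -
  let ?g = "f \<circ> transpose a b"
  show ns: "\<not> same_orbit ?g a b" using orbit_split[OF fin f ab one[OF ab(1,2)]] .
  show "same_orbit ?g a x \<or> same_orbit ?g b x" if x: "x \<in> D"
    using orbit_merge[OF fin bij_betw_comp_transpose[OF f ab(1,2)] ab(1,2) ns ab(1) x]
      one[OF ab(1) x] unfolding transpose_comp_cancel by blast
qed

section \<open>Rotation systems\<close>

lemma dflip_dflip [simp]: "dflip (dflip d) = d"
  by (simp add: dflip_def)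

lemma dflip_neq [simp]: "dflip d \<noteq> d" "d \<noteq> dflip d"
  by (cases d; simp add: dflip_def)+

lemma fst_dflip [simp]: "fst (dflip d) = fst d"
  by (simp add: dflip_def)

lemma dflip_in_darts [simp]: "dflip d \<in> darts G \<longleftrightarrow> d \<in> darts G"
  by (simp add: darts_def dflip_def mem_Times_iff)

lemma finite_darts: "wf_graph G \<Longrightarrow> finite (darts G)"
  by (simp add: wf_graph_def darts_def)

lemma dtail_in_verts: "wf_graph G \<Longrightarrow> d \<in> darts G \<Longrightarrow> dtail G d \<in> verts G"
  by (auto simp: wf_graph_def darts_def dtail_def)

lemma bij_betw_dflip: "bij_betw dflip (darts G) (darts G)"
  by (rule bij_betw_byWitness[where f' = dflip]) auto

lemma bij_betw_face_perm:
  "rotation_system G \<rho> \<Longrightarrow> bij_betw (\<rho> \<circ> dflip) (darts G) (darts G)"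
  using bij_betw_trans[OF bij_betw_dflip] by (auto simp: rotation_system_def)

lemma rotation_same_orbit_iff:
  assumes "rotation_system G \<rho>" and "d \<in> darts G" and "d' \<in> darts G"
  shows "same_orbit \<rho> d d' \<longleftrightarrow> dtail G d = dtail G d'"
proof
  assume "same_orbit \<rho> d d'"
  then have "dtail G d' = dtail G d \<and> d' \<in> darts G"
    by (induction rule: same_orbit_induct)
      (use assms in \<open>auto simp: rotation_system_def bij_betw_def\<close>)
  then show "dtail G d = dtail G d'" by simp
next
  assume "dtail G d = dtail G d'"
  then show "same_orbit \<rho> d d'" using assms unfolding rotation_system_def same_orbit_def by blast
qed

section \<open>Face numbers modulo 2 and the maximum genus\<close>

lemma card_image_eq_card_image:
  assumes "\<And>x y. x \<in> D \<Longrightarrow> y \<in> D \<Longrightarrow> h x = h y \<longleftrightarrow> k x = k y"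
  shows "card (h ` D) = card (k ` D)"
proof -
  let ?P = "(\<lambda>x. (h x, k x)) ` D"
  have "inj_on fst ?P" "inj_on snd ?P" using assms by (auto simp: inj_on_def)
  then have "card (fst ` ?P) = card (snd ` ?P)" by (simp only: card_image)
  then show ?thesis by (simp add: image_image)
qed

text \<open>Signs multiply in \<open>\<rho> \<circ> dflip\<close>. Cycles of the rotation correspond
  to vertices, of the flip to edges, of the composition to faces, and the number of darts is even.
  An isolated vertex would have no cycle, hence the last hypothesis.\<close>

lemma num_faces_parity:
  assumes wf: "wf_graph G" and rot: "rotation_system G \<rho>"
    and no_isolated: "verts G \<subseteq> dtail G ` darts G"
  shows "even (num_faces G \<rho> + card (verts G) + card (edges G))"
proof -
  let ?D = "darts G"
  \<comment> \<open>Signs belong to permutations of the whole type, so rotation and flip are made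
    the identity off the darts.\<close>
  let ?p = "\<lambda>d. if d \<in> ?D then \<rho> d else d"
  let ?q = "\<lambda>d. if d \<in> ?D then dflip d else d"
  have fin: "finite ?D" using finite_darts[OF wf] .
  have bij: "bij_betw \<rho> ?D ?D" using rot by (simp add: rotation_system_def)
  then have "bij_betw ?p ?D ?D" by (subst bij_betw_cong[where g = \<rho>]) auto
  then have p: "?p permutes ?D" by (rule bij_imp_permutes) simp
  have "bij_betw ?q ?D ?D" using bij_betw_dflip by (subst bij_betw_cong[where g = dflip]) auto
  then have q: "?q permutes ?D" by (rule bij_imp_permutes) simp
  have orb: "orbit_of f ` ?D = orbit_of g ` ?D"
    if "bij_betw f ?D ?D" "\<And>d. d \<in> ?D \<Longrightarrow> f d = g d" for f g
    using same_orbit_cong_on[of f ?D g] that unfolding orbit_of_eq bij_betw_def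
    by (intro image_cong) auto
  have o1: "orbit_of ?p ` ?D = orbit_of \<rho> ` ?D" using orb[OF permutes_imp_bij[OF p], of \<rho>] by simp
  have o2: "orbit_of ?q ` ?D = orbit_of dflip ` ?D" using orb[OF permutes_imp_bij[OF q], of dflip] by simp
  have pq: "?p \<circ> ?q permutes ?D" using permutes_compose[OF q p] .
  have o3: "orbit_of (?p \<circ> ?q) ` ?D = orbit_of (\<rho> \<circ> dflip) ` ?D"
    using orb[OF permutes_imp_bij[OF pq], of "\<rho> \<circ> dflip"] by simp
  have "dtail G ` ?D = verts G" using no_isolated dtail_in_verts[OF wf] by blast
  then have c1: "card (orbit_of \<rho> ` ?D) = card (verts G)"
    using card_image_eq_card_image[of ?D "orbit_of \<rho>" "dtail G"]
      orbit_of_eq_iff[OF fin bij] rotation_same_orbit_iff[OF rot] by simp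
  have flip_orbit: "same_orbit dflip d d' \<longleftrightarrow> fst d = fst d'" for d d' :: "'b dart"
  proof
    assume "same_orbit dflip d d'"
    then show "fst d = fst d'" by (induction rule: same_orbit_induct) simp_all
  next
    assume "fst d = fst d'"
    then have "d' = d \<or> d' = dflip d" by (cases d; cases d') (auto simp: dflip_def)
    then show "same_orbit dflip d d'" using same_orbit_apply[of dflip d] by auto
  qed
  have "fst ` ?D = edges G" by (auto simp: darts_def)
  then have c2: "card (orbit_of dflip ` ?D) = card (edges G)"
    using card_image_eq_card_image[of ?D "orbit_of dflip" fst]
      orbit_of_eq_iff[OF fin bij_betw_dflip] flip_orbit by simp
  have e: "card ?D = card (edges G) * 2" unfolding darts_def by (simp add: card_cartesian_product)
  have "evenperm (?p \<circ> ?q) \<longleftrightarrow> (evenperm ?p \<longleftrightarrow> evenperm ?q)"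
    using p q fin by (intro evenperm_comp) (auto simp: permutation_permutes)
  then have "even (num_faces G \<rho>) \<longleftrightarrow> (even (card (verts G)) \<longleftrightarrow> even (card (edges G)))"
    unfolding card_orbits_parity[OF fin p, symmetric] card_orbits_parity[OF fin q, symmetric]
      card_orbits_parity[OF fin pq, symmetric] o1 o2 o3 c1 c2 e num_faces_def by simp
  then show ?thesis unfolding even_add by blast
qed

text \<open>The bound is not an equality because a graph without darts has no orbit, hence zero
  faces.\<close>

lemma num_faces_le_1_iff:
  assumes wf: "wf_graph G" and rot: "rotation_system G \<rho>"
  shows "num_faces G \<rho> \<le> 1 \<longleftrightarrow>
    (\<forall>d \<in> darts G. \<forall>d' \<in> darts G. same_orbit (\<rho> \<circ> dflip) d d')"
proof -
  have "num_faces G \<rho> \<le> 1 \<longleftrightarrow>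
    (\<forall>X \<in> orbit_of (\<rho> \<circ> dflip) ` darts G. \<forall>Y \<in> orbit_of (\<rho> \<circ> dflip) ` darts G. X = Y)"
    unfolding num_faces_def using finite_darts[OF wf] by (simp add: card_le_Suc0_iff_eq)
  then show ?thesis
    using orbit_of_eq_iff[OF finite_darts[OF wf] bij_betw_face_perm[OF rot]] by auto
qed

text \<open>The constructions yield at most two orbits covering all half-edges. The condition on
  triples expresses this and survives passing to a coarser orbit relation.\<close>

lemma num_faces_le_2:
  assumes wf: "wf_graph G" and rot: "rotation_system G \<rho>"
    and three: "\<And>x y z. x \<in> darts G \<Longrightarrow> y \<in> darts G \<Longrightarrow> z \<in> darts G \<Longrightarrow>
      same_orbit (\<rho> \<circ> dflip) x y \<or> same_orbit (\<rho> \<circ> dflip) y z \<or> same_orbit (\<rho> \<circ> dflip) x z"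
  shows "num_faces G \<rho> \<le> 2"
proof (rule ccontr)
  let ?O = "orbit_of (\<rho> \<circ> dflip)"
  assume "\<not> num_faces G \<rho> \<le> 2"
  then have "3 \<le> card (?O ` darts G)" by (simp add: num_faces_def)
  then obtain B where B: "B \<subseteq> ?O ` darts G" "card B = 3" using obtain_subset_with_card_n by metis
  then obtain X Y Z where XYZ: "B = {X, Y, Z}" "X \<noteq> Y" "Y \<noteq> Z" "X \<noteq> Z"
    by (auto simp: card_Suc_eq numeral_3_eq_3)
  with B have "X \<in> ?O ` darts G" "Y \<in> ?O ` darts G" "Z \<in> ?O ` darts G" by auto
  then obtain x y z where "x \<in> darts G" "y \<in> darts G" "z \<in> darts G"
    "X = ?O x" "Y = ?O y" "Z = ?O z" by blast
  then show False
    using three[of x y z] XYZ orbit_of_eq_iff[OF finite_darts[OF wf] bij_betw_face_perm[OF rot]] by metis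
qed

text \<open>Makes \<open>Max\<close> in the definition of the maximum genus meaningful.\<close>

lemma finite_emb_genus:
  assumes "wf_graph G"
  shows "finite {emb_genus G \<rho> | \<rho>. rotation_system G \<rho>}"
proof (rule finite_subset)
  let ?h = "\<lambda>n. (2 - int (card (verts G)) + int (card (edges G)) - int n) div 2"
  have "num_faces G \<rho> \<le> card (darts G)" for \<rho>
    unfolding num_faces_def using finite_darts[OF assms] by (rule card_image_le)
  then show "{emb_genus G \<rho> | \<rho>. rotation_system G \<rho>} \<subseteq> ?h ` {..card (darts G)}"
    unfolding emb_genus_def by blast
qed simp

lemma xi_le_emb_genus:
  assumes "wf_graph G" and "rotation_system G \<rho>"
  shows "xi G \<le> betti G - 2 * ((betti G + 1 - int (num_faces G \<rho>)) div 2)"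
proof -
  have "emb_genus G \<rho> \<le> max_genus G"
    unfolding max_genus_def using finite_emb_genus[OF assms(1)] assms(2) by (intro Max_ge) auto
  moreover have "emb_genus G \<rho> = (betti G + 1 - int (num_faces G \<rho>)) div 2"
    unfolding emb_genus_def betti_def by (simp add: algebra_simps)
  ultimately show ?thesis unfolding xi_def by simp
qed

lemma xi_le_1_if_one_face:
  assumes "wf_graph G" and "rotation_system G \<rho>" and "num_faces G \<rho> \<le> 1"
  shows "xi G \<le> 1"
  using xi_le_emb_genus[OF assms(1,2)] assms(3) by presburger

lemma xi_le_1_if_two_faces:
  assumes "wf_graph G" and "rotation_system G \<rho>" and "num_faces G \<rho> \<le> 2" and "odd (betti G)"
  shows "xi G \<le> 1"
  using xi_le_emb_genus[OF assms(1,2)] assms(3,4) by presburger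

text \<open>\<open>xi G\<close> has the parity of \<open>betti G\<close>, so here it is at most 0,
  and by Euler's formula an embedding of maximum genus has at most one face. Existence of a rotation
  system ensures that the maximum is attained.\<close>

lemma one_face_if_xi_le_1:
  assumes wf: "wf_graph G" and ex: "\<exists>\<rho>. rotation_system G \<rho>" and "xi G \<le> 1" and "even (betti G)"
  obtains \<rho> where "rotation_system G \<rho>" and "num_faces G \<rho> \<le> 1"
proof -
  have "max_genus G \<in> {emb_genus G \<rho> | \<rho>. rotation_system G \<rho>}"
    unfolding max_genus_def using finite_emb_genus[OF wf] ex by (intro Max_in) auto
  then obtain \<rho> where \<rho>: "rotation_system G \<rho>" "max_genus G = emb_genus G \<rho>" by auto
  have "emb_genus G \<rho> = (betti G + 1 - int (num_faces G \<rho>)) div 2"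
    unfolding emb_genus_def betti_def by (simp add: algebra_simps)
  then have "num_faces G \<rho> \<le> 1" using \<rho>(2) assms(3,4) unfolding xi_def by presburger
  then show ?thesis using that \<rho>(1) by blast
qed

text \<open>Half-edges outside the image of \<open>\<iota>\<close> are dangling: they occur in the rotation at
  their vertex, but a face walk reaching one turns around immediately. Skipping them yields a
  genuine rotation system without splitting any face.\<close>

lemma rotation_from_half_edges:
  fixes A :: "('v, 'e) mgraph" and \<iota> :: "'e dart \<Rightarrow> 'a"
  assumes fin: "finite D" and \<rho>: "bij_betw \<rho> D D"
    and tau: "\<And>x y. x \<in> D \<Longrightarrow> y \<in> D \<Longrightarrow> same_orbit \<rho> x y \<longleftrightarrow> tau x = tau y"
    and inj: "inj_on \<iota> (darts A)" and im: "\<And>d. d \<in> darts A \<Longrightarrow> \<iota> d \<in> D"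
    and tau_\<iota>: "\<And>d. d \<in> darts A \<Longrightarrow> tau (\<iota> d) = dtail A d"
    and \<alpha>: "\<And>d. d \<in> darts A \<Longrightarrow> \<alpha> (\<iota> d) = \<iota> (dflip d)"
    and \<alpha>': "\<And>x. x \<in> D - \<iota> ` darts A \<Longrightarrow> \<alpha> x = x"
  shows "bij_betw (\<rho> \<circ> \<alpha>) D D"
    and "\<exists>\<rho>'. rotation_system A \<rho>' \<and> (\<forall>d \<in> darts A. \<forall>d' \<in> darts A.
      same_orbit (\<rho> \<circ> \<alpha>) (\<iota> d) (\<iota> d') \<longrightarrow> same_orbit (\<rho>' \<circ> dflip) d d')"
proof -
  let ?S = "\<iota> ` darts A"
  have S: "?S \<subseteq> D" using im by auto
  have "\<alpha> x \<in> D \<and> \<alpha> (\<alpha> x) = x" if "x \<in> D" for x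
  proof (cases "x \<in> ?S")
    case True
    then obtain d where d: "d \<in> darts A" "x = \<iota> d" by blast
    then have "dflip d \<in> darts A" by simp
    then show ?thesis using d im \<alpha>[of d] \<alpha>[of "dflip d"] by simp
  qed (use that \<alpha>' in simp)
  then have "bij_betw \<alpha> D D" by (intro bij_betw_byWitness[where f' = \<alpha>]) auto
  then show \<phi>: "bij_betw (\<rho> \<circ> \<alpha>) D D" using \<rho> by (rule bij_betw_trans)
  define \<kappa> where "\<kappa> = inv_into (darts A) \<iota>"
  have \<kappa>: "\<kappa> x \<in> darts A" "\<iota> (\<kappa> x) = x" if "x \<in> ?S" for x
    using that by (auto simp: \<kappa>_def inv_into_into f_inv_into_f)
  define \<rho>' where "\<rho>' d = \<kappa> (first_return \<rho> ?S (\<iota> d))" for d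
  have r: "bij_betw (first_return \<rho> ?S) ?S ?S" by (rule first_return_bij[OF fin \<rho> S])
  have \<iota>\<rho>': "\<iota> (\<rho>' d) = first_return \<rho> ?S (\<iota> d)" "\<rho>' d \<in> darts A" if "d \<in> darts A" for d
    using \<kappa> first_return_in[OF fin \<rho> S] that by (auto simp: \<rho>'_def)
  \<comment> \<open>\<open>\<iota>\<close> intertwines \<open>f\<close> with \<open>g\<close> and is
    injective, so orbits of \<open>g\<close> through image points pull back. This serves both the
    rotation and the face permutation.\<close>
  have transfer: "same_orbit f d d'"
    if "same_orbit g (\<iota> d) (\<iota> d')" "d \<in> darts A" "d' \<in> darts A"
      "\<And>d. d \<in> darts A \<Longrightarrow> \<iota> (f d) = g (\<iota> d) \<and> f d \<in> darts A" for f g d d'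
  proof -
    have "(f ^^ n) d \<in> darts A \<and> \<iota> ((f ^^ n) d) = (g ^^ n) (\<iota> d)" for n
      by (induction n) (use that(2,4) in auto)
    then show ?thesis using that(1,3) inj unfolding same_orbit_def by (metis inj_onD)
  qed
  have "rotation_system A \<rho>'"
    unfolding rotation_system_def
  proof (intro conjI ballI impI)
    have "bij_betw \<iota> (darts A) ?S" using inj by (simp add: bij_betw_def)
    moreover have "bij_betw \<kappa> ?S (darts A)" unfolding \<kappa>_def
      using inj by (simp add: bij_betw_inv_into bij_betw_def[of \<iota>])
    ultimately have "bij_betw (\<kappa> \<circ> (first_return \<rho> ?S \<circ> \<iota>)) (darts A) (darts A)"
      using r by (blast intro: bij_betw_trans)
    then show "bij_betw \<rho>' (darts A) (darts A)"
      by (rule bij_betw_cong[THEN iffD1, rotated]) (simp add: \<rho>'_def)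
  next
    fix d assume d: "d \<in> darts A"
    have "same_orbit \<rho> (\<iota> d) (\<iota> (\<rho>' d))" using \<iota>\<rho>'[OF d] first_return_same_orbit by metis
    then show "dtail A (\<rho>' d) = dtail A d" using tau im tau_\<iota> \<iota>\<rho>' d by metis
  next
    fix d d' assume d: "d \<in> darts A" "d' \<in> darts A" and "dtail A d = dtail A d'"
    then have "same_orbit \<rho> (\<iota> d) (\<iota> d')" using tau im tau_\<iota> by simp
    then have "same_orbit (first_return \<rho> ?S) (\<iota> d) (\<iota> d')"
      using same_orbit_first_return[OF fin \<rho> S] d by blast
    then have "same_orbit \<rho>' d d'" using transfer[of "first_return \<rho> ?S" d d' \<rho>'] d \<iota>\<rho>' by blast
    then show "\<exists>n. (\<rho>' ^^ n) d = d'" by (simp add: same_orbit_def)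
  qed
  moreover have "same_orbit (\<rho>' \<circ> dflip) d d'"
    if d: "d \<in> darts A" "d' \<in> darts A" "same_orbit (\<rho> \<circ> \<alpha>) (\<iota> d) (\<iota> d')" for d d'
  proof -
    have "same_orbit (first_return (\<rho> \<circ> \<alpha>) ?S) (\<iota> d) (\<iota> d')"
      using same_orbit_first_return[OF fin \<phi> S] d by blast
    moreover have "\<iota> ((\<rho>' \<circ> dflip) d) = first_return (\<rho> \<circ> \<alpha>) ?S (\<iota> d) \<and> (\<rho>' \<circ> dflip) d \<in> darts A"
      if "d \<in> darts A" for d
      using first_return_comp_fixed[OF fin \<rho> S, of \<alpha> "\<iota> d"] \<alpha>' \<alpha> that \<iota>\<rho>'[of "dflip d"] by simp
    ultimately show ?thesis using transfer[of _ d d' "\<rho>' \<circ> dflip"] d by blast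
  qed
  ultimately show "\<exists>\<rho>'. rotation_system A \<rho>' \<and> (\<forall>d \<in> darts A. \<forall>d' \<in> darts A.
      same_orbit (\<rho> \<circ> \<alpha>) (\<iota> d) (\<iota> d') \<longrightarrow> same_orbit (\<rho>' \<circ> dflip) d d')" by blast
qed

section \<open>Cutting an embedding along a small edge cut\<close>

text \<open>An edge with just one end in \<open>W\<close> contributes exactly one dart, whose flip
  lies outside the set: the half-edge that remains after cutting.\<close>

definition darts_from :: "('v, 'e) mgraph \<Rightarrow> 'v set \<Rightarrow> 'e dart set" where
  "darts_from G W = {d \<in> darts G. dtail G d \<in> W}"

lemma darts_from_rotation:
  assumes "wf_graph G" and rot: "rotation_system G \<rho>"
  shows "bij_betw \<rho> (darts_from G W) (darts_from G W)"
    and "d \<in> darts_from G W \<Longrightarrow> d' \<in> darts_from G W \<Longrightarrow>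
      same_orbit \<rho> d d' \<longleftrightarrow> dtail G d = dtail G d'"
proof -
  have "inj_on \<rho> (darts_from G W)"
    using rot by (auto simp: rotation_system_def bij_betw_def darts_from_def intro: inj_on_subset)
  moreover have "\<rho> ` darts_from G W \<subseteq> darts_from G W"
    using rot by (auto simp: rotation_system_def bij_betw_def darts_from_def)
  moreover have "finite (darts_from G W)"
    using finite_darts[OF assms(1)] by (simp add: darts_from_def)
  ultimately show "bij_betw \<rho> (darts_from G W) (darts_from G W)"
    by (simp add: bij_betw_def endo_inj_surj)
  show "same_orbit \<rho> d d' \<longleftrightarrow> dtail G d = dtail G d'"
    if "d \<in> darts_from G W" "d' \<in> darts_from G W"
    using rotation_same_orbit_iff[OF rot, of d d'] that by (simp add: darts_from_def)
qed

text \<open>If the edge of \<open>d\<close> stays inside \<open>W\<close>, the face walk does not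
  leave. Otherwise it returns from outside over some cut edge, and \<open>d'\<close> is the half of
  that edge at \<open>W\<close>.\<close>

lemma face_return:
  assumes wf: "wf_graph G" and rot: "rotation_system G \<rho>" and d: "d \<in> darts_from G W"
  defines "\<psi> \<equiv> first_return (\<rho> \<circ> dflip) (darts_from G W)"
  shows "dflip d \<in> darts_from G W \<Longrightarrow> \<psi> d = \<rho> (dflip d)"
    and "dflip d \<notin> darts_from G W \<Longrightarrow>
      \<exists>d' \<in> darts_from G W. dflip d' \<notin> darts_from G W \<and> \<psi> d = \<rho> d'"
proof -
  let ?S = "darts_from G W"
  have mem: "\<rho> x \<in> ?S \<longleftrightarrow> x \<in> ?S" if "x \<in> darts G" for x
    using that rot by (auto simp: rotation_system_def bij_betw_def darts_from_def)
  show "\<psi> d = \<rho> (dflip d)" if "dflip d \<in> ?S"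
    using first_return_immediate[of "\<rho> \<circ> dflip" d ?S] mem that by (auto simp: \<psi>_def darts_from_def)
  assume nd: "dflip d \<notin> ?S"
  have S: "?S \<subseteq> darts G" by (auto simp: darts_from_def)
  obtain z where z: "z \<in> darts G" "\<psi> d = \<rho> (dflip z)" "z = d \<or> z \<notin> ?S"
    using first_return_last_step[OF finite_darts[OF wf] bij_betw_face_perm[OF rot] S d]
    by (auto simp: \<psi>_def)
  have "\<psi> d \<in> ?S"
    using first_return_in[OF finite_darts[OF wf] bij_betw_face_perm[OF rot] S d] by (simp add: \<psi>_def)
  then have "dflip z \<in> ?S" using mem z(1,2) by simp
  \<comment> \<open>The witness is the reverse of the last dart walked. That dart is not
    \<open>d\<close>, since its reverse lies in the set and \<open>dflip d\<close> does not.\<close>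
  then show "\<exists>d' \<in> ?S. dflip d' \<notin> ?S \<and> \<psi> d = \<rho> d'"
    using z nd by (intro bexI[of _ "dflip z"]) auto
qed

lemma one_face_return:
  assumes wf: "wf_graph G" and rot: "rotation_system G \<rho>" and one: "num_faces G \<rho> \<le> 1"
    and "d \<in> darts_from G W" and "d' \<in> darts_from G W"
  shows "same_orbit (first_return (\<rho> \<circ> dflip) (darts_from G W)) d d'"
proof -
  have "same_orbit (\<rho> \<circ> dflip) d d'"
    using num_faces_le_1_iff[OF wf rot] one assms(4,5) by (auto simp: darts_from_def)
  then show ?thesis
    using same_orbit_first_return[OF finite_darts[OF wf] bij_betw_face_perm[OF rot], of "darts_from G W"]
      assms(4,5) by (auto simp: darts_from_def)
qed

text \<open>With one cut edge, a face walk leaving over \<open>b\<close> can only come back over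
  \<open>b\<close>. The return map thus treats \<open>b\<close> as a dangling half-edge, and
  \<open>\<alpha>\<close> fixes it.\<close>

lemma one_face_bridge_side:
  assumes wf: "wf_graph H" and rot: "rotation_system H \<rho>" and one: "num_faces H \<rho> \<le> 1"
    and wfA: "wf_graph A" and ends: "\<And>e. e \<in> edges A \<Longrightarrow> ends A e = ends H e"
    and S: "darts_from H (verts A) = insert b (darts A)"
    and b: "b \<notin> darts A"
  obtains \<rho>' where "rotation_system A \<rho>'" and "num_faces A \<rho>' \<le> 1"
proof -
  let ?S = "darts_from H (verts A)"
  let ?\<psi> = "first_return (\<rho> \<circ> dflip) ?S"
  define \<alpha> where "\<alpha> d = (if d = b then b else dflip d)" for d
  have fin: "finite ?S" using finite_darts[OF wf] by (simp add: darts_from_def)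
  have fb: "dflip b \<notin> ?S" using b S dflip_in_darts[of b A] by (metis dflip_neq(1) insertE)
  have "\<exists>\<rho>'. rotation_system A \<rho>' \<and> (\<forall>d \<in> darts A. \<forall>d' \<in> darts A.
      same_orbit (\<rho> \<circ> \<alpha>) (id d) (id d') \<longrightarrow> same_orbit (\<rho>' \<circ> dflip) d d')"
  proof (rule rotation_from_half_edges(2)[OF fin, where tau = "dtail H" and \<iota> = id])
    show "bij_betw \<rho> ?S ?S" using darts_from_rotation(1)[OF wf rot] .
    show "\<And>x y. x \<in> ?S \<Longrightarrow> y \<in> ?S \<Longrightarrow> same_orbit \<rho> x y \<longleftrightarrow> dtail H x = dtail H y"
      using darts_from_rotation(2)[OF wf rot] .
    show "\<And>d. d \<in> darts A \<Longrightarrow> dtail H (id d) = dtail A d"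
      using ends by (auto simp: darts_def dtail_def)
  qed (use S b in \<open>auto simp: \<alpha>_def\<close>)
  then obtain \<rho>' where \<rho>': "rotation_system A \<rho>'"
    "\<And>d d'. d \<in> darts A \<Longrightarrow> d' \<in> darts A \<Longrightarrow> same_orbit (\<rho> \<circ> \<alpha>) d d' \<Longrightarrow> same_orbit (\<rho>' \<circ> dflip) d d'"
    by auto
  have \<psi>: "?\<psi> d = (\<rho> \<circ> \<alpha>) d" if dS: "d \<in> ?S" for d
  proof (cases "d = b")
    case True
    obtain d' where "d' \<in> ?S" "dflip d' \<notin> ?S" "?\<psi> d = \<rho> d'"
      using face_return(2)[OF wf rot dS] True fb by blast
    then show ?thesis using S True by (auto simp: \<alpha>_def)
  next
    case False
    then show ?thesis using face_return(1)[OF wf rot that] S that by (auto simp: \<alpha>_def)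
  qed
  have Ssub: "?S \<subseteq> darts H" by (auto simp: darts_from_def)
  have cl: "?\<psi> ` ?S \<subseteq> ?S"
    using first_return_in[OF finite_darts[OF wf] bij_betw_face_perm[OF rot] Ssub] by blast
  have "same_orbit (\<rho> \<circ> \<alpha>) d d'" if "d \<in> ?S" "d' \<in> ?S" for d d'
    using same_orbit_cong_on[OF cl \<psi> that(1)] one_face_return[OF wf rot one that] by blast
  then have "num_faces A \<rho>' \<le> 1" using num_faces_le_1_iff[OF wfA \<rho>'(1)] \<rho>'(2) S by auto
  then show ?thesis using that \<rho>'(1) by blast
qed

text \<open>The far side of a 2-edge-cut is traversed by the unique face walk exactly twice. Each
  passage either returns through the edge it came from or crosses to the other one, so contracting
  the far side to the edge \<open>e\<close> gives the face permutation up to one transposition.\<close>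

lemma two_faces_replace_side:
  assumes wf: "wf_graph H" and rot: "rotation_system H \<rho>" and one: "num_faces H \<rho> \<le> 1"
    and wfA: "wf_graph A" and e: "e \<in> edges A"
    and ends: "\<And>g. g \<in> edges A \<Longrightarrow> g \<noteq> e \<Longrightarrow> ends A g = ends H g"
    and S: "darts_from H (verts A) = {b1, b2} \<union> (edges A - {e}) \<times> UNIV"
    and b: "b1 \<noteq> b2" "fst b1 \<notin> edges A - {e}" "fst b2 \<notin> edges A - {e}" "b2 \<noteq> dflip b1"
    and tails: "dtail A (e, True) = dtail H b1" "dtail A (e, False) = dtail H b2"
  obtains \<rho>' where "rotation_system A \<rho>'" and "num_faces A \<rho>' \<le> 2"
proof -
  let ?S = "darts_from H (verts A)"
  let ?\<psi> = "first_return (\<rho> \<circ> dflip) ?S"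
  \<comment> \<open>\<open>b1\<close> and \<open>b2\<close> become the two darts of the replacement
    edge \<open>e\<close>, so the new flip exchanges them.\<close>
  define \<alpha> where "\<alpha> d = (if d = b1 then b2 else if d = b2 then b1 else dflip d)" for d
  define \<iota> where "\<iota> d = (if fst d = e then (if snd d then b1 else b2) else d)" for d
  have fin: "finite ?S" using finite_darts[OF wf] by (simp add: darts_from_def)
  have dA: "darts A = {(e, True), (e, False)} \<union> (edges A - {e}) \<times> UNIV"
    using e by (auto simp: darts_def)
  have bS: "b1 \<in> ?S" "b2 \<in> ?S" using S by auto
  define K :: "'b dart set" where "K = (edges A - {e}) \<times> UNIV"
  have S': "d \<in> ?S \<longleftrightarrow> d = b1 \<or> d = b2 \<or> d \<in> K" for d unfolding S K_def by blast
  have flipK: "dflip d \<in> K \<longleftrightarrow> d \<in> K" for d by (simp add: K_def mem_Times_iff)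
  have bK: "b1 \<notin> K" "b2 \<notin> K" using b by (simp_all add: K_def mem_Times_iff)
  have inner: "dflip d \<in> ?S" "\<alpha> d = dflip d" if "d \<in> ?S" "d \<noteq> b1" "d \<noteq> b2" for d
    using that flipK[of d] unfolding S' \<alpha>_def by auto
  have "dflip b2 \<noteq> b1" using b(4) by auto
  then have bd: "dflip b1 \<notin> ?S" "dflip b2 \<notin> ?S"
    using b(4) bK flipK[of b1] flipK[of b2] unfolding S' by auto
  have \<iota>K: "\<iota> d = d" if "d \<in> K" for d using that by (auto simp: K_def \<iota>_def)
  have \<iota>e: "\<iota> (e, True) = b1" "\<iota> (e, False) = b2" by (simp_all add: \<iota>_def)
  have dA': "darts A = insert (e, True) (insert (e, False) K)" unfolding dA K_def by simp
  have "\<iota> ` K = K" using \<iota>K by simp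
  then have im: "\<iota> ` darts A = ?S" unfolding dA' using S' \<iota>e by (simp add: set_eq_iff)
  have ext: "finite ?S" "bij_betw \<rho> ?S ?S"
    "\<And>x y. x \<in> ?S \<Longrightarrow> y \<in> ?S \<Longrightarrow> same_orbit \<rho> x y \<longleftrightarrow> dtail H x = dtail H y"
    "inj_on \<iota> (darts A)" "\<And>d. d \<in> darts A \<Longrightarrow> \<iota> d \<in> ?S"
    "\<And>d. d \<in> darts A \<Longrightarrow> dtail H (\<iota> d) = dtail A d"
    "\<And>d. d \<in> darts A \<Longrightarrow> \<alpha> (\<iota> d) = \<iota> (dflip d)"
    "\<And>x. x \<in> ?S - \<iota> ` darts A \<Longrightarrow> \<alpha> x = x"
  proof -
    have "inj_on \<iota> K" using \<iota>K by (auto intro: inj_onI)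
    then show "inj_on \<iota> (darts A)"
      unfolding dA' using b(1) bK \<iota>e \<open>\<iota> ` K = K\<close> by (auto simp: inj_on_insert)
    show "dtail H (\<iota> d) = dtail A d" if "d \<in> darts A" for d
    proof (cases "d \<in> K")
      case True
      then show ?thesis using \<iota>K[OF True] ends[of "fst d"] by (auto simp: K_def dtail_def)
    qed (use that tails \<iota>e in \<open>auto simp: dA'\<close>)
    show "\<alpha> (\<iota> d) = \<iota> (dflip d)" if "d \<in> darts A" for d
    proof (cases "d \<in> K")
      case True
      then show ?thesis using \<iota>K flipK[of d] bK by (auto simp: \<alpha>_def)
    qed (use that \<iota>e b(1) in \<open>auto simp: dA' dflip_def \<alpha>_def\<close>)
  qed (use fin im darts_from_rotation[OF wf rot, where W = "verts A"] in auto)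
  have \<phi>: "bij_betw (\<rho> \<circ> \<alpha>) ?S ?S"
    by (rule rotation_from_half_edges(1)[where A = A and \<iota> = \<iota> and tau = "dtail H"]) (fact ext)+
  have "\<exists>\<rho>'. rotation_system A \<rho>' \<and> (\<forall>d \<in> darts A. \<forall>d' \<in> darts A.
      same_orbit (\<rho> \<circ> \<alpha>) (\<iota> d) (\<iota> d') \<longrightarrow> same_orbit (\<rho>' \<circ> dflip) d d')"
    by (rule rotation_from_half_edges(2)[where tau = "dtail H"]) (fact ext)+
  then obtain \<rho>' where \<rho>': "rotation_system A \<rho>'"
    "\<And>d d'. d \<in> darts A \<Longrightarrow> d' \<in> darts A \<Longrightarrow> same_orbit (\<rho> \<circ> \<alpha>) (\<iota> d) (\<iota> d') \<Longrightarrow> same_orbit (\<rho>' \<circ> dflip) d d'"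
    by (elim exE conjE) simp
  have \<psi>_inner: "?\<psi> d = \<rho> (\<alpha> d)" if "d \<in> ?S" "d \<noteq> b1" "d \<noteq> b2" for d
    using face_return(1)[OF wf rot that(1)] inner[OF that] by simp
  have \<psi>_bd: "?\<psi> d = \<rho> b1 \<or> ?\<psi> d = \<rho> b2" if d: "d = b1 \<or> d = b2" for d
  proof -
    obtain d' where d': "d' \<in> ?S" "dflip d' \<notin> ?S" "?\<psi> d = \<rho> d'"
      using face_return(2)[OF wf rot, where d = d and W = "verts A"] bS bd d by blast
    then have "d' = b1 \<or> d' = b2" using inner(1) by blast
    then show ?thesis using d'(3) by blast
  qed
  have Ssub: "?S \<subseteq> darts H" by (auto simp: darts_from_def)
  note \<psi>bij = first_return_bij[OF finite_darts[OF wf] bij_betw_face_perm[OF rot] Ssub]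
  have cl: "?\<psi> ` ?S \<subseteq> ?S" using \<psi>bij by (simp add: bij_betw_def)
  \<comment> \<open>Injectivity excludes that both passages end at the same half-edge. Either both
    cross over, which is what the edge \<open>e\<close> does, or both turn back.\<close>
  have "?\<psi> b1 \<noteq> ?\<psi> b2" using \<psi>bij bS b(1) by (metis bij_betw_imp_inj_on inj_onD)
  then consider "?\<psi> b1 = \<rho> b2" "?\<psi> b2 = \<rho> b1" | "?\<psi> b1 = \<rho> b1" "?\<psi> b2 = \<rho> b2"
    using \<psi>_bd by metis
  then have three: "same_orbit (\<rho> \<circ> \<alpha>) x y \<or> same_orbit (\<rho> \<circ> \<alpha>) y z \<or> same_orbit (\<rho> \<circ> \<alpha>) x z"
    if xyz: "x \<in> ?S" "y \<in> ?S" "z \<in> ?S" for x y z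
  proof cases
    case 1
    have "?\<psi> d = (\<rho> \<circ> \<alpha>) d" if "d \<in> ?S" for d using \<psi>_inner[OF that] 1 by (auto simp: \<alpha>_def)
    from same_orbit_cong_on[OF cl this xyz(1)] one_face_return[OF wf rot one xyz(1,2)]
    show ?thesis by blast
  next
    case 2
    \<comment> \<open>Turning back differs from crossing by a transposition. As \<open>?g\<close>
      has a single orbit, undoing the transposition leaves two.\<close>
    let ?g = "\<rho> \<circ> \<alpha> \<circ> transpose b1 b2"
    have "?\<psi> d = ?g d" if "d \<in> ?S" for d
      using \<psi>_inner[OF that] 2 b(1) by (auto simp: \<alpha>_def transpose_def)
    then have g: "same_orbit ?g u v" if "u \<in> ?S" "v \<in> ?S" for u v
      using same_orbit_cong_on[OF cl _ that(1)] one_face_return[OF wf rot one that] by blast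
    have "same_orbit (\<rho> \<circ> \<alpha>) b1 u \<or> same_orbit (\<rho> \<circ> \<alpha>) b2 u" if "u \<in> ?S" for u
      using split_single_orbit(2)[OF fin bij_betw_comp_transpose[OF \<phi> bS] bS b(1) g that]
      unfolding transpose_comp_cancel .
    moreover have "same_orbit (\<rho> \<circ> \<alpha>) u v"
      if "same_orbit (\<rho> \<circ> \<alpha>) w u" "same_orbit (\<rho> \<circ> \<alpha>) w v" "w \<in> ?S" for u v w
      using same_orbit_trans[OF same_orbit_sym[OF fin \<phi> that(3,1)] that(2)] .
    ultimately show ?thesis using xyz bS by meson
  qed
  have "num_faces A \<rho>' \<le> 2"
  proof (rule num_faces_le_2[OF wfA \<rho>'(1)])
    fix x y z assume d: "x \<in> darts A" "y \<in> darts A" "z \<in> darts A"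
    show "same_orbit (\<rho>' \<circ> dflip) x y \<or> same_orbit (\<rho>' \<circ> dflip) y z \<or> same_orbit (\<rho>' \<circ> dflip) x z"
      using three[of "\<iota> x" "\<iota> y" "\<iota> z"] \<rho>'(2) d ext(5) by blast
  qed
  then show ?thesis using that \<rho>'(1) by blast
qed

section \<open>Building embeddings edge by edge\<close>

text \<open>Half-edges: \<open>Inr d\<close> is the dart \<open>d\<close>, and \<open>Inl v\<close> is a dangling half-edge at
  \<open>v\<close>. The latter marks a corner at \<open>v\<close> even when \<open>v\<close> is isolated, so every edge
  insertion has the same form.\<close>

definition htail :: "('v, 'e) mgraph \<Rightarrow> 'v + 'e dart \<Rightarrow> 'v" where
  "htail G = case_sum (\<lambda>v. v) (dtail G)"

definition hflip :: "'v + 'e dart \<Rightarrow> 'v + 'e dart" where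
  "hflip = map_sum (\<lambda>v. v) dflip"

definition hedges :: "('v, 'e) mgraph \<Rightarrow> 'e set \<Rightarrow> ('v + 'e dart) set" where
  "hedges G F = Inl ` verts G \<union> Inr ` (F \<times> UNIV)"

text \<open>With \<open>permutes\<close>, half-edges not yet attached are fixed points, so attaching
  one is a composition with a transposition.\<close>

definition partial_rotation ::
  "('v, 'e) mgraph \<Rightarrow> ('v + 'e dart) set \<Rightarrow> ('v + 'e dart \<Rightarrow> 'v + 'e dart) \<Rightarrow> bool" where
  "partial_rotation G I \<rho> \<longleftrightarrow> \<rho> permutes I \<and>
     (\<forall>x \<in> I. \<forall>y \<in> I. same_orbit \<rho> x y \<longleftrightarrow> htail G x = htail G y)"

definition adj_by :: "('v, 'e) mgraph \<Rightarrow> 'e set \<Rightarrow> ('v \<times> 'v) set" where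
  "adj_by G F = {(x, y). \<exists>e \<in> F. joins G e x y}"

lemma htail_simps [simp]: "htail G (Inl v) = v" "htail G (Inr d) = dtail G d"
  by (simp_all add: htail_def)

lemma hflip_simps [simp]: "hflip (Inl v) = Inl v" "hflip (Inr d) = Inr (dflip d)"
  by (simp_all add: hflip_def)

lemma hflip_hflip [simp]: "hflip (hflip x) = x"
  by (cases x) simp_all

lemma Inl_in_hedges [simp]: "Inl v \<in> hedges G F \<longleftrightarrow> v \<in> verts G"
  by (auto simp: hedges_def)

lemma Inr_in_hedges [simp]: "Inr d \<in> hedges G F \<longleftrightarrow> fst d \<in> F"
  by (cases d) (auto simp: hedges_def)

lemma hflip_in_hedges [simp]: "hflip x \<in> hedges G F \<longleftrightarrow> x \<in> hedges G F"
  by (cases x) simp_all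

lemma finite_hedges: "wf_graph G \<Longrightarrow> F \<subseteq> edges G \<Longrightarrow> finite (hedges G F)"
  unfolding hedges_def wf_graph_def using finite_subset[of F "edges G"]
  by (simp add: finite_cartesian_product)

lemma hedges_insert: "hedges G (insert (fst d) F) = insert (Inr (dflip d)) (insert (Inr d) (hedges G F))"
proof -
  have "x \<in> hedges G (insert (fst d) F) \<longleftrightarrow> x = Inr (dflip d) \<or> x = Inr d \<or> x \<in> hedges G F" for x
  proof (cases x)
    case (Inr c)
    have "c = d \<or> c = dflip d \<longleftrightarrow> fst c = fst d" by (cases c; cases d) (auto simp: dflip_def)
    then show ?thesis using Inr by auto
  qed simp
  then show ?thesis by blast
qed

lemma bij_betw_hflip: "bij_betw hflip (hedges G F) (hedges G F)"
  by (rule bij_betw_byWitness[where f' = hflip]) auto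

lemma dtail_dflip_joins: "joins G (fst d) (dtail G d) (dtail G (dflip d))"
  by (cases "ends G (fst d)") (auto simp: joins_def dtail_def dflip_def)

lemma joins_dtailE:
  assumes "joins G e x y"
  obtains d where "fst d = e" "dtail G d = x" "dtail G (dflip d) = y"
proof -
  have "fst (e, ends G e = (x, y)) = e" "dtail G (e, ends G e = (x, y)) = x"
    "dtail G (dflip (e, ends G e = (x, y))) = y"
    using assms by (auto simp: joins_def dtail_def dflip_def)
  then show ?thesis using that by blast
qed

section \<open>Insertion of half-edges as transpositions\<close>

lemma transpose_comp_involution:
  assumes "\<And>x. h (h x) = x"
  shows "transpose r a \<circ> h = h \<circ> transpose (h r) (h a)"
proof
  fix x
  have "h x = r \<longleftrightarrow> x = h r" "h x = a \<longleftrightarrow> x = h a" using assms by metis+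
  then show "(transpose r a \<circ> h) x = (h \<circ> transpose (h r) (h a)) x"
    using assms by (simp add: transpose_def)
qed

text \<open>If \<open>\<rho>\<close> fixes \<open>a\<close>, then
  \<open>\<rho> \<circ> transpose r a\<close> places \<open>a\<close> right after \<open>r\<close>.
  Moving the transposition past the involution \<open>hflip\<close> shows that the face permutation
  also changes by one transposition, hence by one merge or split.\<close>

lemma insert_half_edge_face_perm:
  "\<rho> \<circ> transpose r a \<circ> hflip = \<rho> \<circ> hflip \<circ> transpose (hflip r) (hflip a)"
  using transpose_comp_involution[of hflip r a] by (simp add: comp_assoc)

lemma permutes_same_orbit_fixed:
  assumes "p permutes S" and "x \<notin> S"
  shows "same_orbit p x y \<longleftrightarrow> x = y"
proof
  assume "same_orbit p x y"
  then show "x = y" by (induction rule: same_orbit_induct) (use assms in \<open>auto simp: permutes_def\<close>)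
qed simp

lemma permutes_same_orbit_in:
  assumes "p permutes S" and "x \<in> S" and "same_orbit p x y"
  shows "y \<in> S"
  using same_orbit_closed[of p S x y] assms permutes_image[OF assms(1)] by simp

text \<open>The unattached \<open>a\<close> is a cycle of its own, so the transposition merges it
  into the cycle of \<open>r\<close>, which belongs to the same vertex.\<close>

lemma partial_rotation_insert:
  assumes fin: "finite I" and pr: "partial_rotation G I \<rho>" and r: "r \<in> I" and a: "a \<notin> I"
    and tail: "htail G r = htail G a"
  shows "partial_rotation G (insert a I) (\<rho> \<circ> transpose r a)"
proof -
  let ?I = "insert a I"
  have p: "\<rho> permutes I" and orb: "\<And>x y. x \<in> I \<Longrightarrow> y \<in> I \<Longrightarrow> same_orbit \<rho> x y \<longleftrightarrow> htail G x = htail G y"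
    using pr by (auto simp: partial_rotation_def)
  have p': "\<rho> permutes ?I" using permutes_subset[OF p] by blast
  have fixed: "same_orbit \<rho> a y \<longleftrightarrow> a = y" for y using permutes_same_orbit_fixed[OF p a] .
  have out: "\<not> same_orbit \<rho> x a" if "x \<in> I" for x using permutes_same_orbit_in[OF p that] a by blast
  have "same_orbit (\<rho> \<circ> transpose r a) x y \<longleftrightarrow> htail G x = htail G y" if xy: "x \<in> ?I" "y \<in> ?I" for x y
  proof -
    have "same_orbit (\<rho> \<circ> transpose r a) x y \<longleftrightarrow> same_orbit \<rho> x y \<or>
      ((same_orbit \<rho> r x \<or> same_orbit \<rho> a x) \<and> (same_orbit \<rho> r y \<or> same_orbit \<rho> a y))"
      using orbit_merge[OF _ permutes_imp_bij[OF p'] _ _ out[OF r] xy] fin r by simp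
    then show ?thesis
      using xy fixed out orb[OF r] orb tail r by (cases "x = a"; cases "y = a") auto
  qed
  moreover have "(\<rho> \<circ> transpose r a) permutes ?I"
    using permutes_compose[OF permutes_swap_id p'] r by blast
  ultimately show ?thesis unfolding partial_rotation_def by blast
qed

text \<open>The half-edges \<open>r\<close> and \<open>s\<close> mark the corners in which the two
  ends of the new edge are placed. Whether \<open>hflip r\<close> and \<open>hflip s\<close> lie on
  the same old face decides between splitting a face and merging two.\<close>

locale edge_insertion =
  fixes G :: "('v, 'e) mgraph" and F :: "'e set" and \<rho> :: "'v + 'e dart \<Rightarrow> 'v + 'e dart"
    and d :: "'e dart" and r s :: "'v + 'e dart"
  assumes wf: "wf_graph G" and F: "F \<subseteq> edges G" and pr: "partial_rotation G (hedges G F) \<rho>"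
    and d: "fst d \<in> edges G" "fst d \<notin> F"
    and r: "r \<in> hedges G F" "htail G r = dtail G d"
    and s: "s \<in> hedges G F" "htail G s = dtail G (dflip d)"
begin

abbreviation "D' \<equiv> hedges G (insert (fst d) F)"

definition "\<rho>' = \<rho> \<circ> transpose r (Inr d) \<circ> transpose s (Inr (dflip d))"

text \<open>The face permutation when only one end of the new edge is attached.\<close>

definition "\<phi>1 = \<rho> \<circ> hflip \<circ> transpose (hflip r) (Inr (dflip d))"

text \<open>Once one end is attached, both darts of the new edge lie on the face of
  \<open>hflip r\<close>; they are replaced by this old representative.\<close>

definition "anchor x = (if x = Inr d \<or> x = Inr (dflip d) then hflip r else x)"

lemma fin: "finite D'"
  using finite_hedges[OF wf] F d by simp

lemma new_partial_rotation: "partial_rotation G D' \<rho>'"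
proof -
  have "finite (hedges G F)" using finite_hedges[OF wf F] .
  then have "partial_rotation G (insert (Inr d) (hedges G F)) (\<rho> \<circ> transpose r (Inr d))"
    by (rule partial_rotation_insert[OF _ pr r(1)]) (use r d in simp_all)
  then show ?thesis
    unfolding \<rho>'_def hedges_insert
    by (rule partial_rotation_insert[rotated]) (use s d finite_hedges[OF wf F] in simp_all)
qed

lemma new_face_perm: "\<rho>' \<circ> hflip = \<phi>1 \<circ> transpose (hflip s) (Inr d)"
  unfolding \<rho>'_def \<phi>1_def insert_half_edge_face_perm
  using insert_half_edge_face_perm[of \<rho> r "Inr d"] by simp

text \<open>Before attachment the new edge is a face cycle of its own, consisting of its two
  darts.\<close>

lemma old_face_perm:
  shows "bij_betw (\<rho> \<circ> hflip) D' D'"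
    and "(\<rho> \<circ> hflip) (Inr d) = Inr (dflip d)" "(\<rho> \<circ> hflip) (Inr (dflip d)) = Inr d"
    and "(\<rho> \<circ> hflip) ` hedges G F \<subseteq> hedges G F"
proof -
  have p: "\<rho> permutes hedges G F" using pr by (simp add: partial_rotation_def)
  then have "\<rho> permutes D'" by (rule permutes_subset) (auto simp: hedges_def)
  then show "bij_betw (\<rho> \<circ> hflip) D' D'"
    using bij_betw_trans[OF bij_betw_hflip permutes_imp_bij] by blast
  show "(\<rho> \<circ> hflip) (Inr d) = Inr (dflip d)" "(\<rho> \<circ> hflip) (Inr (dflip d)) = Inr d"
    using permutes_not_in[OF p, of "Inr d"] permutes_not_in[OF p, of "Inr (dflip d)"] d by simp_all
  show "(\<rho> \<circ> hflip) ` hedges G F \<subseteq> hedges G F"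
    by (rule image_subsetI) (simp add: permutes_in_image[OF p])
qed

lemma new_mem: "Inr d \<in> D'" "Inr (dflip d) \<in> D'" "hflip r \<in> D'" "hflip s \<in> D'"
  using r s by (simp_all add: hedges_insert)

lemma new_neq: "hflip s \<noteq> Inr d" "hflip s \<noteq> Inr (dflip d)"
proof -
  have "hflip s \<in> hedges G F" "Inr d \<notin> hedges G F" "Inr (dflip d) \<notin> hedges G F" using s d by simp_all
  then show "hflip s \<noteq> Inr d" "hflip s \<noteq> Inr (dflip d)" by metis+
qed

lemma bij_\<phi>1: "bij_betw \<phi>1 D' D'"
  unfolding \<phi>1_def using bij_betw_comp_transpose[OF old_face_perm(1) new_mem(3,2)] .

lemma anchor_in: "x \<in> D' \<Longrightarrow> anchor x \<in> hedges G F"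
  using r by (auto simp: anchor_def hedges_insert)

text \<open>Attaching the first end merges the two-dart cycle of the new edge into the face of
  \<open>hflip r\<close>; the relation between old half-edges is unchanged.\<close>

lemma same_orbit_\<phi>1:
  assumes xy: "x \<in> D'" "y \<in> D'"
  shows "same_orbit \<phi>1 x y \<longleftrightarrow> same_orbit (\<rho> \<circ> hflip) (anchor x) (anchor y)"
proof -
  let ?\<phi> = "\<rho> \<circ> hflip"
  have new: "same_orbit ?\<phi> (Inr (dflip d)) z \<longleftrightarrow> z = Inr d \<or> z = Inr (dflip d)" for z
  proof
    assume "same_orbit ?\<phi> (Inr (dflip d)) z"
    then show "z = Inr d \<or> z = Inr (dflip d)"
      by (induction rule: same_orbit_induct) (use old_face_perm(2,3) in auto)
  next
    assume "z = Inr d \<or> z = Inr (dflip d)"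
    then show "same_orbit ?\<phi> (Inr (dflip d)) z"
      using same_orbit_apply[of ?\<phi> "Inr (dflip d)"] old_face_perm(3) by auto
  qed
  have newd: "\<not> same_orbit ?\<phi> (Inr d) z" if "z \<in> hedges G F" for z
  proof -
    have "same_orbit ?\<phi> (Inr (dflip d)) (Inr d)" using new by blast
    then show ?thesis using new[of z] that d same_orbit_trans by fastforce
  qed
  have old: "z \<in> hedges G F" if "same_orbit ?\<phi> w z" "w \<in> hedges G F" for w z
    using same_orbit_closed[OF old_face_perm(4) that(2,1)] .
  have nin: "Inr d \<notin> hedges G F" "Inr (dflip d) \<notin> hedges G F" using d by auto
  have hr: "hflip r \<in> hedges G F" using r by simp
  have sym: "same_orbit ?\<phi> u v \<Longrightarrow> same_orbit ?\<phi> v u" if "u \<in> D'" for u v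
    using same_orbit_sym[OF fin old_face_perm(1) that] .
  have ns: "\<not> same_orbit ?\<phi> (hflip r) (Inr (dflip d))" using old[OF _ hr] nin by blast
  have m: "same_orbit \<phi>1 x y \<longleftrightarrow> same_orbit ?\<phi> x y \<or>
    ((same_orbit ?\<phi> (hflip r) x \<or> x = Inr d \<or> x = Inr (dflip d)) \<and>
     (same_orbit ?\<phi> (hflip r) y \<or> y = Inr d \<or> y = Inr (dflip d)))"
    unfolding \<phi>1_def using orbit_merge[OF fin old_face_perm(1) new_mem(3,2) ns xy] new by simp
  have x: "x = Inr d \<or> x = Inr (dflip d) \<or> x \<in> hedges G F"
    and y: "y = Inr d \<or> y = Inr (dflip d) \<or> y \<in> hedges G F"
    using xy by (auto simp: hedges_insert)
  show ?thesis
  proof (cases "x \<in> hedges G F")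
    case True
    then have ax: "anchor x = x" using nin by (auto simp: anchor_def)
    show ?thesis
    proof (cases "y \<in> hedges G F")
      case True
      then have "anchor y = y" "y \<noteq> Inr d" "y \<noteq> Inr (dflip d)" using nin by (auto simp: anchor_def)
      then show ?thesis
        using m ax same_orbit_trans[OF sym[OF new_mem(3), of x], of y] \<open>x \<in> hedges G F\<close> nin by auto
    next
      case False
      then have "anchor y = hflip r" "y = Inr d \<or> y = Inr (dflip d)" using y by (auto simp: anchor_def)
      moreover have "\<not> same_orbit ?\<phi> x y" using old[OF _ True] False by blast
      ultimately show ?thesis
        using m ax True nin sym[OF new_mem(3), of x] sym[OF xy(1), of "hflip r"] by auto
    qed
  next
    case False
    then have ax: "anchor x = hflip r" "x = Inr d \<or> x = Inr (dflip d)" using x by (auto simp: anchor_def)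
    show ?thesis
    proof (cases "y \<in> hedges G F")
      case True
      then have "anchor y = y" "y \<noteq> Inr d" "y \<noteq> Inr (dflip d)" using nin by (auto simp: anchor_def)
      moreover have "\<not> same_orbit ?\<phi> x y" using ax(2) new[of y] newd[OF True] calculation by blast
      ultimately show ?thesis using m ax by auto
    next
      case False
      then have "anchor y = hflip r" "y = Inr d \<or> y = Inr (dflip d)" using y by (auto simp: anchor_def)
      then show ?thesis using m ax by auto
    qed
  qed
qed

text \<open>Attaching the second end transposes \<open>hflip s\<close> and \<open>Inr d\<close>, and
  \<open>Inr d\<close> already lies on the face of \<open>hflip r\<close>. For corners on different
  faces this merges the two.\<close>

lemma same_orbit_merge:
  assumes ns: "\<not> same_orbit (\<rho> \<circ> hflip) (hflip r) (hflip s)" and xy: "x \<in> D'" "y \<in> D'"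
  shows "same_orbit (\<rho>' \<circ> hflip) x y \<longleftrightarrow> same_orbit (\<rho> \<circ> hflip) (anchor x) (anchor y) \<or>
    (\<forall>z \<in> {x, y}. same_orbit (\<rho> \<circ> hflip) (hflip r) (anchor z) \<or>
      same_orbit (\<rho> \<circ> hflip) (hflip s) (anchor z))"
proof -
  have hs: "anchor (hflip s) = hflip s" "anchor (Inr d) = hflip r"
    using new_neq by (auto simp: anchor_def)
  have "\<not> same_orbit (\<rho> \<circ> hflip) (hflip s) (hflip r)"
    using ns same_orbit_sym[OF fin old_face_perm(1) new_mem(4)] by blast
  then have "\<not> same_orbit \<phi>1 (hflip s) (Inr d)"
    using same_orbit_\<phi>1[OF new_mem(4,1)] hs by simp
  from orbit_merge[OF fin bij_\<phi>1 new_mem(4,1) this xy] show ?thesis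
    unfolding new_face_perm using same_orbit_\<phi>1 xy new_mem hs by auto
qed

lemma bij_new_face_perm: "bij_betw (\<rho>' \<circ> hflip) D' D'"
  unfolding new_face_perm using bij_betw_comp_transpose[OF bij_\<phi>1 new_mem(4,1)] .

text \<open>A half-attached edge leaves a single face single, so the last transposition splits it
  into two cycles, with representatives \<open>hflip s\<close> and \<open>Inr d\<close>.\<close>

lemma split_one_face:
  assumes one: "\<And>x y. x \<in> hedges G F \<Longrightarrow> y \<in> hedges G F \<Longrightarrow> same_orbit (\<rho> \<circ> hflip) x y"
  shows "\<not> same_orbit (\<rho>' \<circ> hflip) (hflip s) (Inr d)"
    and "x \<in> D' \<Longrightarrow> same_orbit (\<rho>' \<circ> hflip) (hflip s) x \<or> same_orbit (\<rho>' \<circ> hflip) (Inr d) x"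
proof -
  have ne: "hflip s \<noteq> Inr d" using new_neq by blast
  have "same_orbit \<phi>1 x y" if "x \<in> D'" "y \<in> D'" for x y
    using same_orbit_\<phi>1[OF that] one anchor_in that by blast
  note split = split_single_orbit[OF fin bij_\<phi>1 new_mem(4,1) ne this]
  show "\<not> same_orbit (\<rho>' \<circ> hflip) (hflip s) (Inr d)"
    unfolding new_face_perm using split(1) by blast
  show "same_orbit (\<rho>' \<circ> hflip) (hflip s) x \<or> same_orbit (\<rho>' \<circ> hflip) (Inr d) x" if "x \<in> D'"
    unfolding new_face_perm using split(2) that by blast
qed

end

lemma partial_rotation_empty: "partial_rotation G (hedges G {}) id"
proof -
  have "same_orbit id x y \<longleftrightarrow> x = y" for x y :: "'a + 'b dart"
    by (auto simp: same_orbit_def)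
  then show ?thesis by (auto simp: partial_rotation_def hedges_def permutes_id)
qed

lemma edge_insertion_Inl:
  assumes "wf_graph G" "F \<subseteq> edges G" "partial_rotation G (hedges G F) \<rho>" "fst d \<in> edges G" "fst d \<notin> F"
  shows "edge_insertion G F \<rho> d (Inl (dtail G d)) (Inl (dtail G (dflip d)))"
proof
  have "d \<in> darts G" using assms(4) by (simp add: darts_def mem_Times_iff)
  then show "Inl (dtail G d) \<in> hedges G F" "Inl (dtail G (dflip d)) \<in> hedges G F"
    using dtail_in_verts[OF assms(1)] by simp_all
qed (use assms in simp_all)

lemma partial_rotation_exists:
  assumes wf: "wf_graph G" and F: "F \<subseteq> edges G"
  shows "\<exists>\<rho>. partial_rotation G (hedges G F) \<rho>"
proof -
  have "finite F" using F wf finite_subset by (auto simp: wf_graph_def)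
  then show ?thesis using F
  proof (induction F rule: finite_induct)
    case empty
    then show ?case using partial_rotation_empty by blast
  next
    case (insert e F)
    then obtain \<rho> where "partial_rotation G (hedges G F) \<rho>" by auto
    then interpret edge_insertion G F \<rho> "(e, True)" "Inl (dtail G (e, True))" "Inl (dtail G (dflip (e, True)))"
      using edge_insertion_Inl[OF wf, of F \<rho> "(e, True)"] insert by auto
    show ?case using new_partial_rotation by auto
  qed
qed

text \<open>The markers \<open>Inl v\<close> are fixed by \<open>hflip\<close>, that is, dangling,
  and can be skipped.\<close>

lemma rotation_of_partial_rotation:
  assumes wf: "wf_graph G" and pr: "partial_rotation G (hedges G (edges G)) \<rho>"
  obtains \<rho>' where "rotation_system G \<rho>'"
    and "\<And>d d'. d \<in> darts G \<Longrightarrow> d' \<in> darts G \<Longrightarrow>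
      same_orbit (\<rho> \<circ> hflip) (Inr d) (Inr d') \<Longrightarrow> same_orbit (\<rho>' \<circ> dflip) d d'"
proof -
  let ?D = "hedges G (edges G)"
  have D: "fst d \<in> edges G" if "d \<in> darts G" for d using that by (auto simp: darts_def)
  have "\<exists>\<rho>'. rotation_system G \<rho>' \<and> (\<forall>d \<in> darts G. \<forall>d' \<in> darts G.
      same_orbit (\<rho> \<circ> hflip) (Inr d) (Inr d') \<longrightarrow> same_orbit (\<rho>' \<circ> dflip) d d')"
  proof (rule rotation_from_half_edges(2)[where D = ?D and tau = "htail G"])
    show "finite ?D" using finite_hedges[OF wf] by simp
    show "bij_betw \<rho> ?D ?D" using pr by (simp add: partial_rotation_def permutes_imp_bij)
    show "\<And>x y. x \<in> ?D \<Longrightarrow> y \<in> ?D \<Longrightarrow> same_orbit \<rho> x y \<longleftrightarrow> htail G x = htail G y"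
      using pr unfolding partial_rotation_def by blast
    show "\<And>x. x \<in> ?D - Inr ` darts G \<Longrightarrow> hflip x = x"
      by (auto simp: hedges_def darts_def)
  qed (use D in auto)
  then show ?thesis using that by blast
qed

lemma rotation_system_exists:
  assumes "wf_graph G"
  shows "\<exists>\<rho>. rotation_system G \<rho>"
  using partial_rotation_exists[OF assms order_refl] rotation_of_partial_rotation[OF assms] by metis

section \<open>One-face embeddings grown from a tree\<close>

lemma sym_adj_by: "sym (adj_by G F)"
  by (auto simp: sym_def adj_by_def joins_def)

text \<open>Edges are added one at a time. Face walks stay within a component, so the ends of a new
  forest edge, lying in different components, have corners on different faces, and the insertion
  merges these.\<close>

lemma partial_rotation_forest:
  assumes wf: "wf_graph G" and T: "T \<subseteq> edges G"
    and forest: "\<And>d. fst d \<in> T \<Longrightarrow> (dtail G d, dtail G (dflip d)) \<notin> (adj_by G (T - {fst d}))\<^sup>*"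
  shows "\<exists>\<rho>. partial_rotation G (hedges G T) \<rho> \<and> (\<forall>x \<in> hedges G T. \<forall>y \<in> hedges G T.
    (htail G x, htail G y) \<in> (adj_by G T)\<^sup>* \<longrightarrow> same_orbit (\<rho> \<circ> hflip) x y)"
proof -
  let ?P = "\<lambda>F \<rho>. partial_rotation G (hedges G F) \<rho> \<and> (\<forall>x \<in> hedges G F. \<forall>y \<in> hedges G F.
    (htail G x, htail G y) \<in> (adj_by G F)\<^sup>* \<longrightarrow> same_orbit (\<rho> \<circ> hflip) x y)"
  \<comment> \<open>True for every rotation: a face step follows an edge of \<open>F\<close>, or
    stays at a marker, and then turns at a vertex.\<close>
  have conv: "(htail G x, htail G y) \<in> (adj_by G F)\<^sup>*"
    if "\<rho> permutes hedges G F" "partial_rotation G (hedges G F) \<rho>"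
      "same_orbit (\<rho> \<circ> hflip) x y" "x \<in> hedges G F" for \<rho> F x y
    using that(3)
  proof (induction rule: same_orbit_induct)
    case (step z)
    have cl: "(\<rho> \<circ> hflip) ` hedges G F \<subseteq> hedges G F"
      by (rule image_subsetI) (simp add: permutes_in_image[OF that(1)])
    have z: "z \<in> hedges G F" using same_orbit_closed[OF cl that(4) step(1)] .
    then have fz: "hflip z \<in> hedges G F" "\<rho> (hflip z) \<in> hedges G F"
      by (simp_all add: permutes_in_image[OF that(1)])
    have "htail G (\<rho> (hflip z)) = htail G (hflip z)"
      using that(2) fz same_orbit_apply[of \<rho> "hflip z"] unfolding partial_rotation_def by metis
    moreover have "(htail G z, htail G (hflip z)) \<in> (adj_by G F)\<^sup>*"
    proof (cases z)
      case (Inr d)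
      then have "(dtail G d, dtail G (dflip d)) \<in> adj_by G F"
        using z dtail_dflip_joins[of G d] by (auto simp: adj_by_def)
      then show ?thesis using Inr by auto
    qed simp
    ultimately show ?case using step(2) by (auto intro: rtrancl_trans)
  qed simp
  have "finite T" using T wf finite_subset by (auto simp: wf_graph_def)
  moreover have "F \<subseteq> T \<Longrightarrow> \<exists>\<rho>. ?P F \<rho>" if "finite F" for F
    using that
  proof (induction F rule: finite_induct)
    case empty
    have "x = y" if "x \<in> hedges G {}" "y \<in> hedges G {}" "(htail G x, htail G y) \<in> (adj_by G {})\<^sup>*" for x y
      using that by (auto simp: hedges_def adj_by_def)
    then show ?case using partial_rotation_empty by (metis same_orbit_refl)
  next
    case (insert e F)
    then have "\<exists>\<rho>. ?P F \<rho>" by blast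
    then obtain \<rho> where \<rho>: "partial_rotation G (hedges G F) \<rho>"
      and conn: "\<And>x y. x \<in> hedges G F \<Longrightarrow> y \<in> hedges G F \<Longrightarrow>
        (htail G x, htail G y) \<in> (adj_by G F)\<^sup>* \<Longrightarrow> same_orbit (\<rho> \<circ> hflip) x y" by blast
    define d where "d = (e, True)"
    have e: "e = fst d" by (simp add: d_def)
    interpret edge_insertion G F \<rho> d "Inl (dtail G d)" "Inl (dtail G (dflip d))"
      using edge_insertion_Inl[OF wf _ \<rho>, of d] insert T by (auto simp: e)
    let ?u = "Inl (dtail G d) :: 'a + 'b dart" and ?w = "Inl (dtail G (dflip d)) :: 'a + 'b dart"
    have p: "\<rho> permutes hedges G F" using \<rho> by (simp add: partial_rotation_def)
    have "F \<subseteq> T - {fst d}" using insert e by auto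
    then have "(adj_by G F)\<^sup>* \<subseteq> (adj_by G (T - {fst d}))\<^sup>*"
      by (intro rtrancl_mono) (auto simp: adj_by_def)
    then have "(dtail G d, dtail G (dflip d)) \<notin> (adj_by G F)\<^sup>*" using forest[of d] insert e by auto
    then have "\<not> same_orbit (\<rho> \<circ> hflip) ?u ?w" using conv[OF p \<rho>, of ?u ?w] r by auto
    then have ns: "\<not> same_orbit (\<rho> \<circ> hflip) (hflip ?u) (hflip ?w)" by simp
    note merge = same_orbit_merge[OF ns]
    have uw_D: "?u \<in> D'" "?w \<in> D'" using new_mem by simp_all
    have anch: "anchor ?u = ?u" "anchor ?w = ?w" "anchor (Inr d) = ?u" "anchor (Inr (dflip d)) = ?u"
      by (simp_all add: anchor_def)
    have uw: "same_orbit (\<rho>' \<circ> hflip) ?u ?w" using merge[OF uw_D] anch by simp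
    have old: "same_orbit (\<rho>' \<circ> hflip) x y"
      if "x \<in> hedges G F" "y \<in> hedges G F" "same_orbit (\<rho> \<circ> hflip) x y" for x y
    proof -
      have "anchor x = x" "anchor y = y" using that d by (auto simp: anchor_def)
      then show ?thesis using merge[of x y] that by (simp add: hedges_insert)
    qed
    have sym': "same_orbit (\<rho>' \<circ> hflip) x y \<Longrightarrow> same_orbit (\<rho>' \<circ> hflip) y x" if "x \<in> D'" for x y
      using same_orbit_sym[OF fin bij_new_face_perm that] .
    \<comment> \<open>Every half-edge shares its face with the marker at its vertex, so walks in the
      forest need to be followed along markers only.\<close>
    have corner: "same_orbit (\<rho>' \<circ> hflip) x (Inl (htail G x))" "htail G x \<in> verts G" if x: "x \<in> D'" for x
    proof -
      have eG: "fst d \<in> edges G" using insert T e by auto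
      show V: "htail G x \<in> verts G"
      proof (cases x)
        case (Inr c)
        then have "c \<in> darts G" using x F eG by (auto simp: darts_def mem_Times_iff)
        then show ?thesis using Inr dtail_in_verts[OF wf] by simp
      qed (use x in simp)
      consider "x = Inr d" | "x = Inr (dflip d)" | "x \<in> hedges G F" using x by (auto simp: hedges_insert)
      then show "same_orbit (\<rho>' \<circ> hflip) x (Inl (htail G x))"
      proof cases
        case 1
        then show ?thesis using merge[OF x uw_D(1)] anch by simp
      next
        case 2
        then have "same_orbit (\<rho>' \<circ> hflip) x ?u" using merge[OF x uw_D(1)] anch by simp
        then show ?thesis using uw same_orbit_trans 2 by auto
      next
        case 3
        then show ?thesis using old[of x "Inl (htail G x)"] conn[of x "Inl (htail G x)"] V by simp
      qed
    qed
    have hop: "same_orbit (\<rho>' \<circ> hflip) (Inl p) (Inl q)" "q \<in> verts G"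
      if pq: "(p, q) \<in> adj_by G (insert (fst d) F)" and pV: "p \<in> verts G" for p q
    proof -
      obtain g where g: "g \<in> insert (fst d) F" "joins G g p q" using pq by (auto simp: adj_by_def)
      have "g \<in> edges G" using g insert T e by auto
      then show qV: "q \<in> verts G" using g(2) wf by (auto simp: wf_graph_def joins_def)
      show "same_orbit (\<rho>' \<circ> hflip) (Inl p) (Inl q)"
      proof (cases "g \<in> F")
        case True
        then have "(p, q) \<in> (adj_by G F)\<^sup>*" using g by (auto simp: adj_by_def)
        then show ?thesis using old[of "Inl p" "Inl q"] conn[of "Inl p" "Inl q"] pV qV by simp
      next
        case False
        then have "joins G (fst d) p q" using g by auto
        then have "(p = dtail G d \<and> q = dtail G (dflip d)) \<or> (q = dtail G d \<and> p = dtail G (dflip d))"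
          by (auto simp: joins_def dtail_def dflip_def)
        then show ?thesis using uw sym'[OF uw_D(1) uw] by auto
      qed
    qed
    have walk: "same_orbit (\<rho>' \<circ> hflip) (Inl p) (Inl q) \<and> q \<in> verts G"
      if "(p, q) \<in> (adj_by G (insert (fst d) F))\<^sup>*" "p \<in> verts G" for p q
      using that(1)
    proof (induction rule: rtrancl_induct)
      case (step y z)
      then have y: "y \<in> verts G" "same_orbit (\<rho>' \<circ> hflip) (Inl p) (Inl y)" by blast+
      show ?case using same_orbit_trans[OF y(2) hop(1)[OF step(2) y(1)]] hop(2)[OF step(2) y(1)] by blast
    qed (use that in simp)
    have "same_orbit (\<rho>' \<circ> hflip) x y" if xy: "x \<in> D'" "y \<in> D'"
      "(htail G x, htail G y) \<in> (adj_by G (insert (fst d) F))\<^sup>*" for x y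
    proof -
      have "same_orbit (\<rho>' \<circ> hflip) (Inl (htail G x)) (Inl (htail G y))"
        using walk[OF xy(3) corner(2)[OF xy(1)]] by blast
      from same_orbit_trans[OF corner(1)[OF xy(1)] same_orbit_trans[OF this sym'[OF xy(2) corner(1)[OF xy(2)]]]]
      show ?thesis .
    qed
    then show ?case using new_partial_rotation unfolding e by blast
  qed
  ultimately show ?thesis by blast
qed

definition one_face_on :: "('v, 'e) mgraph \<Rightarrow> 'e set \<Rightarrow> ('v + 'e dart \<Rightarrow> 'v + 'e dart) \<Rightarrow> bool" where
  "one_face_on G F \<rho> \<longleftrightarrow> partial_rotation G (hedges G F) \<rho> \<and>
     (\<forall>x \<in> hedges G F. \<forall>y \<in> hedges G F. same_orbit (\<rho> \<circ> hflip) x y)"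

text \<open>The first edge of an adjacent pair splits the face, and both faces have a corner at the
  common vertex, on either side of the first edge. So the second edge can be attached there in the
  face not containing the corner chosen at its other end, and merges the two faces again.\<close>

lemma one_face_on_insert_pair:
  assumes wf: "wf_graph G" and F: "F \<subseteq> edges G" and one: "one_face_on G F \<rho>"
    and a: "fst a \<in> edges G" "fst a \<notin> F" and c: "fst c \<in> edges G" "fst c \<notin> F" "fst c \<noteq> fst a"
    and tails: "dtail G c = dtail G a"
  shows "\<exists>\<rho>'. one_face_on G (insert (fst c) (insert (fst a) F)) \<rho>'"
proof -
  have pr: "partial_rotation G (hedges G F) \<rho>"
    and one': "\<And>x y. x \<in> hedges G F \<Longrightarrow> y \<in> hedges G F \<Longrightarrow> same_orbit (\<rho> \<circ> hflip) x y"
    using one unfolding one_face_on_def by blast+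
  let ?v = "Inl (dtail G a) :: 'a + 'b dart" and ?w = "Inl (dtail G (dflip c)) :: 'a + 'b dart"
  \<comment> \<open>Taking \<open>dflip a\<close> makes the common vertex the end attached second.
    The split then separates \<open>?v\<close> from \<open>Inr (dflip a)\<close>, the flips of the
    two corners \<open>?v\<close> and \<open>Inr a\<close> at that vertex.\<close>
  interpret A: edge_insertion G F \<rho> "dflip a" "Inl (dtail G (dflip a))" "?v"
    using edge_insertion_Inl[OF wf F pr, of "dflip a"] a by simp
  let ?F = "insert (fst a) F" and ?\<phi> = "A.\<rho>' \<circ> hflip"
  have ns: "\<not> same_orbit ?\<phi> ?v (Inr (dflip a))" using A.split_one_face(1)[OF one'] by simp
  have two: "same_orbit ?\<phi> ?v x \<or> same_orbit ?\<phi> (Inr (dflip a)) x" if "x \<in> hedges G ?F" for x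
    using A.split_one_face(2)[OF one', of x] that by simp
  have fin: "finite (hedges G ?F)" using A.fin by simp
  have bij: "bij_betw ?\<phi> (hedges G ?F) (hedges G ?F)" using A.bij_new_face_perm by simp
  have vF: "?v \<in> hedges G ?F" "Inr (dflip a) \<in> hedges G ?F" using A.s by (simp_all)
  have "c \<in> darts G" using c by (simp add: darts_def mem_Times_iff)
  then have wF: "?w \<in> hedges G ?F" using dtail_in_verts[OF wf, of "dflip c"] by simp
  have sym: "same_orbit ?\<phi> x y \<Longrightarrow> same_orbit ?\<phi> y x" if "x \<in> hedges G ?F" for x y
    using same_orbit_sym[OF fin bij that] .
  obtain r where r: "r = ?v \<or> r = Inr a" "\<not> same_orbit ?\<phi> (hflip r) ?w"
    "\<And>x. x \<in> hedges G ?F \<Longrightarrow> same_orbit ?\<phi> (hflip r) x \<or> same_orbit ?\<phi> ?w x"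
  proof (cases "same_orbit ?\<phi> ?v ?w")
    case True
    have "\<not> same_orbit ?\<phi> (Inr (dflip a)) ?w"
      using ns same_orbit_trans[OF True sym[OF vF(2)]] by blast
    moreover have "same_orbit ?\<phi> (Inr (dflip a)) x \<or> same_orbit ?\<phi> ?w x" if "x \<in> hedges G ?F" for x
      using two[OF that] same_orbit_trans[OF sym[OF vF(1) True]] by blast
    ultimately show ?thesis using that[of "Inr a"] by simp
  next
    case False
    then have "same_orbit ?\<phi> (Inr (dflip a)) ?w" using two[OF wF] by blast
    then have "same_orbit ?\<phi> ?v x \<or> same_orbit ?\<phi> ?w x" if "x \<in> hedges G ?F" for x
      using two[OF that] same_orbit_trans[OF sym[OF vF(2)]] by blast
    then show ?thesis using that[of ?v] False by simp
  qed
  interpret C: edge_insertion G ?F A.\<rho>' c r ?w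
  proof
    show "partial_rotation G (hedges G ?F) A.\<rho>'" using A.new_partial_rotation by simp
    show "r \<in> hedges G ?F" "htail G r = dtail G c" using r(1) vF tails by auto
  qed (use wf F a c wF in auto)
  have "\<not> same_orbit ?\<phi> (hflip r) (hflip ?w)" using r(2) by simp
  note merge = C.same_orbit_merge[OF this]
  have "same_orbit (C.\<rho>' \<circ> hflip) x y" if "x \<in> C.D'" "y \<in> C.D'" for x y
  proof -
    have "same_orbit ?\<phi> (hflip r) (C.anchor z) \<or> same_orbit ?\<phi> (hflip ?w) (C.anchor z)"
      if "z \<in> {x, y}" for z
      using r(3)[OF C.anchor_in, of z] that \<open>x \<in> C.D'\<close> \<open>y \<in> C.D'\<close> unfolding hflip_simps by blast
    then show ?thesis using merge[OF that] by blast
  qed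
  then show ?thesis using C.new_partial_rotation unfolding one_face_on_def by blast
qed

text \<open>\<open>s\<close> assigns each edge of \<open>K\<close> to one of its ends. Even classes
  split into pairs of edges sharing the assigned vertex, and each pair keeps the embedding
  one-faced.\<close>

lemma one_face_on_add_even:
  assumes wf: "wf_graph G" and "one_face_on G F \<rho>" and "F \<subseteq> edges G" and "K \<subseteq> edges G" and "F \<inter> K = {}"
    and "\<And>e. e \<in> K \<Longrightarrow> s e \<in> {fst (ends G e), snd (ends G e)}"
    and "\<And>z. even (card {e \<in> K. s e = z})"
  shows "\<exists>\<rho>. one_face_on G (F \<union> K) \<rho>"
proof -
  have finK: "finite K" using assms(4) wf finite_subset by (auto simp: wf_graph_def)
  then show ?thesis using assms(2-)
  proof (induction "card K" arbitrary: K F \<rho> rule: less_induct)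
    case less
    show ?case
    proof (cases "K = {}")
      case True
      then show ?thesis using less.prems(2) by auto
    next
      case False
      then obtain g where g: "g \<in> K" by blast
      let ?X = "{e \<in> K. s e = s g}"
      have "finite ?X" "even (card ?X)" "g \<in> ?X" using less.prems g by auto
      then have "?X \<noteq> {g}" by (metis card_1_singleton_iff odd_one One_nat_def)
      then obtain h where h: "h \<in> K" "s h = s g" "h \<noteq> g" using g by auto
      obtain a where a: "fst a = g" "dtail G a = s g"
        using less.prems(6)[OF g] that[of "(g, s g = fst (ends G g))"] by (auto simp: dtail_def)
      obtain c where c: "fst c = h" "dtail G c = s g"
        using less.prems(6)[OF h(1)] h(2) that[of "(h, s h = fst (ends G h))"] by (auto simp: dtail_def)
      obtain \<rho>' where \<rho>': "one_face_on G (insert h (insert g F)) \<rho>'"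
        using one_face_on_insert_pair[OF wf less.prems(3,2), of a c] a c g h less.prems(4,5) by auto
      let ?K = "K - {g, h}"
      have "card ?K < card K" using g less.prems(1) by (intro psubset_card_mono) auto
      moreover have "even (card {e \<in> ?K. s e = z})" for z
      proof (cases "z = s g")
        case True
        have "{e \<in> ?K. s e = z} = ?X - {g, h}" using True by auto
        moreover have "card (?X - {g, h}) = card ?X - card {g, h}"
          using g h less.prems(1) by (intro card_Diff_subset) auto
        moreover have "card {g, h} = 2" using h(3) by auto
        ultimately show ?thesis using \<open>even (card ?X)\<close> by simp
      next
        case False
        then have "{e \<in> ?K. s e = z} = {e \<in> K. s e = z}" using h by auto
        then show ?thesis using less.prems(7) by simp
      qed
      ultimately have "\<exists>\<rho>. one_face_on G (insert h (insert g F) \<union> ?K) \<rho>"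
        using less.prems g h by (intro less.hyps[OF _ _ \<rho>']) auto
      moreover have "insert h (insert g F) \<union> ?K = F \<union> K" using g h by auto
      ultimately show ?thesis by simp
    qed
  qed
qed

lemma two_face_rotation:
  assumes wf: "wf_graph G" and T: "T \<subseteq> edges G"
    and forest: "\<And>d. fst d \<in> T \<Longrightarrow> (dtail G d, dtail G (dflip d)) \<notin> (adj_by G (T - {fst d}))\<^sup>*"
    and conn: "\<And>x y. x \<in> verts G \<Longrightarrow> y \<in> verts G \<Longrightarrow> (x, y) \<in> (adj_by G T)\<^sup>*"
    and f: "f \<in> edges G - T"
    and s: "\<And>e. e \<in> edges G - T - {f} \<Longrightarrow> s e \<in> {fst (ends G e), snd (ends G e)}"
    and ev: "\<And>z. even (card {e \<in> edges G - T - {f}. s e = z})"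
  obtains \<rho> where "rotation_system G \<rho>" "num_faces G \<rho> \<le> 2"
proof -
  obtain \<rho>0 where \<rho>0: "partial_rotation G (hedges G T) \<rho>0"
    "\<And>x y. x \<in> hedges G T \<Longrightarrow> y \<in> hedges G T \<Longrightarrow>
      (htail G x, htail G y) \<in> (adj_by G T)\<^sup>* \<Longrightarrow> same_orbit (\<rho>0 \<circ> hflip) x y"
    using partial_rotation_forest[OF wf T forest] by blast
  have "htail G x \<in> verts G" if "x \<in> hedges G T" for x
  proof (cases x)
    case (Inr d)
    then have "d \<in> darts G" using that T by (auto simp: darts_def mem_Times_iff)
    then show ?thesis using Inr dtail_in_verts[OF wf] by simp
  qed (use that in simp)
  then have "one_face_on G T \<rho>0" unfolding one_face_on_def using \<rho>0 conn by blast
  then obtain \<rho>1 where \<rho>1: "one_face_on G (T \<union> (edges G - T - {f})) \<rho>1"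
    using one_face_on_add_even[OF wf _ T, of \<rho>0 "edges G - T - {f}" s] s ev by blast
  let ?F = "edges G - {f}"
  have "T \<union> (edges G - T - {f}) = ?F" using T f by auto
  with \<rho>1 have pr: "partial_rotation G (hedges G ?F) \<rho>1"
    and one: "\<And>x y. x \<in> hedges G ?F \<Longrightarrow> y \<in> hedges G ?F \<Longrightarrow> same_orbit (\<rho>1 \<circ> hflip) x y"
    unfolding one_face_on_def by auto
  define d where "d = (f, True)"
  interpret edge_insertion G ?F \<rho>1 d "Inl (dtail G d)" "Inl (dtail G (dflip d))"
    using edge_insertion_Inl[OF wf _ pr, of d] f by (auto simp: d_def)
  have F: "insert (fst d) ?F = edges G" using f by (auto simp: d_def)
  let ?\<phi> = "\<rho>' \<circ> hflip" and ?w = "hflip (Inl (dtail G (dflip d)))"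
  have two: "same_orbit ?\<phi> ?w x \<or> same_orbit ?\<phi> (Inr d) x" if "x \<in> D'" for x
    using split_one_face(2)[OF one that] .
  have same: "same_orbit ?\<phi> u v" if "same_orbit ?\<phi> w u" "same_orbit ?\<phi> w v" "w \<in> D'" for u v w
    using same_orbit_trans[OF same_orbit_sym[OF fin bij_new_face_perm that(3,1)] that(2)] .
  have three: "same_orbit ?\<phi> x y \<or> same_orbit ?\<phi> y z \<or> same_orbit ?\<phi> x z"
    if "x \<in> D'" "y \<in> D'" "z \<in> D'" for x y z
    using two[OF that(1)] two[OF that(2)] two[OF that(3)] same[OF _ _ new_mem(4)] same[OF _ _ new_mem(1)]
    by meson
  have pr': "partial_rotation G (hedges G (edges G)) \<rho>'" using new_partial_rotation unfolding F .
  obtain \<rho> where \<rho>: "rotation_system G \<rho>"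
    "\<And>d d'. d \<in> darts G \<Longrightarrow> d' \<in> darts G \<Longrightarrow>
      same_orbit ?\<phi> (Inr d) (Inr d') \<Longrightarrow> same_orbit (\<rho> \<circ> dflip) d d'"
    using rotation_of_partial_rotation[OF wf pr'] by blast
  have "num_faces G \<rho> \<le> 2"
  proof (rule num_faces_le_2[OF wf \<rho>(1)])
    fix x y z assume d: "x \<in> darts G" "y \<in> darts G" "z \<in> darts G"
    then have "fst x \<in> edges G" "fst y \<in> edges G" "fst z \<in> edges G" by (auto simp: darts_def)
    then have "Inr x \<in> D'" "Inr y \<in> D'" "Inr z \<in> D'" unfolding F Inr_in_hedges .
    from three[OF this] \<rho>(2) d
    show "same_orbit (\<rho> \<circ> dflip) x y \<or> same_orbit (\<rho> \<circ> dflip) y z \<or> same_orbit (\<rho> \<circ> dflip) x z" by blast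
  qed
  then show ?thesis using that \<rho>(1) by blast
qed

section \<open>Assigning cotree edges to endpoints\<close>

text \<open>The nested inequality is an exclusive or: reassigning \<open>e\<close> flips the parity
  at its old and its new vertex, and nowhere if these coincide.\<close>

lemma parity_fun_upd:
  assumes "finite F" and "e \<in> F"
  shows "odd (card {g \<in> F. (s(e := q)) g = z}) \<longleftrightarrow>
    (odd (card {g \<in> F. s g = z}) \<noteq> ((s e = z) \<noteq> (q = z)))"
proof -
  let ?R = "{g \<in> F - {e}. s g = z}"
  have fin: "finite ?R" using assms by simp
  have "{g \<in> F. t g = z} = (if t e = z then insert e ?R else ?R)" if "\<And>g. g \<noteq> e \<Longrightarrow> t g = s g" for t
  proof -
    have "t g = z \<longleftrightarrow> s g = z" if "g \<noteq> e" for g using \<open>\<And>g. g \<noteq> e \<Longrightarrow> t g = s g\<close> that by simp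
    then have "g \<in> {g \<in> F. t g = z} \<longleftrightarrow> g \<in> (if t e = z then insert e ?R else ?R)" for g
      using assms(2) by (cases "g = e") auto
    then show ?thesis by blast
  qed
  from this[of s] this[of "s(e := q)"] fin show ?thesis by auto
qed

text \<open>Moving each edge of the walk to its other end flips the parity at both its ends, and the
  flips at interior vertices cancel. Edges may repeat, since the current assignment is updated at
  every step.\<close>

lemma reassign_along_walk:
  assumes F: "finite F" and s: "\<And>e. e \<in> F \<Longrightarrow> s e \<in> {fst (ends G e), snd (ends G e)}"
    and walk: "(x, y) \<in> (adj_by G F)\<^sup>*"
  shows "\<exists>t. (\<forall>e \<in> F. t e \<in> {fst (ends G e), snd (ends G e)}) \<and>
    (\<forall>z. odd (card {e \<in> F. t e = z}) \<longleftrightarrow> (odd (card {e \<in> F. s e = z}) \<noteq> ((z = x) \<noteq> (z = y))))"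
  using walk
proof (induction rule: rtrancl_induct)
  case base
  then show ?case using s by (intro exI[of _ s]) auto
next
  case (step y y')
  then obtain t where t: "\<And>e. e \<in> F \<Longrightarrow> t e \<in> {fst (ends G e), snd (ends G e)}"
    "\<And>z. odd (card {e \<in> F. t e = z}) \<longleftrightarrow> (odd (card {e \<in> F. s e = z}) \<noteq> ((z = x) \<noteq> (z = y)))" by blast
  obtain e where e: "e \<in> F" "joins G e y y'" using step(2) by (auto simp: adj_by_def)
  define q where "q = (if t e = y then y' else y)"
  have te: "(t e = y \<and> q = y') \<or> (t e = y' \<and> q = y)"
    using t(1)[OF e(1)] e(2) by (auto simp: joins_def q_def)
  have "\<forall>g \<in> F. (t(e := q)) g \<in> {fst (ends G g), snd (ends G g)}"
    using t(1) e te by (auto simp: joins_def)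
  moreover have "odd (card {g \<in> F. (t(e := q)) g = z}) \<longleftrightarrow>
    (odd (card {e \<in> F. s e = z}) \<noteq> ((z = x) \<noteq> (z = y')))" for z
    using parity_fun_upd[OF F e(1), of t q z] t(2)[of z] te by auto
  ultimately show ?case by blast
qed

text \<open>Take an assignment with as few odd vertices as possible. Two of them in one component
  could be repaired along a walk, so each component has at most one, and counting edges shows that a
  component with one is odd. The only odd component has the single edge \<open>e\<close>, whose
  removal leaves no odd vertex.\<close>

lemma even_assignment:
  assumes wf: "wf_graph G" and e: "e \<in> edges G - T"
    and oddc: "odd_components (cotree G T) = {comp_verts (cotree G T) (fst (ends G e))}"
    and compe: "comp_edges (cotree G T) (comp_verts (cotree G T) (fst (ends G e))) = {e}"
  obtains s where "\<And>g. g \<in> edges G - T - {e} \<Longrightarrow> s g \<in> {fst (ends G g), snd (ends G g)}"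
    and "\<And>z. even (card {g \<in> edges G - T - {e}. s g = z})"
proof -
  let ?H = "cotree G T" and ?F = "edges G - T"
  have finV: "finite (verts G)" and finF: "finite ?F" using wf by (auto simp: wf_graph_def)
  have adjH: "adj ?H = adj_by G ?F"
    by (auto simp: adj_def adj_by_def joins_def cotree_def delete_edges_def)
  define valid where "valid s \<longleftrightarrow> (\<forall>g \<in> ?F. s g \<in> {fst (ends G g), snd (ends G g)})" for s
  define Odd where "Odd s = {z \<in> verts G. odd (card {g \<in> ?F. s g = z})}" for s
  have "valid (\<lambda>g. fst (ends G g))" by (simp add: valid_def)
  then obtain s where s: "valid s" "\<And>t. valid t \<Longrightarrow> card (Odd s) \<le> card (Odd t)"
    using ex_has_least_nat[of valid _ "\<lambda>s. card (Odd s)"] by blast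
  have sep: "z = z'" if z: "z \<in> Odd s" "z' \<in> Odd s" "(z, z') \<in> (adj_by G ?F)\<^sup>*" for z z'
  proof (rule ccontr)
    assume ne: "z \<noteq> z'"
    obtain t where t: "valid t"
      "\<And>x. odd (card {e \<in> ?F. t e = x}) \<longleftrightarrow> (odd (card {e \<in> ?F. s e = x}) \<noteq> ((x = z) \<noteq> (x = z')))"
      using reassign_along_walk[OF finF, of s G z z'] s(1) z(3) unfolding valid_def by blast
    have "Odd t = Odd s - {z, z'}" using t(2) z ne unfolding Odd_def by auto
    then have "card (Odd t) < card (Odd s)"
      using z(1) finV by (intro psubset_card_mono) (auto simp: Odd_def)
    then show False using s(2)[OF t(1)] by simp
  qed
  have sF: "s g \<in> verts G" "(fst (ends G g), s g) \<in> (adj_by G ?F)\<^sup>*" "(s g, fst (ends G g)) \<in> (adj_by G ?F)\<^sup>*"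
    if g: "g \<in> ?F" for g
  proof -
    have sg: "s g = fst (ends G g) \<or> s g = snd (ends G g)" using s(1) g unfolding valid_def by auto
    then show "s g \<in> verts G" using g wf by (auto simp: wf_graph_def)
    have "joins G g (fst (ends G g)) (snd (ends G g))" by (simp add: joins_def)
    then have "(fst (ends G g), snd (ends G g)) \<in> adj_by G ?F" using g by (auto simp: adj_by_def)
    then show "(fst (ends G g), s g) \<in> (adj_by G ?F)\<^sup>*" using sg by auto
    then show "(s g, fst (ends G g)) \<in> (adj_by G ?F)\<^sup>*"
      using sym_rtrancl[OF sym_adj_by] by (metis symD)
  qed
  have comp_mem: "x \<in> comp_verts ?H v \<longleftrightarrow> x \<in> verts G \<and> (v, x) \<in> (adj_by G ?F)\<^sup>*" for x v
    unfolding comp_verts_def adjH by (simp add: cotree_def delete_edges_def)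
  \<comment> \<open>Both ends of a cotree edge lie in one component, so the edges of a component can
    be counted through the vertices assigned by \<open>s\<close>.\<close>
  have ce: "comp_edges ?H (comp_verts ?H v) = {g \<in> ?F. s g \<in> comp_verts ?H v}" for v
  proof -
    have "fst (ends G g) \<in> comp_verts ?H v \<longleftrightarrow> s g \<in> comp_verts ?H v" if g: "g \<in> ?F" for g
      using sF[OF g] wf g unfolding comp_mem by (auto simp: wf_graph_def intro: rtrancl_trans)
    then show ?thesis by (auto simp: comp_edges_def cotree_def delete_edges_def)
  qed
  let ?C = "comp_verts ?H (fst (ends G e))"
  have oddO: "z \<in> ?C" if z: "z \<in> Odd s" for z
  proof -
    let ?Z = "comp_verts ?H z"
    have zZ: "z \<in> ?Z" using z by (auto simp: comp_mem Odd_def)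
    have finZ: "finite ?Z" using finV by (rule finite_subset[rotated]) (auto simp: comp_mem)
    have "even (card {g \<in> ?F. s g = x})" if "x \<in> ?Z - {z}" for x
    proof -
      have "x \<in> verts G" "(z, x) \<in> (adj_by G ?F)\<^sup>*" "z \<noteq> x" using that comp_mem by auto
      then show ?thesis using sep[OF z, of x] unfolding Odd_def by blast
    qed
    then have "even (\<Sum>x \<in> ?Z - {z}. card {g \<in> ?F. s g = x})" by (intro dvd_sum) auto
    moreover have "odd (card {g \<in> ?F. s g = z})" using z by (simp add: Odd_def)
    moreover have "(\<Sum>x \<in> ?Z. card {g \<in> ?F. s g = x}) =
      card {g \<in> ?F. s g = z} + (\<Sum>x \<in> ?Z - {z}. card {g \<in> ?F. s g = x})"
      using finZ zZ by (rule sum.remove)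
    ultimately have "odd (\<Sum>x \<in> ?Z. card {g \<in> ?F. s g = x})" by simp
    moreover have "card (comp_edges ?H ?Z) = (\<Sum>x \<in> ?Z. card {g \<in> ?F. s g = x})"
    proof -
      have "{g \<in> ?F. s g \<in> ?Z} = (\<Union>x \<in> ?Z. {g \<in> ?F. s g = x})" by auto
      then show ?thesis unfolding ce using finZ wf[unfolded wf_graph_def] by (subst card_UN_disjoint[symmetric]) auto
    qed
    ultimately have "?Z \<in> odd_components ?H"
      using z unfolding odd_components_def by (auto simp: Odd_def cotree_def delete_edges_def)
    then show ?thesis using oddc zZ by auto
  qed
  show ?thesis
  proof (rule that[of s])
    show "s g \<in> {fst (ends G g), snd (ends G g)}" if "g \<in> ?F - {e}" for g
      using s(1) that unfolding valid_def by blast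
    fix z
    show "even (card {g \<in> ?F - {e}. s g = z})"
    proof (cases "z \<in> ?C")
      case True
      then have "g = e" if "g \<in> ?F" "s g = z" for g using ce[of "fst (ends G e)"] compe that by blast
      then have "{g \<in> ?F - {e}. s g = z} = {}" by blast
      then show ?thesis by (simp only: card.empty even_zero)
    next
      case False
      have "s e \<in> ?C" using ce[of "fst (ends G e)"] compe by blast
      then have "{g \<in> ?F - {e}. s g = z} = {g \<in> ?F. s g = z}" using False by auto
      moreover have "even (card {g \<in> ?F. s g = z})"
      proof (cases "z \<in> verts G")
        case True
        then show ?thesis using oddO[of z] False by (auto simp: Odd_def)
      next
        case False
        then have "{g \<in> ?F. s g = z} = {}" using sF(1) by auto
        then show ?thesis by (simp only: card.empty even_zero)
      qed
      ultimately show ?thesis by simp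
    qed
  qed
qed

section \<open>Connectivity and counting\<close>

text \<open>Serves to replace edges by detours and, with \<open>\<pi>\<close> collapsing one side of
  the sum, to project walks; an edge may map to an empty path.\<close>

lemma rtrancl_map:
  assumes "(p, q) \<in> R\<^sup>*" and "\<And>a b. (a, b) \<in> R \<Longrightarrow> (\<pi> a, \<pi> b) \<in> Q\<^sup>*"
  shows "(\<pi> p, \<pi> q) \<in> Q\<^sup>*"
  using assms(1) by (induction rule: rtrancl_induct) (auto intro: rtrancl_trans assms(2))

lemma joins_sym: "joins G e x y \<longleftrightarrow> joins G e y x"
  by (auto simp: joins_def)

lemma adj_sym: "(x, y) \<in> (adj G)\<^sup>* \<Longrightarrow> (y, x) \<in> (adj G)\<^sup>*"
proof -
  have "sym (adj G)" by (auto simp: sym_def adj_def joins_def)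
  then show "(x, y) \<in> (adj G)\<^sup>* \<Longrightarrow> (y, x) \<in> (adj G)\<^sup>*" using sym_rtrancl by (metis symD)
qed

lemma connected_graphI:
  assumes "c \<in> verts G" and "\<And>x. x \<in> verts G \<Longrightarrow> (c, x) \<in> (adj G)\<^sup>*"
  shows "connected_graph G"
  unfolding connected_graph_def using assms adj_sym rtrancl_trans by (metis empty_iff)

lemma connected_graphD: "connected_graph G \<Longrightarrow> x \<in> verts G \<Longrightarrow> y \<in> verts G \<Longrightarrow> (x, y) \<in> (adj G)\<^sup>*"
  by (simp add: connected_graph_def)

lemma delete_verts_simps [simp]:
  "verts (delete_verts G X) = verts G - X"
  "ends (delete_verts G X) = ends G"
  "dtail (delete_verts G X) = dtail G"
  "joins (delete_verts G X) = joins G"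
  by (auto simp: delete_verts_def dtail_def joins_def fun_eq_iff)

lemma in_edges_delete_verts:
  "e \<in> edges (delete_verts G X) \<longleftrightarrow> e \<in> edges G \<and> fst (ends G e) \<notin> X \<and> snd (ends G e) \<notin> X"
  by (simp add: delete_verts_def)

lemma in_darts_delete_verts:
  "d \<in> darts (delete_verts G X) \<longleftrightarrow> d \<in> darts G \<and> dtail G d \<notin> X \<and> dtail G (dflip d) \<notin> X"
  by (auto simp: darts_def mem_Times_iff in_edges_delete_verts dtail_def dflip_def)

lemma adj_delete_verts:
  "(a, b) \<in> adj (delete_verts G X) \<longleftrightarrow> (\<exists>e \<in> edges G. joins G e a b \<and> a \<notin> X \<and> b \<notin> X)"
  by (auto simp: adj_def joins_def delete_verts_def)

lemma wf_delete_verts: "wf_graph G \<Longrightarrow> wf_graph (delete_verts G X)"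
  by (auto simp: wf_graph_def delete_verts_def)

lemma delete_verts_empty: "delete_verts G {} = G"
  by (simp add: delete_verts_def)

lemma joins_in_verts: "wf_graph G \<Longrightarrow> e \<in> edges G \<Longrightarrow> joins G e x y \<Longrightarrow> x \<in> verts G \<and> y \<in> verts G"
  by (auto simp: wf_graph_def joins_def)

section \<open>Two-connected and cubic graphs\<close>

lemma two_connected_third_vertex:
  assumes "two_connected G"
  obtains z where "z \<in> verts G" "z \<noteq> x" "z \<noteq> y"
proof -
  have "\<not> verts G \<subseteq> {x, y}"
  proof
    assume "verts G \<subseteq> {x, y}"
    then have "card (verts G) \<le> card {x, y}" by (intro card_mono) auto
    also have "\<dots> \<le> 2" by (simp add: card_insert_if)
    finally show False using assms by (simp add: two_connected_def)
  qed
  then show ?thesis using that by blast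
qed

text \<open>For \<open>e\<close> joining \<open>a\<close> and \<open>b\<close>, a third vertex
  \<open>z\<close> is connected to \<open>b\<close> in the graph without \<open>a\<close>, and to
  \<open>a\<close> in the graph without \<open>b\<close>. Neither graph contains \<open>e\<close>,
  so \<open>e\<close> has a detour through \<open>z\<close>.\<close>

lemma two_connected_delete_edge:
  assumes G: "two_connected G" and wf: "wf_graph G" and e: "e \<in> edges G"
  shows "connected_graph (delete_edges G {e})"
proof -
  let ?H = "delete_edges G {e}"
  have H: "verts ?H = verts G" "adj ?H = {(a, b). \<exists>g \<in> edges G - {e}. joins G g a b}"
    by (auto simp: delete_edges_def adj_def joins_def)
  have avoid: "(p, q) \<in> (adj ?H)\<^sup>*"
    if "joins G e a b" "p \<in> verts G - {a}" "q \<in> verts G - {a}" for a b p q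
  proof -
    have "a \<in> verts G" using that joins_in_verts[OF wf e] by blast
    then have "(p, q) \<in> (adj (delete_verts G {a}))\<^sup>*"
      using G that unfolding two_connected_def by (auto intro!: connected_graphD)
    moreover have "adj (delete_verts G {a}) \<subseteq> adj ?H"
    proof (rule subrelI)
      fix p q assume "(p, q) \<in> adj (delete_verts G {a})"
      then obtain g where g: "g \<in> edges G" "joins G g p q" "p \<noteq> a" "q \<noteq> a"
        by (auto simp: adj_delete_verts)
      then have "g \<noteq> e" using that(1) by (auto simp: joins_def)
      then show "(p, q) \<in> adj ?H" using g by (auto simp: H)
    qed
    ultimately show ?thesis using rtrancl_mono by blast
  qed
  have joined: "(a, b) \<in> (adj ?H)\<^sup>*" if "joins G e a b" for a b
  proof (cases "a = b")
    case False
    obtain z where z: "z \<in> verts G" "z \<noteq> a" "z \<noteq> b" using two_connected_third_vertex[OF G] .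
    have ab: "a \<in> verts G" "b \<in> verts G" using that joins_in_verts[OF wf e] by blast+
    have "(z, b) \<in> (adj ?H)\<^sup>*" using avoid[OF that, of z b] z ab False by auto
    moreover have "(a, z) \<in> (adj ?H)\<^sup>*"
      using avoid[of b a a z] that joins_sym[of G e a b] z ab False by auto
    ultimately show ?thesis by (rule rtrancl_trans[rotated])
  qed simp
  have "(a, b) \<in> (adj ?H)\<^sup>*" if ab: "(a, b) \<in> adj G" for a b
  proof -
    obtain g where "g \<in> edges G" "joins G g a b" using ab by (auto simp: adj_def)
    then show ?thesis using joined by (cases "g = e") (auto simp: H)
  qed
  then have "(a, b) \<in> (adj ?H)\<^sup>*" if "(a, b) \<in> (adj G)\<^sup>*" for a b
    using rtrancl_map[OF that, of "\<lambda>x. x"] by simp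
  then show ?thesis using G unfolding two_connected_def connected_graph_def H by blast
qed

lemma deg_eq_card_darts:
  assumes "wf_graph G"
  shows "deg G v = card {d \<in> darts G. dtail G d = v}"
proof -
  let ?A = "(\<lambda>e. (e, True)) ` {e \<in> edges G. fst (ends G e) = v}"
  let ?B = "(\<lambda>e. (e, False)) ` {e \<in> edges G. snd (ends G e) = v}"
  have "{d \<in> darts G. dtail G d = v} = ?A \<union> ?B"
    by (auto simp: darts_def dtail_def split: if_splits)
  moreover have "card (?A \<union> ?B) = card ?A + card ?B"
    using assms by (intro card_Un_disjoint) (auto simp: wf_graph_def)
  moreover have "card ?A = card {e \<in> edges G. fst (ends G e) = v}"
    "card ?B = card {e \<in> edges G. snd (ends G e) = v}" by (auto intro!: card_image inj_onI)
  ultimately show ?thesis by (simp add: deg_def)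
qed

lemma connected_neighbour:
  assumes "connected_graph G" and "x \<in> verts G" "z \<in> verts G" "z \<noteq> x"
  obtains w where "(x, w) \<in> adj G" "w \<noteq> x"
proof -
  have "(x, z) \<in> (adj G)\<^sup>*" using assms connected_graphD by metis
  then have "z = x \<or> (\<exists>w. (x, w) \<in> adj G \<and> w \<noteq> x)"
    by (induction rule: rtrancl_induct) blast+
  then show ?thesis using that assms(4) by blast
qed

text \<open>A loop at \<open>x\<close> uses two of its three darts. Connectivity gives a neighbour
  \<open>w\<close>, and connectivity after deleting \<open>w\<close> a further one, so four darts
  would leave \<open>x\<close>.\<close>

lemma two_connected_cubic_no_loop:
  assumes G: "two_connected G" and cub: "cubic G" and e: "e \<in> edges G"
  shows "\<not> joins G e x x"
proof
  assume loop: "joins G e x x"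
  have wf: "wf_graph G" using cub by (simp add: cubic_def)
  have x: "x \<in> verts G" using joins_in_verts[OF wf e loop] by simp
  obtain z where z: "z \<in> verts G" "z \<noteq> x" using two_connected_third_vertex[OF G] by metis
  obtain w where w: "(x, w) \<in> adj G" "w \<noteq> x"
    using connected_neighbour[OF _ x z] G by (auto simp: two_connected_def)
  obtain g where g: "g \<in> edges G" "joins G g x w" using w by (auto simp: adj_def)
  have wV: "w \<in> verts G" using joins_in_verts[OF wf g] by simp
  obtain z' where z': "z' \<in> verts G" "z' \<noteq> x" "z' \<noteq> w" using two_connected_third_vertex[OF G] .
  have "connected_graph (delete_verts G {w})" using G wV by (simp add: two_connected_def)
  then obtain w' where w': "(x, w') \<in> adj (delete_verts G {w})" "w' \<noteq> x"
    by (rule connected_neighbour[of _ x z']) (use x z' w in auto)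
  then obtain g' where g': "g' \<in> edges G" "joins G g' x w'" "w' \<noteq> w" by (auto simp: adj_delete_verts)
  obtain d where d: "fst d = g" "dtail G d = x" "dtail G (dflip d) = w" using joins_dtailE[OF g(2)] .
  obtain d' where d': "fst d' = g'" "dtail G d' = x" "dtail G (dflip d') = w'" using joins_dtailE[OF g'(2)] .
  let ?L = "{d, d', (e, True), (e, False)}"
  have t: "dtail G (e, b) = x" for b using loop by (auto simp: joins_def dtail_def)
  have "fst d \<noteq> e" "fst d' \<noteq> e"
    using t[of "snd (dflip d)"] t[of "snd (dflip d')"] d d' w w'(2) by (metis fst_dflip prod.collapse)+
  moreover have "d \<noteq> d'" using d d' g'(3) by auto
  ultimately have "card ?L = 4" by (auto simp: card_insert_if)
  moreover have "?L \<subseteq> {d \<in> darts G. dtail G d = x}"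
    using d d' t e g g' by (auto simp: darts_def mem_Times_iff)
  then have "card ?L \<le> deg G x"
    unfolding deg_eq_card_darts[OF wf] using finite_darts[OF wf] by (intro card_mono) auto
  ultimately show False using cub x by (auto simp: cubic_def)
qed

lemma card_incident_edges:
  assumes "two_connected G" and cub: "cubic G" and "x \<in> verts G"
  shows "card {e \<in> edges G. x \<in> {fst (ends G e), snd (ends G e)}} = 3"
proof -
  have fin: "finite (edges G)" using cub by (simp add: cubic_def wf_graph_def)
  have "ends G e \<noteq> (x, x)" if "e \<in> edges G" for e
    using two_connected_cubic_no_loop[OF assms(1) cub that, of x] by (auto simp: joins_def)
  then have "{e \<in> edges G. fst (ends G e) = x} \<inter> {e \<in> edges G. snd (ends G e) = x} = {}"
    by (auto simp: prod_eq_iff)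
  moreover have "{e \<in> edges G. x \<in> {fst (ends G e), snd (ends G e)}} =
    {e \<in> edges G. fst (ends G e) = x} \<union> {e \<in> edges G. snd (ends G e) = x}" by auto
  ultimately have "card {e \<in> edges G. x \<in> {fst (ends G e), snd (ends G e)}} = deg G x"
    using fin by (simp add: card_Un_disjoint deg_def)
  then show ?thesis using cub assms(3) by (simp add: cubic_def)
qed

lemma betti_delete_vert:
  assumes "two_connected G" and cub: "cubic G" and x: "x \<in> verts G"
  shows "betti (delete_verts G {x}) = betti G - 2"
proof -
  let ?I = "{e \<in> edges G. x \<in> {fst (ends G e), snd (ends G e)}}"
  have fin: "finite (edges G)" "finite (verts G)" using cub by (simp_all add: cubic_def wf_graph_def)
  have "edges (delete_verts G {x}) = edges G - ?I" by (auto simp: in_edges_delete_verts)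
  moreover have "card (edges G - ?I) + 3 = card (edges G)"
    using card_incident_edges[OF assms] card_Diff_subset[of ?I "edges G"] card_mono[of "edges G" ?I] fin
    by auto
  moreover have "card (verts G - {x}) + 1 = card (verts G)"
    using x fin by (metis One_nat_def Suc_pred add.commute card_Diff_singleton card_gt_0_iff empty_iff plus_1_eq_Suc)
  ultimately show ?thesis unfolding betti_def delete_verts_simps by simp
qed

text \<open>Two cubic vertices sharing one edge meet \<open>3 + 3 - 1 = 5\<close> edges, so the rank
  drops by \<open>5 - 2 = 3\<close>.\<close>

lemma betti_delete_pair:
  assumes "two_connected G" and cub: "cubic G" and x: "x \<in> verts G" "y \<in> verts G" "x \<noteq> y"
    and one: "card {e \<in> edges G. joins G e x y} = 1"
  shows "betti (delete_verts G {x, y}) = betti G - 3"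
proof -
  let ?I = "\<lambda>x. {e \<in> edges G. x \<in> {fst (ends G e), snd (ends G e)}}"
  have fin: "finite (edges G)" "finite (verts G)" using cub by (simp_all add: cubic_def wf_graph_def)
  have "?I x \<inter> ?I y = {e \<in> edges G. joins G e x y}"
    using x(3) by (auto simp: joins_def prod_eq_iff)
  then have "card (?I x \<inter> ?I y) = 1" using one by simp
  then have "card (?I x \<union> ?I y) = 5"
    using card_incident_edges[OF assms(1,2) x(1)] card_incident_edges[OF assms(1,2) x(2)]
      card_Un_Int[of "?I x" "?I y"] fin by simp
  moreover have "card (edges G - (?I x \<union> ?I y)) = card (edges G) - card (?I x \<union> ?I y)"
    using fin by (intro card_Diff_subset) auto
  moreover have "card (?I x \<union> ?I y) \<le> card (edges G)" using fin by (intro card_mono) auto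
  ultimately have "card (edges G - (?I x \<union> ?I y)) + 5 = card (edges G)" by linarith
  moreover have "edges (delete_verts G {x, y}) = edges G - (?I x \<union> ?I y)"
    by (auto simp: in_edges_delete_verts)
  moreover have "card (verts G - {x, y}) = card (verts G) - card {x, y}"
    using x fin by (intro card_Diff_subset) auto
  moreover have "card {x, y} \<le> card (verts G)" using x fin by (intro card_mono) auto
  moreover have "card {x, y} = 2" using x by simp
  ultimately show ?thesis unfolding betti_def delete_verts_simps by simp
qed

text \<open>Connectivity with two distinct vertices excludes isolated vertices. The graph with one
  vertex and no edge has rank 0 but no face, so it must be kept out.\<close>

lemma num_faces_parity_connected:
  assumes wf: "wf_graph G" and conn: "connected_graph G" and ab: "a \<in> verts G" "b \<in> verts G" "a \<noteq> b"
    and rot: "rotation_system G \<rho>"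
  shows "even (betti G) \<longleftrightarrow> odd (num_faces G \<rho>)" and "num_faces G \<rho> > 0"
proof -
  have iso: "\<exists>d \<in> darts G. dtail G d = v" if v: "v \<in> verts G" for v
  proof -
    obtain z where "z \<in> verts G" "z \<noteq> v" using ab by metis
    then obtain w where "(v, w) \<in> adj G" using connected_neighbour[OF conn v] by metis
    then obtain e where "e \<in> edges G" "joins G e v w" by (auto simp: adj_def)
    then obtain d where "fst d = e" "dtail G d = v" using joins_dtailE by metis
    then show ?thesis using \<open>e \<in> edges G\<close> by (intro bexI[of _ d]) (auto simp: darts_def mem_Times_iff)
  qed
  then have "even (num_faces G \<rho> + card (verts G) + card (edges G))"
    using num_faces_parity[OF wf rot] by blast
  then show "even (betti G) \<longleftrightarrow> odd (num_faces G \<rho>)" unfolding betti_def by auto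
  have "darts G \<noteq> {}" using iso ab by blast
  then show "num_faces G \<rho> > 0" using finite_darts[OF wf] by (simp add: num_faces_def card_gt_0_iff)
qed

text \<open>If the ends of a tree edge were still joined without it, every walk could be rerouted
  and the edge would not be a bridge.\<close>

lemma spanning_treeD:
  assumes wf: "wf_graph G" and T: "spanning_tree G T"
  shows "T \<subseteq> edges G"
    and "x \<in> verts G \<Longrightarrow> y \<in> verts G \<Longrightarrow> (x, y) \<in> (adj_by G T)\<^sup>*"
    and "fst d \<in> T \<Longrightarrow> (dtail G d, dtail G (dflip d)) \<notin> (adj_by G (T - {fst d}))\<^sup>*"
proof -
  let ?K = "delete_edges G (edges G - T)"
  show sub: "T \<subseteq> edges G" using T by (simp add: spanning_tree_def)
  have adj: "adj ?K = adj_by G T" "adj (delete_edges ?K {e}) = adj_by G (T - {e})" for e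
    using sub by (auto simp: adj_def adj_by_def joins_def delete_edges_def)
  have conn: "connected_graph ?K" using T by (simp add: spanning_tree_def)
  have V: "verts ?K = verts G" "verts (delete_edges ?K {e}) = verts G" for e
    by (simp_all add: delete_edges_def)
  show reach: "(x, y) \<in> (adj_by G T)\<^sup>*" if "x \<in> verts G" "y \<in> verts G" for x y
    using connected_graphD[OF conn] that unfolding V adj by blast
  show "(dtail G d, dtail G (dflip d)) \<notin> (adj_by G (T - {fst d}))\<^sup>*" if d: "fst d \<in> T"
  proof
    let ?Q = "(adj_by G (T - {fst d}))\<^sup>*"
    assume in1: "(dtail G d, dtail G (dflip d)) \<in> ?Q"
    then have in2: "(dtail G (dflip d), dtail G d) \<in> ?Q"
      using sym_rtrancl[OF sym_adj_by] by (metis symD)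
    have "(a, b) \<in> ?Q" if ab: "(a, b) \<in> adj_by G T" for a b
    proof -
      obtain g where g: "g \<in> T" "joins G g a b" using ab by (auto simp: adj_by_def)
      show ?thesis
      proof (cases "g = fst d")
        case True
        then have "(a = dtail G d \<and> b = dtail G (dflip d)) \<or> (b = dtail G d \<and> a = dtail G (dflip d))"
          using g(2) by (auto simp: joins_def dtail_def dflip_def)
        then show ?thesis using in1 in2 by blast
      qed (use g in \<open>auto simp: adj_by_def\<close>)
    qed
    then have "(x, y) \<in> ?Q" if "(x, y) \<in> (adj_by G T)\<^sup>*" for x y
      using rtrancl_map[OF that, of "\<lambda>x. x"] by simp
    then have "connected_graph (delete_edges ?K {fst d})"
      using conn reach unfolding connected_graph_def V adj by blast
    then show False using T d by (simp add: spanning_tree_def is_bridge_def)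
  qed
qed

section \<open>The odd 2-sum\<close>

text \<open>The attachment vertices are named as the ends of \<open>e1\<close> and
  \<open>e2\<close>. The hypotheses are symmetric under exchanging the two sides and under
  exchanging the two new edges, so later arguments treat only \<open>G1\<close> and
  \<open>f1\<close>.\<close>

locale two_sum =
  fixes G1 G2 G :: "('v, 'e) mgraph" and e1 e2 f1 f2 :: 'e and x1 x2 y1 y2 :: 'v
  assumes conn1: "two_connected G1" and conn2: "two_connected G2"
    and cub1: "cubic G1" and cub2: "cubic G2" and cub: "cubic G"
    and disjV: "verts G1 \<inter> verts G2 = {}" and disjE: "edges G1 \<inter> edges G2 = {}"
    and V: "verts G = verts G1 \<union> verts G2"
    and e1: "e1 \<in> edges G1" and e2: "e2 \<in> edges G2"
    and f: "f1 \<noteq> f2" "f1 \<notin> edges G1 \<union> edges G2" "f2 \<notin> edges G1 \<union> edges G2"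
    and E: "edges G = (edges G1 - {e1}) \<union> (edges G2 - {e2}) \<union> {f1, f2}"
    and ends1: "\<And>e. e \<in> edges G1 - {e1} \<Longrightarrow> ends G e = ends G1 e"
    and ends2: "\<And>e. e \<in> edges G2 - {e2} \<Longrightarrow> ends G e = ends G2 e"
    and jf1: "joins G f1 x1 y1" and jf2: "joins G f2 x2 y2"
    and xV: "x1 \<in> verts G1" "x2 \<in> verts G1" and yV: "y1 \<in> verts G2" "y2 \<in> verts G2"
    and xy: "x1 \<noteq> x2" "y1 \<noteq> y2"
    and je1: "joins G1 e1 x1 x2" and je2: "joins G2 e2 y1 y2"

lemma two_sum_swap:
  "two_sum G1 G2 G e1 e2 f1 f2 x1 x2 y1 y2 \<Longrightarrow> two_sum G2 G1 G e2 e1 f1 f2 y1 y2 x1 x2"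
  unfolding two_sum_def by (simp add: Int_commute Un_commute joins_sym)

lemma two_sum_flip:
  "two_sum G1 G2 G e1 e2 f1 f2 x1 x2 y1 y2 \<Longrightarrow> two_sum G1 G2 G e1 e2 f2 f1 x2 x1 y2 y1"
  unfolding two_sum_def by (simp add: insert_commute) (metis joins_sym)

context two_sum
begin

lemma swap: "two_sum G2 G1 G e2 e1 f1 f2 y1 y2 x1 x2"
  by (rule two_sum_swap) (rule two_sum_axioms)

lemma flip: "two_sum G1 G2 G e1 e2 f2 f1 x2 x1 y2 y1"
  by (rule two_sum_flip) (rule two_sum_axioms)

lemma wf1: "wf_graph G1" and wf2: "wf_graph G2" and wf: "wf_graph G"
  using cub1 cub2 cub by (simp_all add: cubic_def)

lemma joins1: "e \<in> edges G1 - {e1} \<Longrightarrow> joins G e a b \<longleftrightarrow> joins G1 e a b"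
  using ends1 by (simp add: joins_def)

lemma joins2: "e \<in> edges G2 - {e2} \<Longrightarrow> joins G e a b \<longleftrightarrow> joins G2 e a b"
  using ends2 by (simp add: joins_def)

lemma edge_cases [consumes 2, case_names left right f1 f2]:
  assumes "e \<in> edges G" and "joins G e a b"
  obtains "e \<in> edges G1 - {e1}" "joins G1 e a b" "a \<in> verts G1" "b \<in> verts G1"
  | "e \<in> edges G2 - {e2}" "joins G2 e a b" "a \<in> verts G2" "b \<in> verts G2"
  | "e = f1" "(a = x1 \<and> b = y1) \<or> (a = y1 \<and> b = x1)"
  | "e = f2" "(a = x2 \<and> b = y2) \<or> (a = y2 \<and> b = x2)"
proof -
  consider "e \<in> edges G1 - {e1}" | "e \<in> edges G2 - {e2}" | "e = f1" | "e = f2" using assms(1) E by blast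
  then show thesis
  proof cases
    case 1
    then show ?thesis using that(1) assms(2) joins1[OF 1] joins_in_verts[OF wf1, of e a b] by blast
  next
    case 2
    then show ?thesis using that(2) assms(2) joins2[OF 2] joins_in_verts[OF wf2, of e a b] by blast
  next
    case 3
    then show ?thesis using that(3) assms(2) jf1 by (auto simp: joins_def)
  next
    case 4
    then show ?thesis using that(4) assms(2) jf2 by (auto simp: joins_def)
  qed
qed

text \<open>Two edges are lost and two gained, so edge and vertex numbers both add up. In particular
  two odd ranks give an odd rank.\<close>

lemma betti_sum: "betti G = betti G1 + betti G2 - 1"
proof -
  have fin: "finite (edges G1)" "finite (edges G2)" "finite (verts G1)" "finite (verts G2)"
    using wf1 wf2 by (simp_all add: wf_graph_def)
  have "card (verts G) = card (verts G1) + card (verts G2)"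
    unfolding V using fin disjV by (simp add: card_Un_disjoint)
  moreover have "card (edges G) = card ((edges G1 - {e1}) \<union> (edges G2 - {e2})) + card {f1, f2}"
    unfolding E using fin f by (intro card_Un_disjoint) auto
  moreover have "card ((edges G1 - {e1}) \<union> (edges G2 - {e2})) = card (edges G1 - {e1}) + card (edges G2 - {e2})"
    using fin disjE by (intro card_Un_disjoint) auto
  moreover have "card {f1, f2} = 2" using f by simp
  moreover have "card (edges G1 - {e1}) + 1 = card (edges G1)" "card (edges G2 - {e2}) + 1 = card (edges G2)"
    using fin e1 e2 card_Suc_Diff1 by fastforce+
  ultimately show ?thesis unfolding betti_def by simp
qed

section \<open>Connectivity of the sum after deletions\<close>

lemma reach2:
  assumes "X \<subseteq> verts G1" and "p \<in> verts G2" "q \<in> verts G2"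
  shows "(p, q) \<in> (adj (delete_verts G X))\<^sup>*"
proof -
  have "(p, q) \<in> (adj (delete_edges G2 {e2}))\<^sup>*"
    using connected_graphD[OF two_connected_delete_edge[OF conn2 wf2 e2]] assms(2,3)
    by (simp add: delete_edges_def)
  moreover have "adj (delete_edges G2 {e2}) \<subseteq> adj (delete_verts G X)"
  proof (rule subrelI)
    fix a b assume "(a, b) \<in> adj (delete_edges G2 {e2})"
    then obtain g where g: "g \<in> edges G2 - {e2}" "joins G2 g a b"
      by (auto simp: adj_def delete_edges_def joins_def)
    then have "a \<in> verts G2" "b \<in> verts G2" using joins_in_verts[OF wf2] by blast+
    then have "a \<notin> X" "b \<notin> X" using assms(1) disjV by blast+
    then show "(a, b) \<in> adj (delete_verts G X)"
      unfolding adj_delete_verts using g joins2[OF g(1)] E by blast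
  qed
  ultimately show ?thesis using rtrancl_mono by blast
qed

lemma f_adj:
  assumes "X \<subseteq> verts G1"
  shows "x1 \<notin> X \<Longrightarrow> (x1, y1) \<in> adj (delete_verts G X)" "x2 \<notin> X \<Longrightarrow> (x2, y2) \<in> adj (delete_verts G X)"
proof -
  have "y1 \<notin> X" "y2 \<notin> X" using assms yV disjV by auto
  then show "x1 \<notin> X \<Longrightarrow> (x1, y1) \<in> adj (delete_verts G X)" "x2 \<notin> X \<Longrightarrow> (x2, y2) \<in> adj (delete_verts G X)"
    unfolding adj_delete_verts using E jf1 jf2 by blast+
qed

text \<open>The lost edge \<open>e1\<close> is replaced by the detour over \<open>f1\<close>,
  through \<open>G2\<close> without \<open>e2\<close>, and back over \<open>f2\<close>. It is called
  for only if \<open>x1\<close> and \<open>x2\<close> both survive.\<close>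

lemma connected_delete_aux:
  assumes X: "X \<subseteq> verts G1" and conn: "connected_graph (delete_verts G1 X)" and x1: "x1 \<notin> X"
  shows "connected_graph (delete_verts G X)"
proof (rule connected_graphI)
  let ?H = "delete_verts G X"
  show "x1 \<in> verts ?H" using xV x1 V by simp
  have e1': "(x1, x2) \<in> (adj ?H)\<^sup>*" if "x2 \<notin> X"
    using r_into_rtrancl[OF f_adj(1)[OF X x1]] reach2[OF X yV]
      adj_sym[OF r_into_rtrancl[OF f_adj(2)[OF X that]]] by (meson rtrancl_trans)
  have step: "(a, b) \<in> (adj ?H)\<^sup>*" if ab: "(a, b) \<in> adj (delete_verts G1 X)" for a b
  proof -
    obtain g where g: "g \<in> edges G1" "joins G1 g a b" "a \<notin> X" "b \<notin> X" using ab by (auto simp: adj_delete_verts)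
    show ?thesis
    proof (cases "g = e1")
      case True
      then have "(a = x1 \<and> b = x2) \<or> (a = x2 \<and> b = x1)" using g je1 by (auto simp: joins_def)
      then show ?thesis using g(3,4) e1' adj_sym[OF e1'] by auto
    next
      case False
      then have "(a, b) \<in> adj ?H" unfolding adj_delete_verts using g joins1[of g] E by blast
      then show ?thesis by blast
    qed
  qed
  fix p assume "p \<in> verts ?H"
  then consider "p \<in> verts G1 - X" | "p \<in> verts G2" using V by auto
  then show "(x1, p) \<in> (adj ?H)\<^sup>*"
  proof cases
    case 1
    then have "(x1, p) \<in> (adj (delete_verts G1 X))\<^sup>*" using connected_graphD[OF conn] xV x1 by simp
    then show ?thesis using rtrancl_map[of x1 p _ "\<lambda>x. x"] step by simp
  next
    case 2
    show ?thesis using f_adj(1)[OF X x1] reach2[OF X yV(1) 2] by (rule converse_rtrancl_into_rtrancl)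
  qed
qed

lemma connected_delete:
  assumes "X \<subseteq> verts G1" and "connected_graph (delete_verts G1 X)" and "\<not> {x1, x2} \<subseteq> X"
  shows "connected_graph (delete_verts G X)"
  using connected_delete_aux[OF assms(1,2)] two_sum.connected_delete_aux[OF flip assms(1,2)] assms(3) by blast

lemma connected_delete_left: "v \<in> verts G1 \<Longrightarrow> connected_graph (delete_verts G {v})"
  using connected_delete[of "{v}"] conn1 xy by (auto simp: two_connected_def)

lemma two_connected_sum: "two_connected G"
  unfolding two_connected_def
proof (intro conjI ballI)
  have "finite (verts G)" using wf by (simp add: wf_graph_def)
  then have "card (verts G1) \<le> card (verts G)" using V by (intro card_mono) auto
  then show "3 \<le> card (verts G)" using conn1 by (simp add: two_connected_def)
  show "connected_graph G"
    using connected_delete[of "{}"] conn1 by (simp add: two_connected_def delete_verts_empty)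
  show "connected_graph (delete_verts G {v})" if "v \<in> verts G" for v
    using connected_delete_left two_sum.connected_delete_left[OF swap] that V by blast
qed

text \<open>Collapsing \<open>G2\<close> to \<open>x2\<close> turns \<open>f1\<close> into
  \<open>e1\<close> and contracts \<open>f2\<close>, so walks of the sum that avoid \<open>X\<close>
  project to such walks of \<open>G1\<close>.\<close>

lemma connected_left:
  assumes X: "X \<inter> verts G2 = {}" and conn: "connected_graph (delete_verts G X)" and x2: "x2 \<notin> X"
  shows "connected_graph (delete_verts G1 X)"
proof (rule connected_graphI)
  let ?A = "delete_verts G1 X" and ?H = "delete_verts G X"
  let ?\<pi> = "\<lambda>z. if z \<in> verts G1 then z else x2"
  show "x2 \<in> verts ?A" using xV x2 by simp
  fix p assume p: "p \<in> verts ?A"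
  have y: "y1 \<notin> verts G1" "y2 \<notin> verts G1" using yV disjV by auto
  have "(?\<pi> a, ?\<pi> b) \<in> (adj ?A)\<^sup>*" if ab: "(a, b) \<in> adj ?H" for a b
  proof -
    obtain g where g: "g \<in> edges G" "joins G g a b" and nX: "a \<notin> X" "b \<notin> X"
      using ab by (auto simp: adj_delete_verts)
    from g show ?thesis
    proof (cases rule: edge_cases)
      case left
      then have "(a, b) \<in> adj ?A" unfolding adj_delete_verts using nX by blast
      then show ?thesis using left by auto
    next
      case right
      then have "a \<notin> verts G1" "b \<notin> verts G1" using disjV by auto
      then show ?thesis by simp
    next
      case f1
      then have "x1 \<notin> X" using nX by auto
      then have "(x1, x2) \<in> adj ?A" unfolding adj_delete_verts using e1 je1 x2 by blast
      then show ?thesis using f1 y xV adj_sym[of x1 x2] by auto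
    next
      case f2
      then show ?thesis using y xV by auto
    qed
  qed
  from rtrancl_map[of x2 p "adj ?H" ?\<pi>, OF _ this]
  show "(x2, p) \<in> (adj ?A)\<^sup>*" using connected_graphD[OF conn, of x2 p] p xV x2 V by simp
qed

subsection \<open>The sum is two-face-embeddable\<close>

lemma adj_by_left: "F \<subseteq> edges G1 - {e1} \<Longrightarrow> adj_by G F = adj_by G1 F"
  using joins1 unfolding adj_by_def by blast

lemma adj_by_right: "F \<subseteq> edges G2 - {e2} \<Longrightarrow> adj_by G F = adj_by G2 F"
  using joins2 unfolding adj_by_def by blast

lemma dtail_left: "fst d \<in> edges G1 - {e1} \<Longrightarrow> dtail G d = dtail G1 d"
  using ends1 by (simp add: dtail_def)

text \<open>Collapsing \<open>G2\<close> to \<open>x1\<close> contracts \<open>f1\<close>, and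
  \<open>f2\<close> is not in the tree. A walk around a tree edge of \<open>G1\<close> would project
  to one within \<open>T1\<close>.\<close>

lemma forest_left:
  assumes T1: "T1 \<subseteq> edges G1 - {e1}" and T2: "T2 \<subseteq> edges G2 - {e2}" and d: "fst d \<in> T1"
    and forest: "(dtail G1 d, dtail G1 (dflip d)) \<notin> (adj_by G1 (T1 - {fst d}))\<^sup>*"
  shows "(dtail G d, dtail G (dflip d)) \<notin> (adj_by G (insert f1 (T1 \<union> T2) - {fst d}))\<^sup>*"
proof
  let ?\<pi> = "\<lambda>z. if z \<in> verts G1 then z else x1" and ?Q = "adj_by G1 (T1 - {fst d})"
  assume path: "(dtail G d, dtail G (dflip d)) \<in> (adj_by G (insert f1 (T1 \<union> T2) - {fst d}))\<^sup>*"
  have "(?\<pi> a, ?\<pi> b) \<in> ?Q\<^sup>*" if ab: "(a, b) \<in> adj_by G (insert f1 (T1 \<union> T2) - {fst d})" for a b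
  proof -
    obtain g where g: "g \<in> insert f1 (T1 \<union> T2)" "g \<noteq> fst d" "joins G g a b" using ab by (auto simp: adj_by_def)
    then have "g \<in> edges G" using T1 T2 E by auto
    then show ?thesis using g(3)
    proof (cases rule: edge_cases)
      case left
      then have "g \<in> T1" using g(1) T2 f disjE by auto
      then have "(a, b) \<in> ?Q" using left g(2) by (auto simp: adj_by_def)
      then show ?thesis using left by auto
    next
      case right
      then have "a \<notin> verts G1" "b \<notin> verts G1" using disjV by auto
      then show ?thesis by simp
    next
      case f1
      then show ?thesis using xV yV disjV by auto
    next
      case f2
      then show ?thesis using g(1) f T1 T2 by auto
    qed
  qed
  from rtrancl_map[OF path, of ?\<pi>, OF this]
  have "(?\<pi> (dtail G d), ?\<pi> (dtail G (dflip d))) \<in> ?Q\<^sup>*" .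
  moreover have "d \<in> darts G1" using d T1 by (auto simp: darts_def mem_Times_iff)
  then have "dtail G1 d \<in> verts G1" "dtail G1 (dflip d) \<in> verts G1"
    using dtail_in_verts[OF wf1] by simp_all
  moreover have "dtail G d = dtail G1 d" "dtail G (dflip d) = dtail G1 (dflip d)"
    using dtail_left[of d] dtail_left[of "dflip d"] d T1 by auto
  ultimately show False using forest by simp
qed

lemma forest_f1:
  assumes T1: "T1 \<subseteq> edges G1 - {e1}" and T2: "T2 \<subseteq> edges G2 - {e2}" and d: "fst d = f1"
  shows "(dtail G d, dtail G (dflip d)) \<notin> (adj_by G (insert f1 (T1 \<union> T2) - {fst d}))\<^sup>*"
proof
  \<comment> \<open>Every remaining tree edge keeps the side of a vertex, so the target relation can
    be empty.\<close>
  let ?\<pi> = "\<lambda>z. z \<in> verts G1"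
  assume path: "(dtail G d, dtail G (dflip d)) \<in> (adj_by G (insert f1 (T1 \<union> T2) - {fst d}))\<^sup>*"
  have "(?\<pi> a, ?\<pi> b) \<in> {}\<^sup>*" if ab: "(a, b) \<in> adj_by G (insert f1 (T1 \<union> T2) - {fst d})" for a b
  proof -
    obtain g where g: "g \<in> T1 \<union> T2" "joins G g a b" using ab d by (auto simp: adj_by_def)
    then have "g \<in> edges G" using T1 T2 E by auto
    then show ?thesis using g(2)
    proof (cases rule: edge_cases)
      case right
      then show ?thesis using disjV by auto
    qed (use g f T1 T2 in auto)
  qed
  from rtrancl_map[OF path, of ?\<pi>, OF this]
  have "dtail G d \<in> verts G1 \<longleftrightarrow> dtail G (dflip d) \<in> verts G1" by simp
  then show False
    using jf1 d xV yV disjV by (auto simp: joins_def dtail_def dflip_def split: if_splits)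
qed

lemma two_face_embeddable_sum:
  assumes T1: "spanning_tree G1 T1" "e1 \<notin> T1"
    "odd_components (cotree G1 T1) = {comp_verts (cotree G1 T1) (fst (ends G1 e1))}"
    "comp_edges (cotree G1 T1) (comp_verts (cotree G1 T1) (fst (ends G1 e1))) = {e1}"
    and T2: "spanning_tree G2 T2" "e2 \<notin> T2"
    "odd_components (cotree G2 T2) = {comp_verts (cotree G2 T2) (fst (ends G2 e2))}"
    "comp_edges (cotree G2 T2) (comp_verts (cotree G2 T2) (fst (ends G2 e2))) = {e2}"
    and odd: "odd (betti G1)" "odd (betti G2)"
  shows "two_face_embeddable G"
proof -
  note t1 = spanning_treeD[OF wf1 T1(1)] and t2 = spanning_treeD[OF wf2 T2(1)]
  have sub1: "T1 \<subseteq> edges G1 - {e1}" and sub2: "T2 \<subseteq> edges G2 - {e2}" using t1(1) t2(1) T1(2) T2(2) by auto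
  let ?T = "insert f1 (T1 \<union> T2)"
  have T: "?T \<subseteq> edges G" using sub1 sub2 E by auto
  have forest: "(dtail G d, dtail G (dflip d)) \<notin> (adj_by G (?T - {fst d}))\<^sup>*" if d: "fst d \<in> ?T" for d
  proof -
    consider "fst d = f1" | "fst d \<in> T1" | "fst d \<in> T2" using d by blast
    then show ?thesis
    proof cases
      case 1
      then show ?thesis using forest_f1[OF sub1 sub2] by blast
    next
      case 2
      then show ?thesis using forest_left[OF sub1 sub2 2 t1(3)[OF 2]] by blast
    next
      case 3
      then show ?thesis using two_sum.forest_left[OF swap sub2 sub1 3 t2(3)[OF 3]] by (simp add: Un_commute)
    qed
  qed
  have mono: "(a, b) \<in> (adj_by G ?T)\<^sup>*" if "(a, b) \<in> (adj_by G F)\<^sup>*" "F \<subseteq> ?T" for a b F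
    using that rtrancl_mono[of "adj_by G F" "adj_by G ?T"] by (auto simp: adj_by_def)
  have r1: "(a, b) \<in> (adj_by G ?T)\<^sup>*" if "a \<in> verts G1" "b \<in> verts G1" for a b
    using mono[of a b T1] t1(2)[OF that] adj_by_left[OF sub1] by auto
  have r2: "(a, b) \<in> (adj_by G ?T)\<^sup>*" if "a \<in> verts G2" "b \<in> verts G2" for a b
    using mono[of a b T2] t2(2)[OF that] adj_by_right[OF sub2] by auto
  have r3: "(x1, y1) \<in> (adj_by G ?T)\<^sup>*" "(y1, x1) \<in> (adj_by G ?T)\<^sup>*"
    using jf1 joins_sym[of G f1 x1 y1] by (auto simp: adj_by_def)
  have reach: "(a, b) \<in> (adj_by G ?T)\<^sup>*" if "a \<in> verts G" "b \<in> verts G" for a b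
  proof -
    have "(a, x1) \<in> (adj_by G ?T)\<^sup>*" using that(1) r1[of a x1] r2[of a y1] r3 V xV yV
      by (metis Un_iff rtrancl_trans)
    moreover have "(x1, b) \<in> (adj_by G ?T)\<^sup>*" using that(2) r1[of x1 b] r2[of y1 b] r3 V xV yV
      by (metis Un_iff rtrancl_trans)
    ultimately show ?thesis by (rule rtrancl_trans)
  qed
  obtain s1 where s1: "\<And>g. g \<in> edges G1 - T1 - {e1} \<Longrightarrow> s1 g \<in> {fst (ends G1 g), snd (ends G1 g)}"
    "\<And>z. even (card {g \<in> edges G1 - T1 - {e1}. s1 g = z})"
    using even_assignment[OF wf1 _ T1(3,4)] e1 T1(2) by blast
  obtain s2 where s2: "\<And>g. g \<in> edges G2 - T2 - {e2} \<Longrightarrow> s2 g \<in> {fst (ends G2 g), snd (ends G2 g)}"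
    "\<And>z. even (card {g \<in> edges G2 - T2 - {e2}. s2 g = z})"
    using even_assignment[OF wf2 _ T2(3,4)] e2 T2(2) by blast
  define s where "s g = (if g \<in> edges G1 then s1 g else s2 g)" for g
  let ?K1 = "edges G1 - T1 - {e1}" and ?K2 = "edges G2 - T2 - {e2}" and ?K = "edges G - ?T - {f2}"
  \<comment> \<open>As \<open>e1\<close> and \<open>e2\<close> are absent from the sum, the two even
    assignments together cover exactly its cotree edges other than \<open>f2\<close>.\<close>
  have K: "?K = ?K1 \<union> ?K2" using E f disjE sub1 sub2 by auto
  have s_valid: "s g \<in> {fst (ends G g), snd (ends G g)}" if "g \<in> ?K" for g
  proof (cases "g \<in> ?K1")
    case True
    then show ?thesis using s1(1)[OF True] ends1[of g] by (auto simp: s_def)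
  next
    case False
    then have g: "g \<in> ?K2" using that K by blast
    moreover have "g \<notin> edges G1" using g disjE by auto
    ultimately show ?thesis using s2(1)[OF g] ends2[of g] by (auto simp: s_def)
  qed
  have s_even: "even (card {g \<in> ?K. s g = z})" for z
  proof -
    have "{g \<in> ?K. s g = z} = {g \<in> ?K1. s1 g = z} \<union> {g \<in> ?K2. s2 g = z}"
      unfolding K using disjE by (auto simp: s_def)
    moreover have "card ({g \<in> ?K1. s1 g = z} \<union> {g \<in> ?K2. s2 g = z}) =
      card {g \<in> ?K1. s1 g = z} + card {g \<in> ?K2. s2 g = z}"
      using wf1 wf2 disjE by (intro card_Un_disjoint) (auto simp: wf_graph_def)
    ultimately show ?thesis using s1(2)[of z] s2(2)[of z] by (simp only: even_add)
  qed
  have f2: "f2 \<in> edges G - ?T" using E f sub1 sub2 by auto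
  obtain \<rho> where \<rho>: "rotation_system G \<rho>" "num_faces G \<rho> \<le> 2"
    using two_face_rotation[OF wf T forest reach f2 s_valid s_even] by blast
  have "odd (betti G)" using betti_sum odd by simp
  moreover have "connected_graph G" using two_connected_sum by (simp add: two_connected_def)
  ultimately show ?thesis
    using xi_le_1_if_two_faces[OF wf \<rho>] cub wf
    by (simp add: two_face_embeddable_def upper_embeddable_def)
qed

subsection \<open>The sum has no removable pair\<close>

text \<open>The Boolean selects the dart of \<open>f1\<close> with tail \<open>x1\<close>, the one
  pointing from \<open>G1\<close> to \<open>G2\<close>.\<close>

definition "b1 = (f1, fst (ends G f1) = x1)"
definition "b2 = (f2, fst (ends G f2) = x2)"

lemma b_tails: "dtail G b1 = x1" "dtail G (dflip b1) = y1" "dtail G b2 = x2" "dtail G (dflip b2) = y2"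
proof -
  have "x1 \<noteq> y1" "x2 \<noteq> y2" using xV yV disjV by auto
  moreover have "dtail G (e, fst (ends G e) = a) = a \<and> dtail G (dflip (e, fst (ends G e) = a)) = b"
    if "joins G e a b" "a \<noteq> b" for e a b
    using that by (cases "ends G e = (a, b)") (simp_all add: joins_def dtail_def dflip_def)
  ultimately show "dtail G b1 = x1" "dtail G (dflip b1) = y1" "dtail G b2 = x2" "dtail G (dflip b2) = y2"
    using jf1 jf2 unfolding b1_def b2_def by blast+
qed

lemma b_fst: "fst b1 = f1" "fst b2 = f2"
  by (simp_all add: b1_def b2_def)

text \<open>Lists the half-edges on the \<open>G1\<close> side of the cut, as input for the two
  cutting lemmas. \<open>X\<close> may meet both sides, as it does for a pair across the
  cut.\<close>

lemma darts_from_left: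
  "d \<in> darts_from (delete_verts G X) (verts (delete_verts G1 X)) \<longleftrightarrow>
    (d \<in> darts (delete_verts G1 X) \<and> fst d \<noteq> e1) \<or>
    (d = b1 \<and> x1 \<notin> X \<and> y1 \<notin> X) \<or> (d = b2 \<and> x2 \<notin> X \<and> y2 \<notin> X)"
proof -
  have L: "d \<in> darts_from (delete_verts G X) (verts (delete_verts G1 X)) \<longleftrightarrow>
    fst d \<in> edges G \<and> dtail G d \<in> verts G1 \<and> dtail G d \<notin> X \<and> dtail G (dflip d) \<notin> X"
    unfolding darts_from_def mem_Collect_eq in_darts_delete_verts delete_verts_simps
    by (auto simp: darts_def mem_Times_iff)
  have R: "d \<in> darts (delete_verts G1 X) \<and> fst d \<noteq> e1 \<longleftrightarrow>
    fst d \<in> edges G1 - {e1} \<and> dtail G1 d \<notin> X \<and> dtail G1 (dflip d) \<notin> X"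
    unfolding in_darts_delete_verts by (auto simp: darts_def mem_Times_iff)
  have y: "y1 \<notin> verts G1" "y2 \<notin> verts G1" using yV disjV by auto
  have b: "fst d = fst b \<Longrightarrow> d = b \<or> d = dflip b" for b by (cases d; cases b) (auto simp: dflip_def)
  show ?thesis
  proof (cases "fst d \<in> edges G")
    case False
    then show ?thesis unfolding L R using E b_fst by auto
  next
    case True
    from True dtail_dflip_joins[of G d] show ?thesis
    proof (cases rule: edge_cases)
      case left
      then have t: "dtail G d = dtail G1 d" "dtail G (dflip d) = dtail G1 (dflip d)"
        using dtail_left[of d] dtail_left[of "dflip d"] by simp_all
      have "d \<noteq> b1" "d \<noteq> b2" using left f b_fst by auto
      then show ?thesis unfolding L R using left t True by auto
    next
      case right
      then have "d \<noteq> b1" "d \<noteq> b2" "fst d \<notin> edges G1" "dtail G d \<notin> verts G1"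
        using f b_fst disjE disjV by auto
      then show ?thesis unfolding L R by auto
    next
      case f1
      then have "d = b1 \<or> d = dflip b1" using b[of b1] b_fst by simp
      moreover have "d \<noteq> b2" "fst d \<notin> edges G1" using f1 f b_fst by auto
      ultimately show ?thesis unfolding L R using True y xV b_tails by auto
    next
      case f2
      then have "d = b2 \<or> d = dflip b2" using b[of b2] b_fst by simp
      moreover have "d \<noteq> b1" "fst d \<notin> edges G1" using f2 f b_fst by auto
      ultimately show ?thesis unfolding L R using True y xV b_tails by auto
    qed
  qed
qed

lemma ends_delete_left:
  "e \<in> edges (delete_verts G1 X) \<Longrightarrow> e \<noteq> e1 \<Longrightarrow> ends (delete_verts G1 X) e = ends (delete_verts G X) e"
  using ends1 by (simp add: in_edges_delete_verts)

text \<open>Deleting \<open>x1\<close> destroys both \<open>e1\<close> and \<open>f1\<close>, so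
  \<open>f2\<close> is the only connection left between the sides.\<close>

lemma one_face_left:
  assumes H: "rotation_system (delete_verts G X) \<rho>" "num_faces (delete_verts G X) \<rho> \<le> 1"
    and X: "x1 \<in> X" "x2 \<notin> X" "y2 \<notin> X"
  obtains \<rho>' where "rotation_system (delete_verts G1 X) \<rho>'" "num_faces (delete_verts G1 X) \<rho>' \<le> 1"
proof -
  let ?A = "delete_verts G1 X"
  have e1: "e1 \<notin> edges ?A" using je1 X(1) by (auto simp: in_edges_delete_verts joins_def)
  then have "d \<in> darts ?A \<Longrightarrow> fst d \<noteq> e1" for d by (auto simp: darts_def)
  then have S: "darts_from (delete_verts G X) (verts ?A) = insert b2 (darts ?A)"
    using darts_from_left[of _ X] X by blast
  have b: "b2 \<notin> darts ?A" using b_fst f by (auto simp: darts_def in_edges_delete_verts)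
  have ends: "ends ?A e = ends (delete_verts G X) e" if "e \<in> edges ?A" for e
    using ends_delete_left[OF that] that e1 by blast
  show ?thesis
    using one_face_bridge_side[OF wf_delete_verts[OF wf] H wf_delete_verts[OF wf1] ends S b] that by blast
qed

lemma two_faces_left_aux:
  assumes H: "rotation_system (delete_verts G X) \<rho>" "num_faces (delete_verts G X) \<rho> \<le> 1"
    and X: "x1 \<notin> X" "y1 \<notin> X" "x2 \<notin> X" "y2 \<notin> X" and e: "ends G1 e1 = (x1, x2)"
  obtains \<rho>' where "rotation_system (delete_verts G1 X) \<rho>'" "num_faces (delete_verts G1 X) \<rho>' \<le> 2"
proof -
  let ?A = "delete_verts G1 X"
  have e1A: "e1 \<in> edges ?A" using e X e1 by (simp add: in_edges_delete_verts)
  have "d \<in> darts ?A \<and> fst d \<noteq> e1 \<longleftrightarrow> d \<in> (edges ?A - {e1}) \<times> UNIV" for d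
    by (auto simp: darts_def mem_Times_iff)
  then have S: "darts_from (delete_verts G X) (verts ?A) = {b1, b2} \<union> (edges ?A - {e1}) \<times> UNIV"
    using darts_from_left[of _ X] X by blast
  show ?thesis
  proof (rule two_faces_replace_side[OF wf_delete_verts[OF wf] H wf_delete_verts[OF wf1] e1A _ S])
    show "ends ?A g = ends (delete_verts G X) g" if "g \<in> edges ?A" "g \<noteq> e1" for g
      using ends_delete_left that by blast
    show "b1 \<noteq> b2" using f b_fst by auto
    show "b2 \<noteq> dflip b1" using f b_fst by (metis fst_dflip)
    show "fst b1 \<notin> edges ?A - {e1}" "fst b2 \<notin> edges ?A - {e1}"
      using f b_fst by (auto simp: in_edges_delete_verts)
    show "dtail ?A (e1, True) = dtail (delete_verts G X) b1" "dtail ?A (e1, False) = dtail (delete_verts G X) b2"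
      using b_tails e unfolding delete_verts_simps by (simp_all add: dtail_def)
  qed (use that in blast)
qed

text \<open>If \<open>e1\<close> is oriented from \<open>x2\<close> to \<open>x1\<close>, the
  auxiliary lemma is used with \<open>f1\<close> and \<open>f2\<close> exchanged.\<close>

lemma two_faces_left:
  assumes H: "rotation_system (delete_verts G X) \<rho>" "num_faces (delete_verts G X) \<rho> \<le> 1"
    and X: "x1 \<notin> X" "y1 \<notin> X" "x2 \<notin> X" "y2 \<notin> X"
  obtains \<rho>' where "rotation_system (delete_verts G1 X) \<rho>'" "num_faces (delete_verts G1 X) \<rho>' \<le> 2"
proof -
  have "ends G1 e1 = (x1, x2) \<or> ends G1 e1 = (x2, x1)" using je1 by (simp add: joins_def)
  then show ?thesis
    using two_faces_left_aux[OF H X] two_sum.two_faces_left_aux[OF flip H X(3,4,1,2)] that by blast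
qed

lemma removable_pair_one_face:
  assumes odd: "odd (betti G)" and rem: "removable_pair G x y"
  obtains \<rho> where "rotation_system (delete_verts G {x, y}) \<rho>" "num_faces (delete_verts G {x, y}) \<rho> \<le> 1"
proof -
  let ?H = "delete_verts G {x, y}"
  have "betti ?H = betti G - 3"
    using betti_delete_pair[OF two_connected_sum cub] rem by (simp add: removable_pair_def)
  then have "even (betti ?H)" using odd by simp
  moreover have "wf_graph ?H" "xi ?H \<le> 1" using rem by (simp_all add: removable_pair_def upper_embeddable_def)
  ultimately show ?thesis using one_face_if_xi_le_1[of ?H] rotation_system_exists[of ?H] that by blast
qed

text \<open>Since \<open>x2\<close> survives, \<open>e1\<close> does not join \<open>x\<close> and
  \<open>y\<close>, so \<open>G1\<close> and the sum have the same edges between them. Whether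
  \<open>x1\<close> survives decides between the cut with one edge and the cut with two.\<close>

lemma removable_pair_left:
  assumes odd: "odd (betti G)" "odd (betti G1)" and rem: "removable_pair G x y"
    and V1: "x \<in> verts G1" "y \<in> verts G1" and x2: "x2 \<notin> {x, y}"
  shows "removable_pair G1 x y"
proof -
  let ?X = "{x, y}"
  let ?A = "delete_verts G1 ?X"
  have y: "y1 \<notin> ?X" "y2 \<notin> ?X" "?X \<inter> verts G2 = {}" using V1 yV disjV by auto
  have ne: "x \<noteq> y" using rem by (simp add: removable_pair_def)
  have "{e \<in> edges G1. joins G1 e x y} = {e \<in> edges G. joins G e x y}"
  proof (intro set_eqI iffI)
    fix e assume "e \<in> {e \<in> edges G1. joins G1 e x y}"
    then have e: "e \<in> edges G1" "joins G1 e x y" by auto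
    moreover have "e \<noteq> e1" using e je1 x2 by (auto simp: joins_def)
    ultimately show "e \<in> {e \<in> edges G. joins G e x y}" using joins1[of e] E by auto
  next
    fix e assume "e \<in> {e \<in> edges G. joins G e x y}"
    then have "e \<in> edges G" "joins G e x y" by auto
    then show "e \<in> {e \<in> edges G1. joins G1 e x y}"
      by (cases rule: edge_cases) (use V1 disjV yV in auto)
  qed
  then have single: "card {e \<in> edges G1. joins G1 e x y} = 1" using rem by (simp add: removable_pair_def)
  have conn: "connected_graph ?A"
    using connected_left[OF y(3) _ x2] rem by (simp add: removable_pair_def upper_embeddable_def)
  obtain \<rho> where \<rho>: "rotation_system (delete_verts G ?X) \<rho>" "num_faces (delete_verts G ?X) \<rho> \<le> 1"
    using removable_pair_one_face[OF odd(1) rem] .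
  have "\<exists>\<rho>'. rotation_system ?A \<rho>' \<and> num_faces ?A \<rho>' \<le> 1"
  proof (cases "x1 \<in> ?X")
    case True
    show ?thesis using one_face_left[OF \<rho> True x2 y(2)] by blast
  next
    case False
    obtain \<rho>' where \<rho>': "rotation_system ?A \<rho>'" "num_faces ?A \<rho>' \<le> 2"
      using two_faces_left[OF \<rho> False y(1) x2 y(2)] .
    have "even (betti ?A)" using betti_delete_pair[OF conn1 cub1 V1 ne single] odd(2) by simp
    moreover have "x1 \<in> verts ?A" "x2 \<in> verts ?A" using xV False x2 by auto
    ultimately have "odd (num_faces ?A \<rho>')"
      using num_faces_parity_connected(1)[OF wf_delete_verts[OF wf1] conn _ _ xy(1) \<rho>'(1)] by blast
    then have "num_faces ?A \<rho>' \<noteq> 2" by auto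
    then show ?thesis using \<rho>' by (intro exI[of _ \<rho>']) auto
  qed
  then have "xi ?A \<le> 1" using xi_le_1_if_one_face[OF wf_delete_verts[OF wf1]] by blast
  moreover have "\<not> is_bridge G1 e" if "e \<in> edges G1" for e
    using two_connected_delete_edge[OF conn1 wf1 that] by (simp add: is_bridge_def)
  ultimately show ?thesis
    using V1 ne single conn wf_delete_verts[OF wf1]
    by (simp add: removable_pair_def upper_embeddable_def)
qed

text \<open>Without \<open>x1\<close> and \<open>x2\<close> no edge joins the two sides, while a
  third vertex of \<open>G1\<close> survives on one and \<open>y1\<close> on the other.\<close>

lemma not_removable_attachments: "\<not> removable_pair G x1 x2"
proof
  assume "removable_pair G x1 x2"
  then have conn: "connected_graph (delete_verts G {x1, x2})"
    by (simp add: removable_pair_def upper_embeddable_def)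
  obtain p where p: "p \<in> verts G1" "p \<noteq> x1" "p \<noteq> x2" using two_connected_third_vertex[OF conn1] .
  have "y1 \<in> verts G - {x1, x2}" "p \<in> verts G - {x1, x2}" using p yV xV disjV V by auto
  then have "(p, y1) \<in> (adj (delete_verts G {x1, x2}))\<^sup>*" using connected_graphD[OF conn] by simp
  then have "y1 \<in> verts G1"
  proof (induction rule: rtrancl_induct)
    case (step a b)
    then obtain g where g: "g \<in> edges G" "joins G g a b" "a \<notin> {x1, x2}" "b \<notin> {x1, x2}"
      unfolding adj_delete_verts by blast
    from g(1,2) show ?case by (cases rule: edge_cases) (use g(3,4) step(3) disjV in auto)
  qed (rule p)
  then show False using yV disjV by blast
qed

lemma removable_pair_sym: "removable_pair G x y \<longleftrightarrow> removable_pair G y x"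
  unfolding removable_pair_def by (auto simp: insert_commute joins_sym)

lemma not_removable_left:
  assumes "odd (betti G)" "odd (betti G1)" and "\<And>x y. \<not> removable_pair G1 x y"
    and "x \<in> verts G1" "y \<in> verts G1"
  shows "\<not> removable_pair G x y"
proof
  assume rem: "removable_pair G x y"
  consider "x2 \<notin> {x, y}" | "x1 \<notin> {x, y}" | "x = x1" "y = x2" | "x = x2" "y = x1" using xy by auto
  then show False
  proof cases
    case 1
    then show ?thesis using removable_pair_left[OF assms(1,2) rem assms(4,5)] assms(3) by blast
  next
    case 2
    then show ?thesis
      using two_sum.removable_pair_left[OF flip assms(1,2) rem assms(4,5)] assms(3) by blast
  next
    case 3
    then show ?thesis using not_removable_attachments rem by blast
  next
    case 4
    then show ?thesis using not_removable_attachments rem removable_pair_sym by blast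
  qed
qed

lemma not_removable_f1:
  assumes odd: "odd (betti G)" "odd (betti G1)"
  shows "\<not> removable_pair G x1 y1"
proof
  assume rem: "removable_pair G x1 y1"
  obtain \<rho> where \<rho>: "rotation_system (delete_verts G {x1, y1}) \<rho>" "num_faces (delete_verts G {x1, y1}) \<rho> \<le> 1"
    using removable_pair_one_face[OF odd(1) rem] .
  have "x2 \<notin> {x1, y1}" "y2 \<notin> {x1, y1}" using xy xV yV disjV by auto
  then obtain \<rho>' where \<rho>': "rotation_system (delete_verts G1 {x1, y1}) \<rho>'" "num_faces (delete_verts G1 {x1, y1}) \<rho>' \<le> 1"
    using one_face_left[OF \<rho>] by blast
  let ?A = "delete_verts G1 {x1}"
  have "y1 \<notin> verts G1" using yV disjV by auto
  \<comment> \<open>\<open>y1\<close> is not a vertex of \<open>G1\<close>, so no edge of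
    \<open>G1\<close> is lost with it.\<close>
  then have "delete_verts G1 {x1, y1} = ?A"
    using wf1 unfolding delete_verts_def wf_graph_def by auto
  then have A: "rotation_system ?A \<rho>'" "num_faces ?A \<rho>' \<le> 1" using \<rho>' by simp_all
  obtain z where "z \<in> verts G1" "z \<noteq> x1" "z \<noteq> x2" using two_connected_third_vertex[OF conn1] .
  then have ab: "x2 \<in> verts ?A" "z \<in> verts ?A" "x2 \<noteq> z" using xV xy by auto
  have "connected_graph ?A" using conn1 xV by (simp add: two_connected_def)
  note par = num_faces_parity_connected[OF wf_delete_verts[OF wf1] this ab A(1)]
  have "odd (betti ?A)" using betti_delete_vert[OF conn1 cub1 xV(1)] odd(2) by simp
  then have "even (num_faces ?A \<rho>')" using par(1) by blast
  then show False using par(2) A(2) by (metis One_nat_def le_antisym Suc_leI odd_one)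
qed

text \<open>A removable pair is joined by an edge, and only \<open>f1\<close> and \<open>f2\<close>
  cross between the sides.\<close>

lemma not_removable_cross:
  assumes odd: "odd (betti G)" "odd (betti G1)" and xy: "x \<in> verts G1" "y \<in> verts G2"
  shows "\<not> removable_pair G x y"
proof
  assume rem: "removable_pair G x y"
  then have "card {e \<in> edges G. joins G e x y} = 1" by (simp add: removable_pair_def)
  then have "{e \<in> edges G. joins G e x y} \<noteq> {}" by (metis card.empty zero_neq_one)
  then obtain e where "e \<in> edges G" "joins G e x y" by blast
  then show False
  proof (cases rule: edge_cases)
    case f1
    then have "x = x1" "y = y1" using xy xV yV disjV by auto
    then show ?thesis using rem not_removable_f1[OF odd] by simp
  next
    case f2
    then have "x = x2" "y = y2" using xy xV yV disjV by auto
    then show ?thesis using rem two_sum.not_removable_f1[OF flip odd] by simp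
  qed (use xy disjV in auto)
qed

end

lemma cubic_deg_delete_edge:
  assumes "cubic G" and "e \<in> edges G" and "x \<in> verts G" and "deg (delete_edges G {e}) x = 2"
  shows "x = fst (ends G e) \<or> x = snd (ends G e)"
proof (rule ccontr)
  assume "\<not> ?thesis"
  then have "deg (delete_edges G {e}) x = deg G x"
    unfolding deg_def delete_edges_def by (auto intro!: arg_cong2[where f = "(+)"] arg_cong[where f = card])
  then show False using assms by (simp add: cubic_def)
qed

text \<open>Deleting \<open>e1\<close> lowers the degree only at its ends, so the 2-valent vertices
  of \<open>G1\<close> are ends of \<open>e1\<close>. Independence of \<open>f1\<close> and
  \<open>f2\<close> makes the two attachment vertices distinct, hence \<open>e1\<close> joins them;
  likewise for \<open>e2\<close>.\<close>

lemma odd_two_sum_imp_two_sum: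
  assumes "two_connected G1" "two_connected G2" and sum: "odd_two_sum G1 e1 G2 e2 G"
  obtains f1 f2 x1 x2 y1 y2 where "two_sum G1 G2 G e1 e2 f1 f2 x1 x2 y1 y2"
proof -
  have odd_e: "odd_edge G1 e1" "odd_edge G2 e2" using sum by (simp_all add: odd_two_sum_def)
  then have cub12: "cubic G1" "cubic G2" and e: "e1 \<in> edges G1" "e2 \<in> edges G2"
    by (simp_all add: odd_edge_def tightly_two_face_embeddable_def two_face_embeddable_def)
  obtain f1 f2 where f: "f1 \<noteq> f2" "f1 \<notin> edges G1 \<union> edges G2" "f2 \<notin> edges G1 \<union> edges G2"
    "edges G = (edges G1 - {e1}) \<union> (edges G2 - {e2}) \<union> {f1, f2}"
    "\<forall>e \<in> edges G1 - {e1}. ends G e = ends G1 e" "\<forall>e \<in> edges G2 - {e2}. ends G e = ends G2 e"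
    and ex: "\<forall>f \<in> {f1, f2}. \<exists>x y. joins G f x y \<and>
            x \<in> verts G1 \<and> deg (delete_edges G1 {e1}) x = 2 \<and>
            y \<in> verts G2 \<and> deg (delete_edges G2 {e2}) y = 2"
    and ind: "{fst (ends G f1), snd (ends G f1)} \<inter> {fst (ends G f2), snd (ends G f2)} = {}"
    and cub: "cubic G"
    using sum unfolding odd_two_sum_def by (elim conjE exE) blast
  obtain x1 y1 where 1: "joins G f1 x1 y1" "x1 \<in> verts G1" "deg (delete_edges G1 {e1}) x1 = 2"
    "y1 \<in> verts G2" "deg (delete_edges G2 {e2}) y1 = 2" using ex by blast
  obtain x2 y2 where 2: "joins G f2 x2 y2" "x2 \<in> verts G1" "deg (delete_edges G1 {e1}) x2 = 2"
    "y2 \<in> verts G2" "deg (delete_edges G2 {e2}) y2 = 2" using ex by blast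
  have ne: "x1 \<noteq> x2" "y1 \<noteq> y2" using ind 1(1) 2(1) by (auto simp: joins_def)
  have "joins G1 e1 x1 x2" "joins G2 e2 y1 y2"
    using cubic_deg_delete_edge[OF cub12(1) e(1) 1(2,3)] cubic_deg_delete_edge[OF cub12(1) e(1) 2(2,3)]
      cubic_deg_delete_edge[OF cub12(2) e(2) 1(4,5)] cubic_deg_delete_edge[OF cub12(2) e(2) 2(4,5)] ne
    by (auto simp: joins_def prod_eq_iff)
  moreover have "verts G1 \<inter> verts G2 = {}" "edges G1 \<inter> edges G2 = {}" "verts G = verts G1 \<union> verts G2"
    using sum by (simp_all add: odd_two_sum_def)
  ultimately have "two_sum G1 G2 G e1 e2 f1 f2 x1 x2 y1 y2"
    using assms(1,2) cub12 cub e f 1 2 ne by (intro two_sum.intro) simp_all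
  then show ?thesis using that by blast
qed

theorem theorem18:
  fixes G1 G2 G :: "('v, 'e) mgraph" and e1 e2 :: 'e
  assumes "two_connected G1" and "two_connected G2"
    and "tightly_two_face_embeddable G1" and "tightly_two_face_embeddable G2"
    and "odd_edge G1 e1" and "odd_edge G2 e2"
    and "odd_two_sum G1 e1 G2 e2 G"
  shows "two_connected G \<and> tightly_two_face_embeddable G"
proof -
  obtain f1 f2 x1 x2 y1 y2 where S: "two_sum G1 G2 G e1 e2 f1 f2 x1 x2 y1 y2"
    using odd_two_sum_imp_two_sum[OF assms(1,2,7)] .
  then interpret two_sum G1 G2 G e1 e2 f1 f2 x1 x2 y1 y2 .
  have odd: "odd (betti G1)" "odd (betti G2)"
    and tight: "\<And>x y. \<not> removable_pair G1 x y" "\<And>x y. \<not> removable_pair G2 x y"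
    using assms(3,4) by (auto simp: tightly_two_face_embeddable_def two_face_embeddable_def)
  obtain T1 where T1: "spanning_tree G1 T1" "e1 \<notin> T1"
    "odd_components (cotree G1 T1) = {comp_verts (cotree G1 T1) (fst (ends G1 e1))}"
    "comp_edges (cotree G1 T1) (comp_verts (cotree G1 T1) (fst (ends G1 e1))) = {e1}"
    using assms(5) unfolding odd_edge_def xuong_tree_def by blast
  obtain T2 where T2: "spanning_tree G2 T2" "e2 \<notin> T2"
    "odd_components (cotree G2 T2) = {comp_verts (cotree G2 T2) (fst (ends G2 e2))}"
    "comp_edges (cotree G2 T2) (comp_verts (cotree G2 T2) (fst (ends G2 e2))) = {e2}"
    using assms(6) unfolding odd_edge_def xuong_tree_def by blast
  have tf: "two_face_embeddable G" using two_face_embeddable_sum[OF T1 T2 odd] .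
  then have oG: "odd (betti G)" by (simp add: two_face_embeddable_def)
  have "\<not> removable_pair G x y" for x y
  proof
    assume rem: "removable_pair G x y"
    then have "x \<in> verts G1 \<union> verts G2" "y \<in> verts G1 \<union> verts G2" using V by (simp_all add: removable_pair_def)
    then consider "x \<in> verts G1" "y \<in> verts G1" | "x \<in> verts G2" "y \<in> verts G2"
      | "x \<in> verts G1" "y \<in> verts G2" | "x \<in> verts G2" "y \<in> verts G1" by blast
    then show False
    proof cases
      case 1
      then show ?thesis using not_removable_left[OF oG odd(1) tight(1)] rem by blast
    next
      case 2
      then show ?thesis using two_sum.not_removable_left[OF swap oG odd(2) tight(2)] rem by blast
    next
      case 3
      then show ?thesis using not_removable_cross[OF oG odd(1)] rem by blast
    next
      case 4
      then show ?thesis using not_removable_cross[OF oG odd(1), of y x] rem removable_pair_sym by blast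
    qed
  qed
  then show ?thesis using two_connected_sum tf by (simp add: tightly_two_face_embeddable_def)
qed

end
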